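(* Consider the OPE associated with ${\rm d}\mu_0(x)=\frac{\sqrt{4-x^2}}{2\pi}\chi_{[-2,2]}(x)\,{\rm d}x$ (recurrence coefficients $a_n\equiv1$, $b_n\equiv0$). Fix $x_0\in(-2,2)$ and $0<\alpha<1$. Let $N\in\mathbb{N}$, $\eta_1,\dots,\eta_N\in\mathbb{C}$ with $\operatorname{Im}\eta_j>0$, $c_1,\dots,c_N\in\mathbb{R}$, and $f(x)=\sum_{j=1}^Nc_j\operatorname{Im}\frac{1}{x-\eta_j}$. Then $$X^{(n)}_{f,\alpha,x_0}-\mathbb{E}X^{(n)}_{f,\alpha,x_0}\to N(0,\sigma_f^2)$$ in distribution, where $\sigma_f^2=\frac{1}{4\pi^2}\iint_{\mathbb{R}^2}\left(\frac{f(x)-f(y)}{x-y}\right)^2{\rm d}x\,{\rm d}y$.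
   Context: The OPE of size $n$ for a measure $\mu$ is the probability measure on $\mathbb{R}^n$ proportional to $\prod_{i<j}(x_i-x_j)^2\,{\rm d}\mu(x_1)\cdots{\rm d}\mu(x_n)$; $X^{(n)}_{f,\alpha,x_0}=\sum_{j=1}^nf(n^\alpha(x_j-x_0))$ and $\mathbb{E}$ is expectation under the OPE. *)

theory Defs
  imports "HOL-Probability.Probability"
begin

definition mu0_density :: "real \<Rightarrow> real" where
  "mu0_density x = indicator {-2..2} x * sqrt (4 - x\<^sup>2) / (2 * pi)"

definition ope_weight :: "nat \<Rightarrow> (nat \<Rightarrow> real) \<Rightarrow> real" where
  "ope_weight n x =
     (\<Prod>i<n. \<Prod>j<n. if i < j then (x i - x j)\<^sup>2 else 1) * (\<Prod>i<n. mu0_density (x i))"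

definition ope_Z :: "nat \<Rightarrow> real" where
  "ope_Z n = integral\<^sup>L (PiM {..<n} (\<lambda>_. lborel)) (ope_weight n)"

definition ope :: "nat \<Rightarrow> (nat \<Rightarrow> real) measure" where
  "ope n = density (PiM {..<n} (\<lambda>_. lborel)) (\<lambda>x. ennreal (ope_weight n x / ope_Z n))"

definition lin_stat :: "(real \<Rightarrow> real) \<Rightarrow> real \<Rightarrow> real \<Rightarrow> nat \<Rightarrow> (nat \<Rightarrow> real) \<Rightarrow> real" where
  "lin_stat f \<alpha> x0 n x = (\<Sum>j<n. f (real n powr \<alpha> * (x j - x0)))"

definition gaussian0 :: "real \<Rightarrow> real measure" where
  "gaussian0 s2 = (if s2 = 0 then return borel 0
                   else density lborel (normal_density 0 (sqrt s2)))"

definition sigma2 :: "(real \<Rightarrow> real) \<Rightarrow> real" where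
  "sigma2 f = 1 / (4 * pi\<^sup>2) *
     integral\<^sup>L (lborel :: (real \<times> real) measure) (\<lambda>(x, y). ((f x - f y) / (x - y))\<^sup>2)"

end

theory Submission
  imports Defs "HOL-Complex_Analysis.Complex_Analysis" "HOL-Real_Asymp.Real_Asymp"
    "Jordan_Normal_Form.Char_Poly"
begin

text \<open>
  Write \<open>y = z + 1/z\<close> with \<open>|z| = 1\<close>. By Cauchy's determinant and Andreief's identity, for any \<open>n\<close>
  points \<open>x\<^sub>k\<close> of the unit disc,
  \<open>E \<Prod>\<^sub>i \<Prod>\<^sub>k 1 / (1 + x\<^sub>k\<^sup>2 - x\<^sub>k y\<^sub>i) = \<Prod>\<^sub>k\<^sub><\<^sub>l 1 / (1 - x\<^sub>k x\<^sub>l)\<close>,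
  because \<open>\<integral> U\<^sub>j(y) / (1 + x\<^sup>2 - x y) d\<mu>\<^sub>0 = x\<^sup>j\<close> for the Chebyshev polynomials of the second kind.
  If the test function is \<open>v\<^sub>0 + V(z) + V(1/z)\<close> with \<open>V(z) = \<Sum>\<^sub>k v\<^sub>k z\<^sup>k\<close>, then on the mesoscopic scale
  \<open>V\<close> is bounded on a disc of radius \<open>1 + c n\<^sup>-\<^sup>\<alpha>\<close>, so the Taylor polynomial \<open>\<Prod>\<^sub>k (1 - x\<^sub>k z)\<close> of
  degree \<open>n\<close> approximates \<open>exp (- \<tau> V)\<close> up to an error of order \<open>exp (- c n\<^sup>1\<^sup>-\<^sup>\<alpha>)\<close>. Expanding
  \<open>\<Prod>\<^sub>k\<^sub><\<^sub>l (1 - x\<^sub>k x\<^sub>l)\<close> in power sums, whose values are \<open>k \<tau> v\<^sub>k\<close> up to that error, gives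
  \<open>E exp (\<tau> X) \<approx> exp (n \<tau> v\<^sub>0 + \<tau>\<^sup>2/2 \<Sum>\<^sub>k k v\<^sub>k\<^sup>2 - \<tau> \<Sum>\<^sub>k v\<^sub>2\<^sub>k)\<close> for every complex \<open>\<tau>\<close>.
  For resolvents the \<open>v\<^sub>k\<close> are explicit and \<open>\<Sum>\<^sub>k k v\<^sub>k\<^sup>2\<close> tends to the stated variance.
\<close>

section \<open>Determinants\<close>

hide_const (open) Determinants.det

definition pair_prod :: "nat \<Rightarrow> (nat \<Rightarrow> nat \<Rightarrow> 'a::comm_monoid_mult) \<Rightarrow> 'a" where
  "pair_prod n g = (\<Prod>i<n. \<Prod>j<n. if i < j then g i j else 1)"

lemma pair_prod_0 [simp]: "pair_prod 0 g = 1"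
  by (simp add: pair_prod_def)

lemma pair_prod_1 [simp]: "pair_prod n (\<lambda>_ _. 1) = 1"
  by (simp add: pair_prod_def)

lemma pair_prod_Suc: "pair_prod (Suc n) g = pair_prod n g * (\<Prod>i<n. g i n)"
proof -
  have "(\<Prod>j<n. if n < j then g n j else 1) = 1"
    by (intro prod.neutral) auto
  then show ?thesis
    by (simp add: pair_prod_def prod.distrib)
qed

lemma pair_prod_cong:
  assumes "\<And>i j. i < j \<Longrightarrow> j < n \<Longrightarrow> g i j = h i j"
  shows "pair_prod n g = pair_prod n h"
  unfolding pair_prod_def using assms by (intro prod.cong refl) auto

lemma pair_prod_mult: "pair_prod n (\<lambda>i j. g i j * h i j) = pair_prod n g * pair_prod n h"
  by (induction n) (simp_all add: pair_prod_Suc prod.distrib mult_ac)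

lemma pair_prod_divide:
  fixes g h :: "nat \<Rightarrow> nat \<Rightarrow> 'a::field"
  shows "pair_prod n (\<lambda>i j. g i j / h i j) = pair_prod n g / pair_prod n h"
  by (induction n) (simp_all add: pair_prod_Suc prod_dividef)

lemma pair_prod_nonzero:
  fixes g :: "nat \<Rightarrow> nat \<Rightarrow> 'a::idom"
  assumes "\<And>i j. i < j \<Longrightarrow> j < n \<Longrightarrow> g i j \<noteq> 0"
  shows "pair_prod n g \<noteq> 0"
  using assms unfolding pair_prod_def by auto

lemma tendsto_pair_prod:
  fixes g :: "nat \<Rightarrow> nat \<Rightarrow> 'b \<Rightarrow> 'a::real_normed_field"
  assumes "\<And>i j. i < j \<Longrightarrow> j < n \<Longrightarrow> ((\<lambda>x. g i j x) \<longlongrightarrow> L i j) F"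
  shows "((\<lambda>x. pair_prod n (\<lambda>i j. g i j x)) \<longlongrightarrow> pair_prod n L) F"
  unfolding pair_prod_def using assms by (intro tendsto_prod) auto

lemma pair_prod_symmetric_mult:
  "pair_prod n (\<lambda>i j. x i * x j) = (\<Prod>i<n. x i) ^ (n - 1)"
proof (induction n)
  case (Suc n)
  have "(\<Prod>i<n. x i) ^ (n - 1) * (\<Prod>i<n. x i) = (\<Prod>i<n. x i) ^ n"
    by (cases n) (simp_all add: mult.commute)
  then show ?case
    using Suc by (simp add: pair_prod_Suc prod.distrib power_mult_distrib flip: mult.assoc)
qed simp

lemma prod_offdiag_eq_pair_prod:
  "(\<Prod>k<n. \<Prod>l\<in>{..<n} - {k}. g k l) = pair_prod n (\<lambda>k l. g k l * g l k)"
proof (induction n)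
  case (Suc n)
  have "(\<Prod>l\<in>{..<Suc n} - {k}. g k l) = g k n * (\<Prod>l\<in>{..<n} - {k}. g k l)" if "k < n" for k
  proof -
    have "{..<Suc n} - {k} = insert n ({..<n} - {k})" using that by auto
    then show ?thesis by simp
  qed
  moreover have "{..<Suc n} - {n} = {..<n}" by auto
  ultimately show ?case
    using Suc by (simp add: pair_prod_Suc prod.distrib mult_ac)
qed simp

definition vandermonde :: "nat \<Rightarrow> (nat \<Rightarrow> 'a::comm_ring_1) \<Rightarrow> 'a" where
  "vandermonde n x = pair_prod n (\<lambda>i j. x j - x i)"

lemma vandermonde_nonzero:
  fixes x :: "nat \<Rightarrow> 'a::idom"
  assumes "inj_on x {..<n}"
  shows "vandermonde n x \<noteq> 0"
  unfolding vandermonde_def by (intro pair_prod_nonzero) (auto dest!: inj_onD[OF assms])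

lemma det_mat_eq_sum_permutations:
  fixes a :: "nat \<Rightarrow> nat \<Rightarrow> 'a::comm_ring_1"
  shows "det (mat n n (\<lambda>(i, j). a i j)) = (\<Sum>p | p permutes {..<n}. signof p * (\<Prod>i<n. a i (p i)))"
  by (subst det_def'[of _ n])
     (auto simp: lessThan_atLeast0 intro!: sum.cong prod.cong dest: permutes_in_image)

lemma det_mat_scale:
  fixes a :: "nat \<Rightarrow> nat \<Rightarrow> 'a::comm_ring_1"
  shows "det (mat n n (\<lambda>(i, j). r i * c j * a i j)) =
         (\<Prod>i<n. r i) * (\<Prod>j<n. c j) * det (mat n n (\<lambda>(i, j). a i j))"
  unfolding det_mat_eq_sum_permutations sum_distrib_left
proof (intro sum.cong refl)
  fix p assume "p \<in> {p. p permutes {..<n}}"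
  then have "(\<Prod>i<n. c (p i)) = (\<Prod>j<n. c j)"
    using prod.permute[of p "{..<n}" c] by (simp add: comp_def)
  then show "signof p * (\<Prod>i<n. r i * c (p i) * a i (p i)) =
             (\<Prod>i<n. r i) * (\<Prod>j<n. c j) * (signof p * (\<Prod>i<n. a i (p i)))"
    by (simp add: prod.distrib mult_ac)
qed

lemma det_poly_eval:
  fixes p :: "nat \<Rightarrow> 'a::comm_ring_1 poly"
  assumes "\<And>j. j < n \<Longrightarrow> degree (p j) < n"
  shows "det (mat n n (\<lambda>(i, j). poly (p j) (x i))) =
         det (mat n n (\<lambda>(i, j). x i ^ j)) * det (mat n n (\<lambda>(k, j). coeff (p j) k))"
proof -
  have "mat n n (\<lambda>(i, j). poly (p j) (x i)) =
        mat n n (\<lambda>(i, j). x i ^ j) * mat n n (\<lambda>(k, j). coeff (p j) k)"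
    (is "_ = ?V * ?C")
  proof (rule eq_matI)
    fix i j assume "i < dim_row (?V * ?C)" "j < dim_col (?V * ?C)"
    then have ij: "i < n" "j < n" by auto
    have "poly (p j) (x i) = (\<Sum>k\<le>degree (p j). coeff (p j) k * x i ^ k)"
      by (simp add: poly_altdef)
    also have "\<dots> = (\<Sum>k=0..<n. coeff (p j) k * x i ^ k)"
      using assms[OF ij(2)] by (intro sum.mono_neutral_left) (auto simp: coeff_eq_0)
    finally show "mat n n (\<lambda>(i, j). poly (p j) (x i)) $$ (i, j) = (?V * ?C) $$ (i, j)"
      using ij by (simp add: scalar_prod_def mult.commute)
  qed auto
  then show ?thesis
    by (simp add: det_mult[of _ n])
qed

lemma det_monic_poly_coeffs:
  fixes p :: "nat \<Rightarrow> 'a::comm_ring_1 poly"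
  assumes deg: "\<And>j. degree (p j) \<le> j" and monic: "\<And>j. coeff (p j) j = 1"
  shows "det (mat n n (\<lambda>(k, j). coeff (p j) k)) = 1"
proof -
  have "det (mat n n (\<lambda>(k, j). coeff (p j) k)) = prod_list (diag_mat (mat n n (\<lambda>(k, j). coeff (p j) k)))"
    by (rule det_upper_triangular[where n=n])
       (auto simp: upper_triangular_def intro!: coeff_eq_0 le_less_trans[OF deg])
  also have "\<dots> = 1"
    by (simp add: prod_list_diag_prod monic)
  finally show ?thesis .
qed

lemma det_monic_poly_eval_eq_powers:
  fixes p :: "nat \<Rightarrow> 'a::comm_ring_1 poly"
  assumes "\<And>j. degree (p j) \<le> j" "\<And>j. coeff (p j) j = 1"
  shows "det (mat n n (\<lambda>(i, j). poly (p j) (x i))) = det (mat n n (\<lambda>(i, j). x i ^ j))"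
  using assms by (subst det_poly_eval) (auto simp: det_monic_poly_coeffs intro: le_less_trans)

lemma det_vandermonde:
  fixes x :: "nat \<Rightarrow> 'a::idom"
  shows "det (mat n n (\<lambda>(i, j). x i ^ j)) = vandermonde n x"
proof (induction n)
  case 0
  then show ?case by (simp add: vandermonde_def)
next
  case (Suc n)
  define q where "q = (\<Prod>i<n. [:- x i, 1:])"
  have "degree q = n"
    unfolding q_def by (subst degree_prod_eq_sum_degree) auto
  moreover have "lead_coeff q = 1"
    unfolding q_def by (simp add: lead_coeff_prod)
  ultimately have q: "degree q = n" "coeff q n = 1" by simp_all
  \<comment> \<open>Replacing the last column by the values of \<open>q\<close> is unimodular and kills all its entries but the last.\<close>
  define p where "p j = (if j = n then q else monom 1 j)" for j
  let ?A = "mat (Suc n) (Suc n) (\<lambda>(i, j). poly (p j) (x i))"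
  have "det (mat (Suc n) (Suc n) (\<lambda>(i, j). x i ^ j)) = det ?A"
    by (rule det_monic_poly_eval_eq_powers[symmetric]) (auto simp: p_def q degree_monom_eq)
  also have "\<dots> = (\<Sum>i<Suc n. ?A $$ (i, n) * cofactor ?A i n)"
    by (rule laplace_expansion_column) auto
  also have "\<dots> = poly q (x n) * cofactor ?A n n"
  proof -
    have "poly q (x i) = 0" if "i < n" for i
      using that by (auto simp: q_def poly_prod intro!: prod_zero bexI[of _ i])
    then show ?thesis by (simp add: p_def)
  qed
  also have "cofactor ?A n n = vandermonde n x"
  proof -
    have "mat_delete ?A n n = mat n n (\<lambda>(i, j). x i ^ j)"
      by (rule eq_matI) (auto simp: mat_delete_def p_def poly_monom)
    then show ?thesis
      using Suc by (simp add: cofactor_def)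
  qed
  also have "poly q (x n) = (\<Prod>i<n. x n - x i)"
    by (simp add: q_def poly_prod)
  finally show ?case
    by (simp add: vandermonde_def pair_prod_Suc mult.commute)
qed

definition lagrange_poly :: "nat \<Rightarrow> (nat \<Rightarrow> 'a::comm_ring_1) \<Rightarrow> nat \<Rightarrow> 'a poly" where
  "lagrange_poly n w k = (\<Prod>l\<in>{..<n} - {k}. [:w l, - 1:])"

lemma poly_lagrange_poly: "poly (lagrange_poly n w k) u = (\<Prod>l\<in>{..<n} - {k}. w l - u)"
  by (simp add: lagrange_poly_def poly_prod)

lemma degree_lagrange_poly_less:
  assumes "k < n"
  shows "degree (lagrange_poly n w k) < n"
proof -
  have "degree (lagrange_poly n w k) \<le> sum (degree \<circ> (\<lambda>l. [:w l, - 1:])) ({..<n} - {k})"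
    unfolding lagrange_poly_def by (rule degree_prod_sum_le) auto
  also have "\<dots> \<le> (\<Sum>l\<in>{..<n} - {k}. 1)"
    by (intro sum_mono) auto
  also have "\<dots> < n" using assms by (simp add: card_Diff_singleton)
  finally show ?thesis .
qed

lemma det_lagrange_poly_eval:
  fixes w :: "nat \<Rightarrow> 'a::idom"
  assumes "inj_on w {..<n}"
  shows "det (mat n n (\<lambda>(i, j). poly (lagrange_poly n w j) (u i))) =
         vandermonde n u * pair_prod n (\<lambda>k l. w k - w l)"
proof -
  define d where "d = det (mat n n (\<lambda>(k, j). coeff (lagrange_poly n w j) k))"
  have eval: "det (mat n n (\<lambda>(i, j). poly (lagrange_poly n w j) (u i))) = vandermonde n u * d" for u
    unfolding d_def by (subst det_poly_eval) (auto simp: degree_lagrange_poly_less det_vandermonde)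
  \<comment> \<open>At the nodes \<open>w\<^sub>i\<close> themselves the matrix is diagonal, which determines \<open>d\<close>.\<close>
  have "vandermonde n w * d = prod_list (diag_mat (mat n n (\<lambda>(i, j). poly (lagrange_poly n w j) (w i))))"
    unfolding eval[symmetric]
    by (rule det_upper_triangular[where n=n])
       (auto simp: upper_triangular_def poly_lagrange_poly intro!: prod_zero)
  also have "\<dots> = (\<Prod>k<n. \<Prod>l\<in>{..<n} - {k}. w l - w k)"
    by (simp add: prod_list_diag_prod lessThan_atLeast0 poly_lagrange_poly)
  also have "\<dots> = vandermonde n w * pair_prod n (\<lambda>k l. w k - w l)"
    by (simp add: prod_offdiag_eq_pair_prod vandermonde_def pair_prod_mult)
  finally have "d = pair_prod n (\<lambda>k l. w k - w l)"
    using vandermonde_nonzero[OF assms] by simp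
  then show ?thesis by (simp add: eval)
qed

theorem cauchy_determinant:
  fixes w y :: "nat \<Rightarrow> 'a::field"
  assumes inj: "inj_on w {..<n}" and disjoint: "\<And>i k. i < n \<Longrightarrow> k < n \<Longrightarrow> w k \<noteq> y i"
  shows "det (mat n n (\<lambda>(i, k). 1 / (w k - y i))) =
         pair_prod n (\<lambda>k l. w k - w l) * vandermonde n y / (\<Prod>i<n. \<Prod>k<n. w k - y i)"
proof -
  have "mat n n (\<lambda>(i, j). poly (lagrange_poly n w j) (y i)) =
        mat n n (\<lambda>(i, j). (\<Prod>k<n. w k - y i) * (1 / (w j - y i)))"
  proof (rule cong_mat)
    fix i j assume ij: "i < n" "j < n"
    have "(\<Prod>k<n. w k - y i) = (w j - y i) * poly (lagrange_poly n w j) (y i)"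
      unfolding poly_lagrange_poly using ij by (subst prod.remove[of _ j]) auto
    then show "(case (i, j) of (i, j) \<Rightarrow> poly (lagrange_poly n w j) (y i)) =
               (case (i, j) of (i, j) \<Rightarrow> (\<Prod>k<n. w k - y i) * (1 / (w j - y i)))"
      using disjoint[OF ij] by simp
  qed auto
  then have "vandermonde n y * pair_prod n (\<lambda>k l. w k - w l) =
      (\<Prod>i<n. \<Prod>k<n. w k - y i) * det (mat n n (\<lambda>(i, k). 1 / (w k - y i)))"
    using det_mat_scale[of n "\<lambda>i. \<Prod>k<n. w k - y i" "\<lambda>_. 1" "\<lambda>i k. 1 / (w k - y i)"]
    unfolding det_lagrange_poly_eval[OF inj, symmetric] by simp
  moreover have "(\<Prod>i<n. \<Prod>k<n. w k - y i) \<noteq> 0"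
    using disjoint by auto
  ultimately show ?thesis
    by (simp add: nonzero_eq_divide_eq mult.commute)
qed

lemma sum_permutations_pair_eq_fact_mult_det:
  fixes g :: "nat \<Rightarrow> nat \<Rightarrow> 'a::{comm_ring_1, ring_char_0}"
  shows "(\<Sum>p | p permutes {..<n}. \<Sum>r | r permutes {..<n}. signof p * signof r * (\<Prod>i<n. g (p i) (r i))) =
         fact n * det (mat n n (\<lambda>(j, k). g j k))"
proof -
  let ?P = "{p. p permutes {..<n}}" and ?G = "mat n n (\<lambda>(j, k). g j k)"
  have "(\<Sum>r\<in>?P. signof p * signof r * (\<Prod>i<n. g (p i) (r i))) = det ?G" if "p \<in> ?P" for p
  proof -
    have p: "p permutes {0..<n}" using that by (simp add: lessThan_atLeast0)
    have "(\<Sum>r\<in>?P. signof r * (\<Prod>i<n. g (p i) (r i))) = det (mat n n (\<lambda>(i, j). g (p i) j))"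
      by (simp add: det_mat_eq_sum_permutations)
    also have "mat n n (\<lambda>(i, j). g (p i) j) = mat n n (\<lambda>(i, j). ?G $$ (p i, j))"
      using permutes_in_image[OF p] by (intro cong_mat) auto
    also have "det \<dots> = signof p * det ?G"
      by (rule det_permute_rows[OF _ p]) simp
    finally have "(\<Sum>r\<in>?P. signof p * signof r * (\<Prod>i<n. g (p i) (r i))) = signof p * (signof p * det ?G)"
      by (simp add: mult.assoc flip: sum_distrib_left)
    then show ?thesis by (auto simp: sign_def)
  qed
  then show ?thesis
    using card_permutations[of "{..<n}" n] by simp
qed

theorem andreief:
  fixes \<phi> \<psi> :: "nat \<Rightarrow> 'a \<Rightarrow> 'b::{real_normed_field, banach, second_countable_topology}"
  assumes "sigma_finite_measure M"
    and int: "\<And>j k. j < n \<Longrightarrow> k < n \<Longrightarrow> integrable M (\<lambda>y. \<phi> j y * \<psi> k y)"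
  shows "(\<integral>y. det (mat n n (\<lambda>(i, j). \<phi> j (y i))) * det (mat n n (\<lambda>(i, k). \<psi> k (y i))) \<partial>PiM {..<n} (\<lambda>_. M)) =
         fact n * det (mat n n (\<lambda>(j, k). \<integral>y. \<phi> j y * \<psi> k y \<partial>M))"
proof -
  interpret product_sigma_finite "\<lambda>_::nat. M"
    using assms(1) by (simp add: product_sigma_finite_def)
  let ?P = "{p. p permutes {..<n}}"
  let ?M = "PiM {..<n} (\<lambda>_. M)"
  have in_range: "p i < n" if "p \<in> ?P" "i < n" for p i
    using that permutes_in_image[of p "{..<n}" i] by auto
  have integrable_factor: "integrable M (\<lambda>y. \<phi> (p i) y * \<psi> (r i) y)"
    if "p \<in> ?P" "r \<in> ?P" "i \<in> {..<n}" for p r i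
    using that in_range[of p i] in_range[of r i] by (intro int) auto
  have integrable_term: "integrable ?M (\<lambda>y. signof p * signof r * (\<Prod>i<n. \<phi> (p i) (y i) * \<psi> (r i) (y i)))"
    if "p \<in> ?P" "r \<in> ?P" for p r
    by (intro integrable_mult_right product_integrable_prod finite_lessThan integrable_factor that)
  have integral_term: "(\<integral>y. signof p * signof r * (\<Prod>i<n. \<phi> (p i) (y i) * \<psi> (r i) (y i)) \<partial>?M) =
      signof p * signof r * (\<Prod>i<n. \<integral>y. \<phi> (p i) y * \<psi> (r i) y \<partial>M)"
    if "p \<in> ?P" "r \<in> ?P" for p r
    unfolding integral_mult_right_zero
    by (subst product_integral_prod) (simp_all add: integrable_factor[OF that])
  have "(\<integral>y. det (mat n n (\<lambda>(i, j). \<phi> j (y i))) * det (mat n n (\<lambda>(i, k). \<psi> k (y i))) \<partial>?M) =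
      (\<integral>y. (\<Sum>p\<in>?P. \<Sum>r\<in>?P. signof p * signof r * (\<Prod>i<n. \<phi> (p i) (y i) * \<psi> (r i) (y i))) \<partial>?M)"
    unfolding det_mat_eq_sum_permutations sum_product by (simp add: prod.distrib mult_ac)
  also have "\<dots> = (\<Sum>p\<in>?P. \<integral>y. (\<Sum>r\<in>?P. signof p * signof r * (\<Prod>i<n. \<phi> (p i) (y i) * \<psi> (r i) (y i))) \<partial>?M)"
    by (intro Bochner_Integration.integral_sum Bochner_Integration.integrable_sum integrable_term)
  also have "\<dots> = (\<Sum>p\<in>?P. \<Sum>r\<in>?P. signof p * signof r * (\<Prod>i<n. \<integral>y. \<phi> (p i) y * \<psi> (r i) y \<partial>M))"
    by (intro sum.cong refl trans[OF Bochner_Integration.integral_sum])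
        (intro integrable_term integral_term; assumption)+
  also have "\<dots> = fact n * det (mat n n (\<lambda>(j, k). \<integral>y. \<phi> j y * \<psi> k y \<partial>M))"
    by (rule sum_permutations_pair_eq_fact_mult_det)
  finally show ?thesis .
qed

section \<open>Chebyshev polynomials and the semicircle law\<close>

definition chebyshev_denom :: "'a::comm_ring_1 \<Rightarrow> 'a \<Rightarrow> 'a" where
  "chebyshev_denom x y = 1 + x\<^sup>2 - x * y"

definition joukowsky :: "'a::field \<Rightarrow> 'a" where
  "joukowsky z = z + 1 / z"

lemma chebyshev_denom_eq_joukowsky: "x \<noteq> 0 \<Longrightarrow> chebyshev_denom x y = x * (joukowsky x - y)"
  by (simp add: chebyshev_denom_def joukowsky_def field_simps power2_eq_square)

lemma joukowsky_diff:
  assumes "x \<noteq> 0" "y \<noteq> 0"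
  shows "joukowsky x - joukowsky y = (y - x) * (1 - x * y) / (x * y)"
  using assms by (simp add: joukowsky_def field_simps)

lemma cis_add_cis_neg: "cis t + cis (- t) = of_real (2 * cos t)"
  by (simp add: complex_eq_iff)

lemma chebyshev_denom_cos:
  "chebyshev_denom x (complex_of_real (2 * cos t)) = (1 - x * cis t) * (1 - x * cis (- t))"
proof -
  have "cis t * cis (- t) = 1" by (simp add: cis_mult)
  moreover have "(1 - x * cis t) * (1 - x * cis (- t)) =
      chebyshev_denom x (cis t + cis (- t)) + x\<^sup>2 * (cis t * cis (- t) - 1)"
    by (simp add: chebyshev_denom_def algebra_simps power2_eq_square)
  ultimately show ?thesis by (simp add: cis_add_cis_neg)
qed

lemma one_minus_mult_cis_nonzero:
  assumes "norm x < 1"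
  shows "1 - x * cis t \<noteq> 0"
proof
  assume "1 - x * cis t = 0"
  then have "norm (x * cis t) = 1" by simp
  then show False using assms by (simp add: norm_mult)
qed

lemma two_cos_arccos_half: "y \<in> {-2..2} \<Longrightarrow> 2 * cos (arccos (y / 2)) = y"
  by (subst cos_arccos) auto

lemma two_cos_in_support: "2 * cos t \<in> {-2..2::real}"
  using cos_ge_minus_one[of t] cos_le_one[of t] by simp

lemma norm_chebyshev_denom_ge:
  fixes x :: complex
  assumes "y \<in> {-2..2::real}" "norm x \<le> 1"
  shows "(1 - norm x)\<^sup>2 \<le> norm (chebyshev_denom x (of_real y))"
proof -
  have "1 - norm x \<le> norm (1 - x * cis t)" for t
    using norm_triangle_ineq2[of 1 "x * cis t"] by (simp add: norm_mult)
  then have "(1 - norm x)\<^sup>2 \<le> norm (chebyshev_denom x (of_real (2 * cos t)))" for t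
    unfolding chebyshev_denom_cos norm_mult power2_eq_square
    using assms(2) by (intro mult_mono) auto
  from this[of "arccos (y / 2)"] show ?thesis
    by (simp only: two_cos_arccos_half[OF assms(1)])
qed

lemma chebyshev_denom_nonzero:
  fixes x :: complex
  assumes "y \<in> {-2..2::real}" "norm x < 1"
  shows "chebyshev_denom x (of_real y) \<noteq> 0"
proof -
  have "0 < (1 - norm x)\<^sup>2" using assms(2) by simp
  also have "\<dots> \<le> norm (chebyshev_denom x (of_real y))"
    using assms by (intro norm_chebyshev_denom_ge) auto
  finally show ?thesis by simp
qed

lemma mu0_density_eq_0: "y \<notin> {-2..2} \<Longrightarrow> mu0_density y = 0"
  unfolding mu0_density_def by auto

lemma indicator_mult_mu0_density: "indicator {-2..2} y * mu0_density y = mu0_density y"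
  by (cases "y \<in> {-2..2}") (auto simp: mu0_density_eq_0)

lemma mu0_density_nonneg: "0 \<le> mu0_density y"
proof (cases "y \<in> {-2..2}")
  case True
  then have "y\<^sup>2 \<le> 2\<^sup>2" by (subst abs_le_square_iff[symmetric]) auto
  then show ?thesis by (simp add: mu0_density_def)
qed (simp add: mu0_density_eq_0)

lemma measurable_mu0_density [measurable]: "mu0_density \<in> borel_measurable borel"
  unfolding mu0_density_def by measurable

lemma continuous_on_mu0_density: "continuous_on {-2..2} mu0_density"
proof -
  have "continuous_on {-2..2} (\<lambda>y. sqrt (4 - y\<^sup>2) / (2 * pi))"
    by (intro continuous_intros) auto
  then show ?thesis
    by (rule continuous_on_eq) (simp add: mu0_density_def)
qed

lemma mu0_density_two_cos:
  assumes "t \<in> {0..pi}"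
  shows "mu0_density (2 * cos t) = sin t / pi"
proof -
  have "4 - (2 * cos t)\<^sup>2 = (2 * sin t)\<^sup>2"
    by (simp add: power_mult_distrib sin_squared_eq)
  then have "sqrt (4 - (2 * cos t)\<^sup>2) = 2 * sin t"
    using assms sin_ge_zero[of t] by (simp only: real_sqrt_abs) auto
  then show ?thesis
    using two_cos_in_support[of t] by (simp add: mu0_density_def)
qed

lemma mu0_integrable:
  fixes g :: "real \<Rightarrow> complex"
  assumes "continuous_on {-2..2} g"
  shows "integrable lborel (\<lambda>y. mu0_density y *\<^sub>R g y)"
proof -
  have "set_integrable lborel {-2..2} (\<lambda>y. mu0_density y *\<^sub>R g y)"
    by (intro borel_integrable_atLeastAtMost' continuous_on_scaleR continuous_on_mu0_density assms)
  then show ?thesis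
    by (simp add: set_integrable_def indicator_mult_mu0_density)
qed

lemma mu0_integral_two_cos:
  fixes g :: "real \<Rightarrow> complex"
  assumes g: "continuous_on {-2..2} g"
  shows "(\<integral>y. mu0_density y *\<^sub>R g y \<partial>lborel) =
         (2 / pi) *\<^sub>R integral {0..pi} (\<lambda>t. (sin t)\<^sup>2 *\<^sub>R g (2 * cos t))"
proof -
  define f where "f y = mu0_density y *\<^sub>R g y" for y
  have f: "continuous_on {-2..2} f"
    unfolding f_def by (intro continuous_on_scaleR continuous_on_mu0_density g)
  have range: "(\<lambda>t. 2 * cos t) ` A \<subseteq> {-2..2::real}" for A
    using two_cos_in_support by blast
  have "integral\<^sup>L lborel f = (LBINT y:{-2..2}. f y)"
    by (simp add: set_lebesgue_integral_def f_def[abs_def] indicator_mult_mu0_density)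
  also have "\<dots> = - (LBINT y=ereal (2 * cos 0)..ereal (2 * cos pi). f y)"
    by (subst interval_integral_endpoints_reverse) (simp add: interval_integral_Icc)
  also have "(LBINT y=ereal (2 * cos 0)..ereal (2 * cos pi). f y) =
      (LBINT t=ereal 0..ereal pi. (- 2 * sin t) *\<^sub>R f (2 * cos t))"
    by (rule interval_integral_substitution_finite[symmetric])
       (auto intro!: derivative_eq_intros continuous_intros continuous_on_subset[OF f range])
  also have "\<dots> = (LBINT t:{0..pi}. (- 2 * sin t) *\<^sub>R f (2 * cos t))"
    by (subst interval_integral_Icc) auto
  also have "\<dots> = integral {0..pi} (\<lambda>t. (- 2 * sin t) *\<^sub>R f (2 * cos t))"
    by (intro set_borel_integral_eq_integral(2) borel_integrable_atLeastAtMost' continuous_intros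
          continuous_on_compose2[OF f _ range])
  also have "\<dots> = integral {0..pi} (\<lambda>t. (- (2 / pi)) *\<^sub>R ((sin t)\<^sup>2 *\<^sub>R g (2 * cos t)))"
    by (intro integral_cong) (simp add: f_def mu0_density_two_cos power2_eq_square)
  also have "\<dots> = (- (2 / pi)) *\<^sub>R integral {0..pi} (\<lambda>t. (sin t)\<^sup>2 *\<^sub>R g (2 * cos t))"
    by (rule integral_cmul)
  finally show ?thesis by (simp add: f_def)
qed

text \<open>Monic normalization: \<open>chebyshev_U n\<close> is the classical \<open>U\<^sub>n\<close> evaluated at \<open>y / 2\<close>.\<close>

fun chebyshev_U :: "nat \<Rightarrow> 'a::comm_ring_1 poly" where
  "chebyshev_U 0 = 1"
| "chebyshev_U (Suc 0) = [:0, 1:]"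
| "chebyshev_U (Suc (Suc n)) = [:0, 1:] * chebyshev_U (Suc n) - chebyshev_U n"

lemma degree_chebyshev_U_le: "degree (chebyshev_U n) \<le> n"
proof (induction n rule: chebyshev_U.induct)
  case (3 n)
  then show ?case
    using degree_pCons_le[of 0 "chebyshev_U (Suc n) :: 'a poly"] by (auto intro!: degree_diff_le)
qed auto

lemma coeff_chebyshev_U_self: "coeff (chebyshev_U n) n = 1"
proof (induction n rule: chebyshev_U.induct)
  case (3 n)
  have "coeff (chebyshev_U n :: 'a poly) (Suc (Suc n)) = 0"
    using degree_chebyshev_U_le[of n, where 'a='a] by (intro coeff_eq_0) linarith
  then show ?case using 3 by simp
qed auto

lemma chebyshev_U_two_cos:
  "poly (chebyshev_U n) (complex_of_real (2 * cos t)) * sin t = sin (real (Suc n) * t)"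
proof (induction n rule: chebyshev_U.induct)
  case 2
  show ?case using sin_double[of t] by (simp flip: of_real_mult add: mult_ac)
next
  case (3 n)
  have "poly (chebyshev_U (Suc (Suc n))) (complex_of_real (2 * cos t)) * sin t =
        of_real (2 * cos t) * (poly (chebyshev_U (Suc n)) (complex_of_real (2 * cos t)) * sin t)
        - poly (chebyshev_U n) (complex_of_real (2 * cos t)) * sin t"
    by (simp add: algebra_simps)
  also have "\<dots> = complex_of_real (2 * cos t * sin (real (Suc (Suc n)) * t) - sin (real (Suc n) * t))"
    using 3 by simp
  also have "2 * cos t * sin (real (Suc (Suc n)) * t) - sin (real (Suc n) * t) =
      sin (real (Suc (Suc (Suc n))) * t)"
    using sin_add[of "real (Suc (Suc n)) * t" t] sin_diff[of "real (Suc (Suc n)) * t" t]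
    by (simp add: algebra_simps)
  finally show ?case .
qed auto

lemma mu0_integral_chebyshev_U:
  fixes g :: "real \<Rightarrow> complex"
  assumes "continuous_on {-2..2} g"
  shows "(\<integral>y. mu0_density y *\<^sub>R (poly (chebyshev_U j) (of_real y) * g y) \<partial>lborel) =
         (2 / pi) *\<^sub>R integral {0..pi} (\<lambda>t. of_real (sin (real (Suc j) * t))
             * (of_real (sin t) * g (2 * cos t)))"
proof -
  have "(\<integral>y. mu0_density y *\<^sub>R (poly (chebyshev_U j) (of_real y) * g y) \<partial>lborel) =
      (2 / pi) *\<^sub>R integral {0..pi} (\<lambda>t. (sin t)\<^sup>2 *\<^sub>R
          (poly (chebyshev_U j) (of_real (2 * cos t)) * g (2 * cos t)))"
    by (rule mu0_integral_two_cos) (intro continuous_intros assms)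
  also have "(\<lambda>t. (sin t)\<^sup>2 *\<^sub>R (poly (chebyshev_U j) (of_real (2 * cos t)) * g (2 * cos t))) =
      (\<lambda>t. of_real (sin (real (Suc j) * t)) * (of_real (sin t) * g (2 * cos t)))"
    unfolding chebyshev_U_two_cos[symmetric] by (simp add: scaleR_conv_of_real power2_eq_square mult_ac)
  finally show ?thesis .
qed

lemma has_integral_cos_int:
  "((\<lambda>t. cos (of_int m * t)) has_integral (if m = 0 then pi else 0)) {0..pi}"
proof (cases "m = 0")
  case True
  then show ?thesis using has_integral_const_real[of "1::real" 0 pi] by simp
next
  case False
  then have "((\<lambda>t. cos (of_int m * t)) has_integral
      (sin (of_int m * pi) / of_int m - sin (of_int m * 0) / of_int m)) {0..pi}"
    by (intro fundamental_theorem_of_calculus)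
       (auto intro!: derivative_eq_intros simp flip: has_real_derivative_iff_has_vector_derivative)
  with False show ?thesis by (simp add: mult.commute[of _ pi])
qed

lemma has_integral_sin_sin:
  "((\<lambda>t. sin (real (Suc j) * t) * sin (real (Suc k) * t)) has_integral
      (if j = k then pi / 2 else 0)) {0..pi}"
proof -
  have "((\<lambda>t. (cos (of_int (int j - int k) * t) - cos (of_int (int j + int k + 2) * t)) / 2) has_integral
         ((if int j - int k = 0 then pi else 0) - (if int j + int k + 2 = 0 then pi else 0)) / 2) {0..pi}"
    by (intro has_integral_divide has_integral_diff has_integral_cos_int)
  then show ?thesis
    by (rule has_integral_eq_rhs[OF has_integral_eq, rotated])
       (auto simp: sin_times_sin algebra_simps)
qed

lemma mu0_chebyshev_U_orthonormal:
  "(\<integral>y. mu0_density y *\<^sub>R (poly (chebyshev_U j) (of_real y) * poly (chebyshev_U k) (complex_of_real y))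
      \<partial>lborel) =
   (if j = k then 1 else 0)"
proof -
  have "((\<lambda>t. complex_of_real (sin (real (Suc j) * t) * sin (real (Suc k) * t))) has_integral
      of_real (if j = k then pi / 2 else 0)) {0..pi}"
    by (intro has_integral_of_real has_integral_sin_sin)
  moreover have "complex_of_real (sin (real (Suc j) * t) * sin (real (Suc k) * t)) =
      of_real (sin (real (Suc j) * t)) * (of_real (sin t)
          * poly (chebyshev_U k) (of_real (2 * cos t)))" for t
    unfolding of_real_mult chebyshev_U_two_cos[of k, symmetric] by (simp only: mult.commute)
  ultimately show ?thesis
    by (subst mu0_integral_chebyshev_U)
       (auto intro!: continuous_intros simp: scaleR_conv_of_real integral_unique simp del: of_real_mult)
qed

lemma sin_geometric_sums:
  fixes x :: complex
  assumes "norm x < 1"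
  shows "(\<lambda>k. x ^ k * of_real (sin (real (Suc k) * t))) sums
      (of_real (sin t) / chebyshev_denom x (of_real (2 * cos t)))"
proof -
  have lt: "norm (x * cis s) < 1" for s
    using assms by (simp add: norm_mult)
  have "cis t * (1 / (1 - x * cis t)) - cis (- t) * (1 / (1 - x * cis (- t))) =
      (cis t - cis (- t)) / chebyshev_denom x (of_real (2 * cos t))"
    unfolding chebyshev_denom_cos using one_minus_mult_cis_nonzero[OF assms]
    by (simp add: diff_frac_eq algebra_simps)
  also have "cis t - cis (- t) = 2 * \<i> * of_real (sin t)"
    by (simp add: complex_eq_iff)
  finally have sum: "cis t * (1 / (1 - x * cis t)) - cis (- t) * (1 / (1 - x * cis (- t))) =
      2 * \<i> * (of_real (sin t) / chebyshev_denom x (of_real (2 * cos t)))" by simp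
  have "cis t * (x * cis t) ^ k - cis (- t) * (x * cis (- t)) ^ k =
      2 * \<i> * (x ^ k * of_real (sin (real (Suc k) * t)))" for k
  proof -
    have "cis t * (x * cis t) ^ k - cis (- t) * (x * cis (- t)) ^ k =
        x ^ k * (cis t ^ Suc k - cis (- t) ^ Suc k)"
      by (simp add: power_mult_distrib algebra_simps)
    also have "cis t ^ Suc k - cis (- t) ^ Suc k = 2 * \<i> * of_real (sin (real (Suc k) * t))"
      unfolding Complex.DeMoivre by (simp add: complex_eq_iff)
    finally show ?thesis by simp
  qed
  moreover have "(\<lambda>k. cis t * (x * cis t) ^ k - cis (- t) * (x * cis (- t)) ^ k) sums
      (cis t * (1 / (1 - x * cis t)) - cis (- t) * (1 / (1 - x * cis (- t))))"
    by (intro sums_diff sums_mult geometric_sums lt)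
  ultimately have "(\<lambda>k. 2 * \<i> * (x ^ k * of_real (sin (real (Suc k) * t)))) sums
      (2 * \<i> * (of_real (sin t) / chebyshev_denom x (of_real (2 * cos t))))"
    unfolding sum by simp
  then show ?thesis
    by (subst (asm) sums_mult_iff) auto
qed

lemma integral_sin_mult_sin_div_denom:
  fixes x :: complex
  assumes x: "norm x < 1"
  shows "integral {0..pi} (\<lambda>t. of_real (sin (real (Suc j) * t))
      * (of_real (sin t) / chebyshev_denom x (of_real (2 * cos t)))) =
         x ^ j * of_real (pi / 2)"
    (is "integral _ ?h = _")
proof -
  define s where "s k t = complex_of_real (sin (real (Suc k) * t))" for k t
  define S where "S K t = (\<Sum>k<K. x ^ k * (s j t * s k t))" for K t
  have "uniform_limit {0..pi} S (\<lambda>t. \<Sum>k. x ^ k * (s j t * s k t)) sequentially"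
    unfolding S_def
  proof (rule Weierstrass_m_test)
    show "summable (\<lambda>k. norm x ^ k)" using x by (simp add: summable_geometric)
    show "norm (x ^ k * (s j t * s k t)) \<le> norm x ^ k" for k t
      unfolding s_def norm_mult norm_power by (intro mult_left_le mult_le_one) auto
  qed
  moreover have "(\<Sum>k. x ^ k * (s j t * s k t)) = ?h t" for t
    using sums_mult[OF sin_geometric_sums[OF x, of t], of "s j t"]
    unfolding s_def by (intro sums_unique[symmetric]) (simp add: mult.left_commute)
  ultimately have "uniform_limit {0..pi} S ?h sequentially" by simp
  then obtain I J where I: "\<And>K. (S K has_integral I K) {0..pi}"
    and J: "(?h has_integral J) {0..pi}" "I \<longlonglongrightarrow> J"
    by (rule uniform_limit_integral) (auto simp: S_def s_def intro!: continuous_intros)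
  have "(S K has_integral (\<Sum>k<K. x ^ k * of_real (if j = k then pi / 2 else 0))) {0..pi}" for K
    unfolding S_def s_def of_real_mult[symmetric]
    by (intro has_integral_sum has_integral_mult_right has_integral_of_real has_integral_sin_sin) auto
  then have "I K = (\<Sum>k<K. x ^ k * of_real (if j = k then pi / 2 else 0))" for K
    using I has_integral_unique by blast
  then have "I K = x ^ j * of_real (pi / 2)" if "K > j" for K
    using that by (simp add: if_distrib sum.delta cong: if_cong)
  then have "I \<longlonglongrightarrow> x ^ j * of_real (pi / 2)"
    by (intro tendsto_eventually eventually_mono[OF eventually_gt_at_top[of j]])
  with J show ?thesis
    using LIMSEQ_unique integral_unique by blast
qed

theorem mu0_integral_chebyshev_U_div_denom:
  fixes x :: complex
  assumes x: "norm x < 1"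
  shows "(\<integral>y. mu0_density y *\<^sub>R (poly (chebyshev_U j) (of_real y) / chebyshev_denom x (of_real y)) \<partial>lborel)
      = x ^ j"
proof -
  have "continuous_on {-2..2} (\<lambda>y. 1 / chebyshev_denom x (complex_of_real y))"
    using chebyshev_denom_nonzero x unfolding chebyshev_denom_def by (intro continuous_intros) auto
  from mu0_integral_chebyshev_U[OF this, of j]
  have "(\<integral>y. mu0_density y *\<^sub>R (poly (chebyshev_U j) (of_real y) / chebyshev_denom x (of_real y)) \<partial>lborel) =
      (2 / pi) *\<^sub>R (x ^ j * of_real (pi / 2))"
    using integral_sin_mult_sin_div_denom[OF x, of j] by simp
  then show ?thesis
    by (simp add: scaleR_conv_of_real)
qed

section \<open>The orthogonal polynomial ensemble\<close>

lemma of_real_vandermonde: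
  "vandermonde n (\<lambda>i. of_real (y i)) = (of_real (vandermonde n y) :: 'a::{real_algebra_1, comm_ring_1})"
  by (induction n) (simp_all add: vandermonde_def pair_prod_Suc)

lemma ope_weight_eq_vandermonde: "ope_weight n y = (\<Prod>i<n. mu0_density (y i)) * (vandermonde n y)\<^sup>2"
proof -
  have "pair_prod n (\<lambda>i j. (y i - y j)\<^sup>2) = (vandermonde n y)\<^sup>2"
    unfolding vandermonde_def power2_eq_square pair_prod_mult[symmetric]
    by (rule pair_prod_cong) (simp add: algebra_simps)
  then show ?thesis
    by (simp add: ope_weight_def pair_prod_def mult.commute)
qed

lemma ope_weight_nonneg: "0 \<le> ope_weight n y"
  unfolding ope_weight_eq_vandermonde by (intro mult_nonneg_nonneg prod_nonneg)
    (auto intro: mu0_density_nonneg)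

lemma measurable_vandermonde [measurable]:
  "vandermonde n \<in> borel_measurable (PiM {..<n} (\<lambda>_. borel :: real measure))"
proof -
  have "(\<lambda>x. if i < j then x j - x i else 1 :: real) \<in> borel_measurable (PiM {..<n} (\<lambda>_. borel))"
    if "i < n" "j < n" for i j
    using that by (cases "i < j") auto
  then show ?thesis
    unfolding vandermonde_def[abs_def] pair_prod_def by (intro borel_measurable_prod) auto
qed

lemma measurable_ope_weight [measurable]: "ope_weight n \<in> borel_measurable (PiM {..<n} (\<lambda>_. lborel))"
  unfolding ope_weight_eq_vandermonde[abs_def] by measurable

lemma det_mu0_chebyshev_U:
  "det (mat n n (\<lambda>(i, j). of_real (mu0_density (y i)) * poly (chebyshev_U j) (complex_of_real (y i)))) =
   of_real ((\<Prod>i<n. mu0_density (y i)) * vandermonde n y)"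
  using det_mat_scale[of n "\<lambda>i. complex_of_real (mu0_density (y i))" "\<lambda>_. 1"
      "\<lambda>i j. poly (chebyshev_U j) (complex_of_real (y i))"]
  by (simp add: det_monic_poly_eval_eq_powers degree_chebyshev_U_le coeff_chebyshev_U_self
      det_vandermonde of_real_vandermonde)

lemma integrable_mu0_chebyshev_U:
  assumes "continuous_on {-2..2} g"
  shows "integrable lborel (\<lambda>y. of_real (mu0_density y) * poly (chebyshev_U j) (complex_of_real y) * g y)"
proof -
  have "integrable lborel (\<lambda>y. mu0_density y *\<^sub>R (poly (chebyshev_U j) (complex_of_real y) * g y))"
    by (intro mu0_integrable continuous_intros assms)
  then show ?thesis by (simp add: scaleR_conv_of_real mult.assoc)
qed

lemma ope_Z_eq_fact: "ope_Z n = fact n"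
proof -
  let ?U = "\<lambda>j y. poly (chebyshev_U j) (complex_of_real y)"
  let ?M = "PiM {..<n} (\<lambda>_. lborel :: real measure)"
  have gram: "(\<integral>u. of_real (mu0_density u) * ?U j u * ?U k u \<partial>lborel) = (if j = k then 1 else 0)" for j k
    using mu0_chebyshev_U_orthonormal[of j k] by (simp add: scaleR_conv_of_real mult.assoc)
  have "det (mat n n (\<lambda>(i, j). ?U j (y i))) = of_real (vandermonde n y)" for y
    by (simp add: det_monic_poly_eval_eq_powers degree_chebyshev_U_le coeff_chebyshev_U_self
        det_vandermonde of_real_vandermonde)
  then have "(\<integral>y. complex_of_real (ope_weight n y) \<partial>?M) =
      (\<integral>y. det (mat n n (\<lambda>(i, j). of_real (mu0_density (y i)) * ?U j (y i)))
          * det (mat n n (\<lambda>(i, k). ?U k (y i))) \<partial>?M)"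
    by (simp add: det_mu0_chebyshev_U ope_weight_eq_vandermonde power2_eq_square mult.assoc)
  also have "\<dots> = fact n * det (mat n n (\<lambda>(j, k). \<integral>u. of_real (mu0_density u) * ?U j u * ?U k u \<partial>lborel))"
    by (rule andreief[OF sigma_finite_lborel]) (intro integrable_mu0_chebyshev_U continuous_intros)
  also have "mat n n (\<lambda>(j, k). \<integral>u. of_real (mu0_density u) * ?U j u * ?U k u \<partial>lborel) = 1\<^sub>m n"
    by (rule eq_matI) (auto simp: gram)
  finally show ?thesis
    unfolding ope_Z_def by (simp add: integral_complex_of_real) (metis of_real_eq_iff of_real_fact)
qed

lemma ope_weight_integrable: "integrable (PiM {..<n} (\<lambda>_. lborel)) (ope_weight n)"
proof (rule ccontr)
  assume "\<not> integrable (PiM {..<n} (\<lambda>_. lborel)) (ope_weight n)"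
  then have "ope_Z n = 0"
    unfolding ope_Z_def by (rule not_integrable_integral_eq)
  then show False by (simp add: ope_Z_eq_fact)
qed

lemma prob_space_ope: "prob_space (ope n)"
proof
  have "emeasure (ope n) (space (ope n)) = (\<integral>\<^sup>+y. ennreal (ope_weight n y / ope_Z n)
      \<partial>PiM {..<n} (\<lambda>_. lborel))"
    unfolding ope_def by (subst emeasure_density) (auto intro!: nn_integral_cong)
  also have "\<dots> = ennreal (\<integral>y. ope_weight n y / ope_Z n \<partial>PiM {..<n} (\<lambda>_. lborel))"
    by (intro nn_integral_eq_integral) (auto intro!: ope_weight_integrable
        simp: ope_Z_eq_fact ope_weight_nonneg)
  also have "(\<integral>y. ope_weight n y / ope_Z n \<partial>PiM {..<n} (\<lambda>_. lborel)) = 1"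
    using ope_Z_eq_fact[of n] by (simp flip: ope_Z_def)
  finally show "emeasure (ope n) (space (ope n)) = 1" by simp
qed

lemma sets_ope [measurable_cong]: "sets (ope n) = sets (PiM {..<n} (\<lambda>_. borel))"
  unfolding ope_def by (simp cong: sets_PiM_cong)

lemma AE_ope_support: "AE y in ope n. \<forall>i<n. y i \<in> {-2..2}"
proof -
  have "ope_weight n y = 0" if "i < n" "y i \<notin> {-2..2}" for i y
    using that mu0_density_eq_0[of "y i"] by (auto simp: ope_weight_eq_vandermonde)
  then have "\<forall>i<n. y i \<in> {-2..2}" if "0 < ope_weight n y" for y
    using that by (metis less_irrefl)
  then show ?thesis
    unfolding ope_def by (subst AE_density) (auto simp: ope_Z_eq_fact zero_less_divide_iff)
qed

lemma integral_ope:
  fixes g :: "(nat \<Rightarrow> real) \<Rightarrow> complex"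
  assumes "g \<in> borel_measurable (ope n)"
  shows "(\<integral>y. g y \<partial>ope n) = (\<integral>y. of_real (ope_weight n y) * g y \<partial>PiM {..<n} (\<lambda>_. lborel)) / fact n"
proof -
  have [measurable]: "g \<in> borel_measurable (PiM {..<n} (\<lambda>_. lborel))"
    using assms by (simp add: ope_def)
  have "(\<integral>y. g y \<partial>ope n) = (\<integral>y. (ope_weight n y / ope_Z n) *\<^sub>R g y \<partial>PiM {..<n} (\<lambda>_. lborel))"
    unfolding ope_def by (intro integral_density) (auto simp: ope_weight_nonneg ope_Z_eq_fact)
  also have "\<dots> = (\<integral>y. of_real (ope_weight n y) * g y / fact n \<partial>PiM {..<n} (\<lambda>_. lborel))"
    by (simp add: ope_Z_eq_fact scaleR_conv_of_real)
  finally show ?thesis by simp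
qed

section \<open>An exact expectation\<close>

lemma inj_on_joukowsky_comp:
  assumes inj: "inj_on x {..<n}" and x0: "\<And>k. k < n \<Longrightarrow> x k \<noteq> 0"
    and x1: "\<And>k l. k < n \<Longrightarrow> l < n \<Longrightarrow> x k * x l \<noteq> 1"
  shows "inj_on (\<lambda>k. joukowsky (x k)) {..<n}"
proof (rule inj_onI)
  fix k l assume kl: "k \<in> {..<n}" "l \<in> {..<n}" "joukowsky (x k) = joukowsky (x l)"
  then have "x l = x k"
    using joukowsky_diff[of "x k" "x l"] x0 x1[of k l] by auto
  then show "k = l" using inj kl by (auto dest: inj_onD)
qed

lemma pair_prod_joukowsky_diff:
  assumes "\<And>k. k < n \<Longrightarrow> x k \<noteq> 0"
  shows "pair_prod n (\<lambda>k l. joukowsky (x k) - joukowsky (x l)) =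
         vandermonde n x * pair_prod n (\<lambda>k l. 1 - x k * x l) / (\<Prod>k<n. x k) ^ (n - 1)"
proof -
  have "pair_prod n (\<lambda>k l. joukowsky (x k) - joukowsky (x l)) =
      pair_prod n (\<lambda>k l. (x l - x k) * (1 - x k * x l) / (x k * x l))"
    by (rule pair_prod_cong) (simp add: joukowsky_diff assms)
  then show ?thesis
    unfolding pair_prod_divide pair_prod_symmetric_mult vandermonde_def by (simp add: pair_prod_mult)
qed

theorem det_inverse_chebyshev_denom:
  fixes x y :: "nat \<Rightarrow> 'a::field"
  assumes inj: "inj_on x {..<n}" and x0: "\<And>k. k < n \<Longrightarrow> x k \<noteq> 0"
    and x1: "\<And>k l. k < n \<Longrightarrow> l < n \<Longrightarrow> x k * x l \<noteq> 1"
    and denom: "\<And>i k. i < n \<Longrightarrow> k < n \<Longrightarrow> chebyshev_denom (x k) (y i) \<noteq> 0"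
  shows "det (mat n n (\<lambda>(i, k). 1 / chebyshev_denom (x k) (y i))) =
         vandermonde n x * pair_prod n (\<lambda>k l. 1 - x k * x l) * vandermonde n y
             / (\<Prod>i<n. \<Prod>k<n. chebyshev_denom (x k) (y i))"
proof -
  have "joukowsky (x k) \<noteq> y i" if "i < n" "k < n" for i k
    using denom[OF that] chebyshev_denom_eq_joukowsky[OF x0[OF that(2)], of "y i"] by auto
  then have cauchy: "det (mat n n (\<lambda>(i, k). 1 / (joukowsky (x k) - y i))) =
      pair_prod n (\<lambda>k l. joukowsky (x k) - joukowsky (x l)) * vandermonde n y
          / (\<Prod>i<n. \<Prod>k<n. joukowsky (x k) - y i)"
    by (intro cauchy_determinant inj_on_joukowsky_comp inj x0 x1)
  define P where "P = (\<Prod>k<n. x k)"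
  have P0: "P \<noteq> 0" using x0 by (simp add: P_def)
  have "(\<Prod>i<n. \<Prod>k<n. chebyshev_denom (x k) (y i)) = (\<Prod>i<n. \<Prod>k<n. x k * (joukowsky (x k) - y i))"
    by (intro prod.cong refl) (simp add: chebyshev_denom_eq_joukowsky x0)
  also have "\<dots> = P ^ n * (\<Prod>i<n. \<Prod>k<n. joukowsky (x k) - y i)"
    by (simp add: prod.distrib P_def)
  finally have denom_prod: "(\<Prod>i<n. \<Prod>k<n. chebyshev_denom (x k) (y i)) = \<dots>" .
  have "mat n n (\<lambda>(i, k). 1 / chebyshev_denom (x k) (y i)) =
      mat n n (\<lambda>(i, k). 1 * (1 / x k) * (1 / (joukowsky (x k) - y i)))"
    by (rule cong_mat) (simp_all add: chebyshev_denom_eq_joukowsky x0)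
  then have "det (mat n n (\<lambda>(i, k). 1 / chebyshev_denom (x k) (y i))) =
      1 / P * det (mat n n (\<lambda>(i, k). 1 / (joukowsky (x k) - y i)))"
    by (simp only: det_mat_scale) (simp add: prod_dividef P_def)
  moreover have "P ^ n = P ^ (n - 1) * P" if "n \<noteq> 0"
    using that by (cases n) (simp_all add: mult.commute)
  ultimately show ?thesis
    unfolding cauchy denom_prod using P0 pair_prod_joukowsky_diff[of n x] x0
    by (cases "n = 0") (simp_all add: P_def vandermonde_def)
qed

definition chebyshev_kernel :: "nat \<Rightarrow> (nat \<Rightarrow> complex) \<Rightarrow> (nat \<Rightarrow> real) \<Rightarrow> complex" where
  "chebyshev_kernel n x y = 1 / (\<Prod>i<n. \<Prod>k<n. chebyshev_denom (x k) (of_real (y i)))"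

lemma measurable_chebyshev_kernel [measurable]: "chebyshev_kernel n x \<in> borel_measurable (ope n)"
  unfolding chebyshev_kernel_def[abs_def] chebyshev_denom_def by measurable

lemma norm_chebyshev_kernel_le:
  assumes r: "r < 1" "\<And>k. k < n \<Longrightarrow> norm (x k) \<le> r" and y: "\<And>i. i < n \<Longrightarrow> y i \<in> {-2..2}"
  shows "norm (chebyshev_kernel n x y) \<le> (1 / (1 - r)\<^sup>2) ^ (n * n)"
proof -
  have "norm (chebyshev_kernel n x y) = (\<Prod>i<n. \<Prod>k<n. 1 / norm (chebyshev_denom (x k) (of_real (y i))))"
    by (simp add: chebyshev_kernel_def norm_divide prod_dividef flip: prod_norm)
  also have "\<dots> \<le> (\<Prod>i<n. \<Prod>k<n. 1 / (1 - r)\<^sup>2)"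
  proof (intro prod_mono conjI prod_nonneg; (simp; fail)?)
    fix i k assume ik: "i \<in> {..<n}" "k \<in> {..<n}"
    have "(1 - r)\<^sup>2 \<le> (1 - norm (x k))\<^sup>2"
      using r ik by (intro power_mono) auto
    also have "\<dots> \<le> norm (chebyshev_denom (x k) (of_real (y i)))"
      using r(1) r(2)[of k] y ik by (intro norm_chebyshev_denom_ge) auto
    finally show "1 / norm (chebyshev_denom (x k) (of_real (y i))) \<le> 1 / (1 - r)\<^sup>2"
      using r(1) by (intro divide_left_mono mult_pos_pos) (auto intro: less_le_trans[of 0 "(1 - r)\<^sup>2"])
  qed
  also have "\<dots> = (1 / (1 - r)\<^sup>2) ^ (n * n)"
    by (simp add: power_mult)
  finally show ?thesis .
qed

lemma ope_weight_mult_chebyshev_kernel: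
  assumes inj: "inj_on x {..<n}" and x0: "\<And>k. k < n \<Longrightarrow> x k \<noteq> 0" and lt1: "\<And>k. k < n \<Longrightarrow> norm (x k) < 1"
  shows "vandermonde n x * pair_prod n (\<lambda>k l. 1 - x k * x l)
      * (of_real (ope_weight n y) * chebyshev_kernel n x y) =
         det (mat n n (\<lambda>(i, j). of_real (mu0_density (y i)) * poly (chebyshev_U j) (complex_of_real (y i)))) *
         det (mat n n (\<lambda>(i, k). 1 / chebyshev_denom (x k) (of_real (y i))))"
proof (cases "\<forall>i<n. y i \<in> {-2..2}")
  case True
  have "x k * x l \<noteq> 1" if "k < n" "l < n" for k l
    using norm_mult_less[OF lt1[OF that(1)] lt1[OF that(2)]] by auto
  then have "det (mat n n (\<lambda>(i, k). 1 / chebyshev_denom (x k) (complex_of_real (y i)))) =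
      vandermonde n x * pair_prod n (\<lambda>k l. 1 - x k * x l) * of_real (vandermonde n y)
          * chebyshev_kernel n x y"
    unfolding chebyshev_kernel_def of_real_vandermonde[symmetric]
    by (subst det_inverse_chebyshev_denom) (use True x0 inj lt1 chebyshev_denom_nonzero in auto)
  then show ?thesis
    unfolding det_mu0_chebyshev_U ope_weight_eq_vandermonde by (simp add: power2_eq_square)
next
  case False
  then have "(\<Prod>i<n. mu0_density (y i)) = 0"
    using mu0_density_eq_0 by (auto intro!: prod_zero)
  then show ?thesis
    unfolding det_mu0_chebyshev_U ope_weight_eq_vandermonde by simp
qed

lemma expectation_chebyshev_kernel_distinct:
  assumes inj: "inj_on x {..<n}" and x0: "\<And>k. k < n \<Longrightarrow> x k \<noteq> 0" and lt1: "\<And>k. k < n \<Longrightarrow> norm (x k) < 1"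
  shows "(\<integral>y. chebyshev_kernel n x y \<partial>ope n) = pair_prod n (\<lambda>k l. 1 / (1 - x k * x l))"
proof -
  define \<phi> where "\<phi> j u = of_real (mu0_density u) * poly (chebyshev_U j) (complex_of_real u)" for j u
  define \<psi> where "\<psi> k u = 1 / chebyshev_denom (x k) (complex_of_real u)" for k u
  let ?V = "vandermonde n x" and ?Q = "pair_prod n (\<lambda>k l. 1 - x k * x l)"
  have "1 - x k * x l \<noteq> 0" if "k < n" "l < n" for k l
    using norm_mult_less[OF lt1[OF that(1)] lt1[OF that(2)]] by auto
  then have nz: "?V \<noteq> 0" "?Q \<noteq> 0"
    using inj by (auto intro!: vandermonde_nonzero pair_prod_nonzero)
  have int: "integrable lborel (\<lambda>u. \<phi> j u * \<psi> k u)" if "k < n" for j k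
    unfolding \<phi>_def \<psi>_def using chebyshev_denom_nonzero[OF _ lt1[OF that]]
    by (intro integrable_mu0_chebyshev_U) (auto simp: chebyshev_denom_def intro!: continuous_intros)
  have moments: "(\<integral>u. \<phi> j u * \<psi> k u \<partial>lborel) = x k ^ j" if "k < n" for j k
    using mu0_integral_chebyshev_U_div_denom[OF lt1[OF that], of j]
    by (simp add: \<phi>_def \<psi>_def scaleR_conv_of_real)
  have "?V * ?Q * (fact n * (\<integral>y. chebyshev_kernel n x y \<partial>ope n)) =
      (\<integral>y. ?V * ?Q * (of_real (ope_weight n y) * chebyshev_kernel n x y) \<partial>PiM {..<n} (\<lambda>_. lborel))"
    by (simp add: integral_ope)
  also have "\<dots> = (\<integral>y. det (mat n n (\<lambda>(i, j). \<phi> j (y i)))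
      * det (mat n n (\<lambda>(i, k). \<psi> k (y i))) \<partial>PiM {..<n} (\<lambda>_. lborel))"
    by (simp only: ope_weight_mult_chebyshev_kernel[OF assms] \<phi>_def \<psi>_def)
  also have "\<dots> = fact n * det (mat n n (\<lambda>(j, k). \<integral>u. \<phi> j u * \<psi> k u \<partial>lborel))"
    by (rule andreief[OF sigma_finite_lborel]) (rule int)
  also have "mat n n (\<lambda>(j, k). \<integral>u. \<phi> j u * \<psi> k u \<partial>lborel) = transpose_mat (mat n n (\<lambda>(k, j). x k ^ j))"
    by (rule eq_matI) (auto simp: moments)
  also have "det \<dots> = ?V"
    by (simp add: det_transpose[of _ n] det_vandermonde)
  finally have "?Q * (\<integral>y. chebyshev_kernel n x y \<partial>ope n) = 1"
    using nz(1) by simp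
  then show ?thesis
    using nz(2) by (simp add: pair_prod_divide eq_divide_eq mult.commute)
qed

lemma eventually_add_divide_nonzero:
  fixes a b :: "'a::real_normed_field"
  assumes "b \<noteq> 0"
  shows "\<forall>\<^sub>F m in sequentially. a + b / of_nat (Suc m) \<noteq> 0"
proof (cases "a = 0")
  case True
  then show ?thesis using assms by (simp del: of_nat_Suc)
next
  case False
  have "(\<lambda>m. a + b * inverse (of_nat (Suc m))) \<longlonglongrightarrow> a + b * 0"
    by (intro tendsto_intros LIMSEQ_inverse_real_of_nat lim_inverse_n[THEN LIMSEQ_Suc])
  then show ?thesis
    using False by (auto simp: divide_inverse dest: tendsto_imp_eventually_ne)
qed

lemma approximation_by_distinct_nonzero:
  fixes x :: "nat \<Rightarrow> 'a::real_normed_field"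
  assumes U: "open U" "\<And>k. k < n \<Longrightarrow> x k \<in> U"
  obtains X where "\<And>k. (\<lambda>m. X m k) \<longlonglongrightarrow> x k" "\<And>m. inj_on (X m) {..<n}"
    "\<And>m k. k < n \<Longrightarrow> X m k \<in> U - {0}"
proof -
  define X where "X m k = x k + of_nat (Suc k) / of_nat (Suc m)" for m k
  have X_lim: "(\<lambda>m. X m k) \<longlonglongrightarrow> x k" for k
  proof -
    have "(\<lambda>m. x k + of_nat (Suc k) * inverse (of_nat (Suc m))) \<longlonglongrightarrow> x k + of_nat (Suc k) * 0"
      by (intro tendsto_intros lim_inverse_n[THEN LIMSEQ_Suc])
    then show ?thesis by (simp add: X_def divide_inverse)
  qed
  have "\<forall>\<^sub>F m in sequentially. X m k - X m l \<noteq> 0" if "l \<noteq> k" for k l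
  proof -
    have "X m k - X m l = (x k - x l) + (of_nat (Suc k) - of_nat (Suc l)) / of_nat (Suc m)" for m
      unfolding X_def by (simp only: diff_divide_distrib) simp
    then show ?thesis
      using that by (simp only:) (rule eventually_add_divide_nonzero, simp)
  qed
  moreover have "\<forall>\<^sub>F m in sequentially. X m k \<noteq> 0" for k
    unfolding X_def by (rule eventually_add_divide_nonzero) (simp only: of_nat_eq_0_iff)
  moreover have "\<forall>\<^sub>F m in sequentially. X m k \<in> U" if "k < n" for k
    using topological_tendstoD[OF X_lim] U that by blast
  ultimately have "\<forall>\<^sub>F m in sequentially. \<forall>k\<in>{..<n}. X m k \<in> U \<and> X m k \<noteq> 0 \<and>
      (\<forall>l\<in>{..<n} - {k}. X m k - X m l \<noteq> 0)"
    by (intro eventually_ball_finite finite_lessThan finite_Diff eventually_conj ballI) auto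
  then obtain m0 where m0: "\<And>m k. m \<ge> m0 \<Longrightarrow> k < n \<Longrightarrow> X m k \<in> U \<and> X m k \<noteq> 0 \<and>
      (\<forall>l\<in>{..<n} - {k}. X m k - X m l \<noteq> 0)"
    unfolding eventually_sequentially by auto
  show thesis
  proof (rule that[of "\<lambda>m. X (m + m0)"])
    show "inj_on (X (m + m0)) {..<n}" for m
      using m0[of "m + m0"] by (fastforce simp: inj_on_def)
  qed (use m0 LIMSEQ_ignore_initial_segment[OF X_lim] in auto)
qed

lemma tendsto_expectation_chebyshev_kernel:
  assumes lim: "\<And>k. (\<lambda>m. X m k) \<longlonglongrightarrow> x k" and r: "r < 1"
    and X: "\<And>m k. k < n \<Longrightarrow> norm (X m k) \<le> r" and x: "\<And>k. k < n \<Longrightarrow> norm (x k) < 1"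
  shows "(\<lambda>m. \<integral>y. chebyshev_kernel n (X m) y \<partial>ope n) \<longlonglongrightarrow> (\<integral>y. chebyshev_kernel n x y \<partial>ope n)"
proof (rule integral_dominated_convergence[where w="\<lambda>_. (1 / (1 - r)\<^sup>2) ^ (n * n)"])
  interpret prob_space "ope n" by (rule prob_space_ope)
  show "integrable (ope n) (\<lambda>_. (1 / (1 - r)\<^sup>2) ^ (n * n))" by simp
  show "AE y in ope n. (\<lambda>m. chebyshev_kernel n (X m) y) \<longlonglongrightarrow> chebyshev_kernel n x y"
    using AE_ope_support
  proof eventually_elim
    case (elim y)
    have "(\<Prod>i<n. \<Prod>k<n. chebyshev_denom (x k) (complex_of_real (y i))) \<noteq> 0"
      using chebyshev_denom_nonzero x elim by auto
    then show ?case
      unfolding chebyshev_kernel_def chebyshev_denom_def by (intro tendsto_intros tendsto_prod lim)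
  qed
  show "AE y in ope n. norm (chebyshev_kernel n (X m) y) \<le> (1 / (1 - r)\<^sup>2) ^ (n * n)" for m
    using AE_ope_support
  proof eventually_elim
    case (elim y)
    then show ?case
      using X r by (intro norm_chebyshev_kernel_le) auto
  qed
qed measurable

theorem expectation_chebyshev_kernel:
  assumes lt1: "\<And>k. k < n \<Longrightarrow> norm (x k) < 1"
  shows "(\<integral>y. chebyshev_kernel n x y \<partial>ope n) = pair_prod n (\<lambda>k l. 1 / (1 - x k * x l))"
proof -
  define q where "q = Max (insert 0 ((\<lambda>k. norm (x k)) ` {..<n}))"
  define r where "r = (1 + q) / 2"
  have q: "q < 1"
    unfolding q_def using lt1 by (subst Max_less_iff) auto
  have "norm (x k) \<le> q" if "k < n" for k
    unfolding q_def using that by (intro Max_ge) auto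
  with q have r: "r < 1" "\<And>k. k < n \<Longrightarrow> x k \<in> ball 0 r"
    by (force simp: r_def)+
  obtain X where X_lim: "\<And>k. (\<lambda>m. X m k) \<longlonglongrightarrow> x k" and X_inj: "\<And>m. inj_on (X m) {..<n}"
    and X: "\<And>m k. k < n \<Longrightarrow> X m k \<in> ball 0 r - {0}"
    using approximation_by_distinct_nonzero[of "ball 0 r" n x] r by blast
  have X_le: "norm (X m k) \<le> r" if "k < n" for m k
    using X[OF that, of m] by simp
  have "(\<lambda>m. \<integral>y. chebyshev_kernel n (X m) y \<partial>ope n) \<longlonglongrightarrow> (\<integral>y. chebyshev_kernel n x y \<partial>ope n)"
    by (rule tendsto_expectation_chebyshev_kernel[OF X_lim r(1) X_le lt1])
  moreover have "(\<integral>y. chebyshev_kernel n (X m) y \<partial>ope n) =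
      pair_prod n (\<lambda>k l. 1 / (1 - X m k * X m l))" for m
    using X r(1) by (intro expectation_chebyshev_kernel_distinct X_inj) (auto intro: le_less_trans[OF X_le])
  moreover have "(\<lambda>m. pair_prod n (\<lambda>k l. 1 / (1 - X m k * X m l))) \<longlonglongrightarrow>
      pair_prod n (\<lambda>k l. 1 / (1 - x k * x l))"
  proof (intro tendsto_pair_prod)
    fix k l assume kl: "k < l" "l < n"
    then have "1 - x k * x l \<noteq> 0"
      using norm_mult_less[of "x k" 1 "x l" 1] lt1 by auto
    then show "(\<lambda>m. 1 / (1 - X m k * X m l)) \<longlonglongrightarrow> 1 / (1 - x k * x l)"
      by (intro tendsto_intros X_lim)
  qed
  ultimately show ?thesis
    by (simp add: LIMSEQ_unique)
qed

section \<open>Polynomial approximation of analytic symbols\<close>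

lemma neg_Ln_sums:
  assumes "norm (w :: complex) < 1"
  shows "(\<lambda>m. w ^ m / of_nat m) sums (- Ln (1 - w))"
  using sums_minus[OF Ln_series'[of "- w"]] assms by simp

lemma power_series_coeff_bound:
  fixes h :: "complex \<Rightarrow> complex"
  assumes sums: "\<And>z. norm z < R \<Longrightarrow> (\<lambda>m. a m * z ^ m) sums h z"
    and R: "0 < R" and B: "\<And>z. norm z < R \<Longrightarrow> norm (h z) \<le> B"
  shows "norm (a m) \<le> B / R ^ m"
proof -
  have hol: "h holomorphic_on ball 0 R"
    by (rule power_series_holomorphic[where a=a]) (use sums in auto)
  have "h has_fps_expansion Abs_fps a"
  proof (rule has_fps_expansionI)
    have "eventually (\<lambda>u. u \<in> ball 0 R) (nhds (0::complex))"
      using R by (intro eventually_nhds_in_open) auto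
    then show "\<forall>\<^sub>F u in nhds 0. (\<lambda>n. fps_nth (Abs_fps a) n * u ^ n) sums h u"
      by eventually_elim (use sums in auto)
  qed
  from fps_nth_fps_expansion[OF this, of m] have a: "a m = (deriv ^^ m) h 0 / fact m"
    by simp
  have "norm (a m) \<le> B / r ^ m" if r: "0 < r" "r < R" for r
  proof -
    have "norm ((deriv ^^ m) h 0) \<le> fact m * B / r ^ m"
    proof (rule Cauchy_inequality)
      show "h holomorphic_on ball 0 r" "continuous_on (cball 0 r) h"
        by (intro holomorphic_on_imp_continuous_on holomorphic_on_subset[OF hol]; use r in auto)+
    qed (use r B in auto)
    then show ?thesis
      by (simp add: a norm_divide divide_le_eq mult.commute)
  qed
  then have "\<forall>\<^sub>F r in at_left R. norm (a m) \<le> B / r ^ m"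
    using eventually_at_left_real[OF R] by (auto elim: eventually_mono)
  moreover have "((\<lambda>r. B / r ^ m) \<longlongrightarrow> B / R ^ m) (at_left R)"
    using R by (intro tendsto_intros) auto
  ultimately show ?thesis
    by (intro tendsto_lowerbound[of "\<lambda>r. B / r ^ m"]) auto
qed

lemma taylor_polynomial_error_bound:
  fixes f :: "complex \<Rightarrow> complex"
  assumes hol: "f holomorphic_on ball 0 R" and R: "0 < R" and B: "\<And>z. norm z < R \<Longrightarrow> norm (f z) \<le> B"
    and \<theta>: "0 < \<theta>" "\<theta> < 1" and z: "norm z \<le> \<theta> * R"
  shows "norm ((\<Sum>l\<le>n. (deriv ^^ l) f 0 / fact l * z ^ l) - f z) \<le> B * \<theta> ^ Suc n / (1 - \<theta>)"
proof -
  define a where "a l = (deriv ^^ l) f 0 / fact l" for l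
  have sums: "(\<lambda>l. a l * w ^ l) sums f w" if "norm w < R" for w
    using holomorphic_power_series[OF hol, of w] that by (simp add: a_def)
  have "\<theta> * R < R" using \<theta> R by simp
  with z have z_less: "norm z < R" by linarith
  have B0: "0 \<le> B" using B[of 0] R by (auto intro: order_trans[OF norm_ge_zero])
  have term_le: "norm (a l * z ^ l) \<le> B * \<theta> ^ l" for l
  proof -
    have "norm (a l * z ^ l) \<le> B / R ^ l * (\<theta> * R) ^ l"
      unfolding norm_mult norm_power using z B0 R
      by (intro mult_mono power_mono power_series_coeff_bound[OF sums]) (auto intro: B)
    then show ?thesis using R by (simp add: power_mult_distrib)
  qed
  have "f z = (\<Sum>l. a (l + Suc n) * z ^ (l + Suc n)) + (\<Sum>l<Suc n. a l * z ^ l)"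
    unfolding sums_unique[OF sums[OF z_less]]
    by (intro suminf_split_initial_segment sums_summable[OF sums[OF z_less]])
  then have "norm ((\<Sum>l\<le>n. a l * z ^ l) - f z) = norm (\<Sum>l. a (l + Suc n) * z ^ (l + Suc n))"
    unfolding lessThan_Suc_atMost by (simp add: norm_minus_commute)
  also have "\<dots> \<le> (\<Sum>l. B * \<theta> ^ Suc n * \<theta> ^ l)"
  proof (rule norm_suminf_le)
    show "norm (a (l + Suc n) * z ^ (l + Suc n)) \<le> B * \<theta> ^ Suc n * \<theta> ^ l" for l
      using term_le[of "l + Suc n"] by (simp add: power_add mult_ac)
  qed (use \<theta> in \<open>auto intro!: summable_mult summable_geometric\<close>)
  also have "\<dots> = B * \<theta> ^ Suc n / (1 - \<theta>)"
    using \<theta> by (subst suminf_mult) (auto simp: suminf_geometric intro!: summable_geometric)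
  finally show ?thesis by (simp add: a_def)
qed

lemma poly_split_reciprocal_root:
  fixes p :: "complex poly"
  assumes p0: "coeff p 0 = 1" and "degree p \<noteq> 0"
  obtains a q where "p = [:1, - a:] * q" "coeff q 0 = 1" "degree p = Suc (degree q)"
proof -
  obtain r where "poly p r = 0"
    using fundamental_theorem_of_algebra[of p] assms(2) by (auto simp: constant_degree)
  then obtain q where q: "p = [:- r, 1:] * q"
    by (metis poly_eq_0_iff_dvd dvdE)
  then have rq: "- r * coeff q 0 = 1"
    using p0 by (simp add: coeff_mult_0)
  then have "r \<noteq> 0" "q \<noteq> 0" by auto
  have "p = [:1, - (1 / r):] * Polynomial.smult (- r) q"
    unfolding q using \<open>r \<noteq> 0\<close> by (simp add: algebra_simps)
  moreover have "degree p = Suc (degree (Polynomial.smult (- r) q))"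
    unfolding q using \<open>r \<noteq> 0\<close> \<open>q \<noteq> 0\<close> by (subst degree_mult_eq) auto
  ultimately show thesis
    using rq by (intro that[of "1 / r" "Polynomial.smult (- r) q"]) auto
qed

lemma polynomial_factorization_at_0:
  fixes p :: "complex poly"
  assumes "coeff p 0 = 1" "degree p \<le> n"
  obtains x where "\<And>z. poly p z = (\<Prod>k<n. 1 - x k * z)"
proof -
  have "\<exists>x. \<forall>z. poly p z = (\<Prod>k<n. 1 - x k * z)"
    using assms
  proof (induction n arbitrary: p)
    case 0
    then obtain a where "p = [:a:]" by (auto elim: degree_eq_zeroE)
    with 0 show ?case by simp
  next
    case (Suc n)
    show ?case
    proof (cases "degree p = 0")
      case True
      then obtain a where "p = [:a:]" by (rule degree_eq_zeroE)
      then show ?thesis using Suc.prems(1) by (intro exI[of _ "\<lambda>_. 0"]) simp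
    next
      case False
      then obtain a q where p: "p = [:1, - a:] * q" and q: "coeff q 0 = 1" "degree p = Suc (degree q)"
        using poly_split_reciprocal_root[OF Suc.prems(1)] by blast
      then obtain x where "\<And>z. poly q z = (\<Prod>k<n. 1 - x k * z)"
        using Suc.IH[of q] Suc.prems(2) by auto
      then have "poly p z = (\<Prod>k<Suc n. 1 - (x(n := a)) k * z)" for z
        unfolding p by (simp add: algebra_simps)
      then show ?thesis by blast
    qed
  qed
  with that show thesis by blast
qed

lemma continuous_logarithms_eq:
  fixes f g :: "'a::topological_space \<Rightarrow> complex"
  assumes S: "connected S" and cont: "continuous_on S f" "continuous_on S g"
    and exp_eq: "\<And>z. z \<in> S \<Longrightarrow> exp (f z) = exp (g z)"
    and a: "a \<in> S" "f a = g a" and z: "z \<in> S"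
  shows "f z = g z"
proof -
  have "(\<lambda>z. f z - g z) constant_on S"
  proof (rule continuous_discrete_range_constant[OF S continuous_on_diff[OF cont]])
    fix x assume x: "x \<in> S"
    have "2 * pi \<le> norm ((f y - g y) - (f x - g x))" if "y \<in> S" "f y - g y \<noteq> f x - g x" for y
    proof (rule ccontr)
      assume "\<not> 2 * pi \<le> norm ((f y - g y) - (f x - g x))"
      then have "\<bar>Im (f y - g y) - Im (f x - g x)\<bar> < 2 * pi"
        using abs_Im_le_cmod[of "(f y - g y) - (f x - g x)"] by simp
      moreover have "exp (f y - g y) = exp (f x - g x)"
        using exp_eq x that by (simp add: exp_diff)
      ultimately show False
        using exp_complex_eqI that(2) by blast
    qed
    then show "\<exists>e>0. \<forall>y. y \<in> S \<and> f y - g y \<noteq> f x - g x \<longrightarrow> e \<le> norm ((f y - g y) - (f x - g x))"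
      by (intro exI[of _ "2 * pi"]) auto
  qed
  then obtain c where "\<And>x. x \<in> S \<Longrightarrow> f x - g x = c"
    unfolding constant_on_def by blast
  from this[OF a(1)] this[OF z] a(2) show ?thesis by simp
qed

lemma sum_pairs_mult:
  fixes a :: "nat \<Rightarrow> 'a::field_char_0"
  shows "(\<Sum>k<n. \<Sum>l<n. if k < l then a k * a l else 0) = ((\<Sum>k<n. a k)\<^sup>2 - (\<Sum>k<n. (a k)\<^sup>2)) / 2"
proof (induction n)
  case (Suc n)
  have "(\<Sum>l<n. if n < l then a n * a l else 0) = 0"
    by (intro sum.neutral) auto
  then have "(\<Sum>k<Suc n. \<Sum>l<Suc n. if k < l then a k * a l else 0) =
      (\<Sum>k<n. \<Sum>l<n. if k < l then a k * a l else 0) + (\<Sum>k<n. a k) * a n"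
    by (simp add: sum.distrib sum_distrib_right)
  then show ?case
    unfolding Suc by (simp add: power2_eq_square field_simps)
qed simp

definition log_coeff :: "nat \<Rightarrow> (nat \<Rightarrow> complex) \<Rightarrow> nat \<Rightarrow> complex" where
  "log_coeff n x m = (\<Sum>k<n. x k ^ m) / of_nat m"

lemma log_coeff_sums:
  assumes "\<And>k. k < n \<Longrightarrow> norm (x k * z) < 1"
  shows "(\<lambda>m. log_coeff n x m * z ^ m) sums (\<Sum>k<n. - Ln (1 - x k * z))"
proof -
  have "(\<lambda>m. \<Sum>k<n. (x k * z) ^ m / of_nat m) sums (\<Sum>k<n. - Ln (1 - x k * z))"
    by (intro sums_sum neg_Ln_sums assms) auto
  moreover have "(\<Sum>k<n. (x k * z) ^ m / of_nat m) = log_coeff n x m * z ^ m" for m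
    unfolding log_coeff_def by (simp add: power_mult_distrib flip: sum_divide_distrib sum_distrib_right)
  ultimately show ?thesis by simp
qed

lemma pair_prod_inverse_eq_exp_log_coeff:
  assumes lt1: "\<And>k. k < n \<Longrightarrow> norm (x k) < 1"
  obtains S where "(\<lambda>m. of_nat m * (log_coeff n x m)\<^sup>2 / 2 - log_coeff n x (2 * m)) sums S"
    and "pair_prod n (\<lambda>k l. 1 / (1 - x k * x l)) = exp S"
proof
  define S where "S = (\<Sum>k<n. \<Sum>l<n. if k < l then - Ln (1 - x k * x l) else 0)"
  have less_1: "norm (x k * x l) < 1" if "k < n" "l < n" for k l
    using norm_mult_less[OF lt1[OF that(1)] lt1[OF that(2)]] by simp
  have "(\<lambda>m. \<Sum>k<n. \<Sum>l<n. if k < l then (x k * x l) ^ m / of_nat m else 0) sums S"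
    unfolding S_def by (intro sums_sum) (use neg_Ln_sums[OF less_1] in auto)
  moreover have "(\<Sum>k<n. \<Sum>l<n. if k < l then (x k * x l) ^ m / of_nat m else 0) =
      of_nat m * (log_coeff n x m)\<^sup>2 / 2 - log_coeff n x (2 * m)" for m
  proof -
    have "(\<Sum>k<n. \<Sum>l<n. if k < l then (x k * x l) ^ m / of_nat m else 0) =
        (\<Sum>k<n. \<Sum>l<n. if k < l then x k ^ m * x l ^ m else 0) / of_nat m"
      unfolding sum_divide_distrib by (intro sum.cong refl) (auto simp: power_mult_distrib)
    also have "\<dots> = of_nat m * (log_coeff n x m)\<^sup>2 / 2 - log_coeff n x (2 * m)"
      unfolding sum_pairs_mult log_coeff_def
      by (cases "m = 0") (auto simp: field_simps power2_eq_square power_mult)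
    finally show ?thesis .
  qed
  ultimately show "(\<lambda>m. of_nat m * (log_coeff n x m)\<^sup>2 / 2 - log_coeff n x (2 * m)) sums S"
    by simp
  show "pair_prod n (\<lambda>k l. 1 / (1 - x k * x l)) = exp S"
    unfolding S_def pair_prod_def exp_sum[OF finite_lessThan]
  proof (intro prod.cong refl)
    fix k l assume "k \<in> {..<n}" "l \<in> {..<n}"
    then have "1 - x k * x l \<noteq> 0" using less_1[of k l] by auto
    then show "(if k < l then 1 / (1 - x k * x l) else 1) = exp (if k < l then - Ln (1 - x k * x l) else 0)"
      by (simp add: exp_minus inverse_eq_divide)
  qed
qed

lemma not_nonpos_Reals_near_1:
  fixes w :: complex
  assumes "norm (1 - w) < 1"
  shows "w \<notin> \<real>\<^sub>\<le>\<^sub>0"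
  using complex_Re_le_cmod[of "1 - w"] assms by (auto simp: complex_nonpos_Reals_iff)

lemma sum_of_nat_power_le:
  fixes s :: real
  assumes "0 \<le> s" "s < 1"
  shows "summable (\<lambda>m. real m * s ^ m)" and "(\<Sum>m. real m * s ^ m) \<le> 1 / (1 - s)\<^sup>2"
proof -
  have sums: "(\<lambda>m. real (Suc m) * s ^ m) sums (1 / (1 - s)\<^sup>2)"
    using assms geometric_deriv_sums[of s] by simp
  show summable: "summable (\<lambda>m. real m * s ^ m)"
    by (rule summable_comparison_test'[OF sums_summable[OF sums], of 0])
       (use assms in \<open>auto intro!: mult_right_mono\<close>)
  show "(\<Sum>m. real m * s ^ m) \<le> 1 / (1 - s)\<^sup>2"
    unfolding sums_unique[OF sums] using assms
    by (intro suminf_le summable sums_summable[OF sums] mult_right_mono) auto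
qed

definition cosine_variance :: "(nat \<Rightarrow> real) \<Rightarrow> real" where
  "cosine_variance v = (\<Sum>k. real k * (v k)\<^sup>2)"

definition cosine_shift :: "(nat \<Rightarrow> real) \<Rightarrow> real" where
  "cosine_shift v = (\<Sum>k. v (2 * k))"

definition gaussian_exponent :: "(nat \<Rightarrow> real) \<Rightarrow> complex \<Rightarrow> complex" where
  "gaussian_exponent v \<tau> = \<tau>\<^sup>2 / 2 * of_real (cosine_variance v) - \<tau> * of_real (cosine_shift v)"

text \<open>The bound on the coefficients makes \<open>\<Sum>\<^sub>k v\<^sub>k z\<^sup>k\<close> bounded by \<open>C\<close> on the disc of radius \<open>1 / s\<^sup>3\<close>.\<close>

locale analytic_symbol =
  fixes W :: "real \<Rightarrow> real" and v :: "nat \<Rightarrow> real" and s C :: real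
  assumes s_pos: "0 < s" and s_less_1: "s < 1" and v_0: "v 0 = 0"
    and abs_v_le: "\<bar>v k\<bar> \<le> C * (1 - s) * s ^ (4 * k)"
    and measurable_W [measurable]: "W \<in> borel_measurable borel"
    and cosine_series: "(\<lambda>k. v k * (2 * cos (real k * t))) sums W (2 * cos t)"
begin

lemma C_nonneg: "0 \<le> C"
  using abs_v_le[of 0] s_less_1 by (simp add: v_0 zero_le_mult_iff)

lemma abs_v_le_power: "\<bar>v k\<bar> \<le> C * s ^ k"
proof -
  have "\<bar>v k\<bar> \<le> C * 1 * s ^ k"
    using C_nonneg s_pos s_less_1
    by (intro order.trans[OF abs_v_le] mult_mono power_decreasing) auto
  then show ?thesis by simp
qed

lemma abs_v_le_C: "\<bar>v k\<bar> \<le> C"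
  using abs_v_le_power[of k] C_nonneg s_pos s_less_1
  by (meson mult_left_le order_trans power_le_one less_imp_le)

lemma cosine_variance_sums: "(\<lambda>k. real k * (v k)\<^sup>2) sums cosine_variance v"
  unfolding cosine_variance_def
proof (rule summable_sums,
    rule summable_comparison_test'[OF summable_mult[OF sum_of_nat_power_le(1)], of s 0])
  fix k
  have "\<bar>v k\<bar> * \<bar>v k\<bar> \<le> C * (C * s ^ k)"
    using abs_v_le_power[of k] abs_v_le_C[of k] C_nonneg by (intro mult_mono) auto
  then have "real k * (\<bar>v k\<bar> * \<bar>v k\<bar>) \<le> real k * (C * (C * s ^ k))"
    by (rule mult_left_mono) simp
  then show "norm (real k * (v k)\<^sup>2) \<le> C * C * (real k * s ^ k)"
    by (simp add: power2_eq_square mult_ac abs_mult)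
qed (use s_pos s_less_1 in auto)

lemma cosine_shift_sums: "(\<lambda>k. v (2 * k)) sums cosine_shift v"
  unfolding cosine_shift_def
proof (rule summable_sums, rule summable_comparison_test'[of "\<lambda>k. C * s ^ k" 0])
  fix k
  have "s ^ (2 * k) \<le> s ^ k" using s_pos s_less_1 by (intro power_decreasing) auto
  then show "norm (v (2 * k)) \<le> C * s ^ k"
    using abs_v_le_power[of "2 * k"] mult_left_mono[OF _ C_nonneg, of "s ^ (2 * k)" "s ^ k"] by simp
qed (use s_pos s_less_1 in \<open>auto intro!: summable_mult summable_geometric\<close>)

definition V :: "complex \<Rightarrow> complex" where
  "V z = (\<Sum>k. of_real (v k) * z ^ k)"

lemma norm_V_term_le:
  assumes "norm z \<le> 1 / s ^ 3"
  shows "norm (complex_of_real (v k) * z ^ k) \<le> C * (1 - s) * s ^ k"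
proof -
  have "norm (complex_of_real (v k) * z ^ k) \<le> C * (1 - s) * s ^ (4 * k) * (1 / s ^ 3) ^ k"
    unfolding norm_mult norm_power norm_of_real using assms C_nonneg s_pos s_less_1
    by (intro mult_mono power_mono abs_v_le) auto
  moreover have "s ^ (4 * k) = s ^ (3 * k) * s ^ k"
    by (simp flip: power_add)
  ultimately show ?thesis
    using s_pos by (simp add: power_divide power_mult)
qed

lemma geometric_bound_sums: "(\<lambda>k. C * (1 - s) * s ^ k) sums C"
  using sums_mult[OF geometric_sums[of s], of "C * (1 - s)"] s_pos s_less_1 by simp

lemma V_sums:
  assumes "norm z \<le> 1 / s ^ 3"
  shows "(\<lambda>k. of_real (v k) * z ^ k) sums V z"
  unfolding V_def
  by (rule summable_sums, rule summable_comparison_test'[OF sums_summable[OF geometric_bound_sums], of 0])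
     (rule norm_V_term_le[OF assms])

lemma norm_V_le:
  assumes "norm z \<le> 1 / s ^ 3"
  shows "norm (V z) \<le> C"
proof -
  have "norm (V z) \<le> (\<Sum>k. C * (1 - s) * s ^ k)"
    unfolding V_def by (rule norm_suminf_le[OF norm_V_term_le[OF assms]
        sums_summable[OF geometric_bound_sums]])
  also have "\<dots> = C"
    by (rule sums_unique[OF geometric_bound_sums, symmetric])
  finally show ?thesis .
qed

lemma holomorphic_V: "V holomorphic_on ball 0 (1 / s ^ 3)"
  by (rule power_series_holomorphic[where a="\<lambda>k. complex_of_real (v k)"]) (use V_sums in auto)

lemma V_0: "V 0 = 0"
  using sums_unique2[OF V_sums[of 0] powser_sums_zero] s_pos v_0 by simp

lemma one_less_inverse_powers: "1 < 1 / s" "1 / s < 1 / s ^ 2" "1 / s ^ 2 < 1 / s ^ 3"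
  using s_pos s_less_1 by (auto simp: field_simps power_numeral_reduce)

lemma norm_cis_le: "norm (cis t) \<le> 1 / s ^ 2" "norm (cis t) \<le> 1 / s ^ 3"
  unfolding norm_cis using one_less_inverse_powers by linarith+

lemma V_cis_add: "V (cis t) + V (cis (- t)) = of_real (W (2 * cos t))"
proof -
  have "(\<lambda>k. of_real (v k) * cis t ^ k + of_real (v k) * cis (- t) ^ k) sums (V (cis t) + V (cis (- t)))"
    by (intro sums_add V_sums norm_cis_le)
  moreover have "of_real (v k) * cis t ^ k + of_real (v k) * cis (- t) ^ k =
      complex_of_real (v k * (2 * cos (real k * t)))" for k
    unfolding Complex.DeMoivre by (simp add: complex_eq_iff)
  ultimately have "(\<lambda>k. complex_of_real (v k * (2 * cos (real k * t)))) sums (V (cis t) + V (cis (- t)))"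
    by simp
  then show ?thesis
    by (rule sums_unique2) (rule sums_of_real[OF cosine_series])
qed

lemma abs_W_le:
  assumes "u \<in> {-2..2}"
  shows "\<bar>W u\<bar> \<le> 2 * C"
proof -
  have "norm (V (cis t) + V (cis (- t))) \<le> C + C" for t
    by (intro norm_triangle_mono norm_V_le norm_cis_le)
  then have "\<bar>W (2 * cos t)\<bar> \<le> 2 * C" for t
    by (simp add: V_cis_add)
  then show ?thesis
    using two_cos_arccos_half[OF assms] by metis
qed

lemma norm_exp_V_le:
  assumes "norm z \<le> 1 / s ^ 3"
  shows "norm (exp (\<tau> * V z)) \<le> exp (norm \<tau> * C)"
proof -
  have "norm (\<tau> * V z) \<le> norm \<tau> * C"
    unfolding norm_mult by (intro mult_left_mono norm_V_le assms) simp
  then show ?thesis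
    using norm_exp[of "\<tau> * V z"] by (force intro: order.trans)
qed

definition taylor_poly :: "complex \<Rightarrow> nat \<Rightarrow> complex poly" where
  "taylor_poly \<tau> n = (\<Sum>l\<le>n. monom ((deriv ^^ l) (\<lambda>z. exp (- \<tau> * V z)) 0 / fact l) l)"

lemma coeff_0_taylor_poly: "coeff (taylor_poly \<tau> n) 0 = 1"
  by (simp add: taylor_poly_def coeff_sum if_distrib V_0 cong: if_cong)

lemma degree_taylor_poly_le: "degree (taylor_poly \<tau> n) \<le> n"
  unfolding taylor_poly_def by (intro degree_sum_le) (auto intro: order.trans[OF degree_monom_le])

definition ratio :: "complex \<Rightarrow> nat \<Rightarrow> complex \<Rightarrow> complex" where
  "ratio \<tau> n z = poly (taylor_poly \<tau> n) z * exp (\<tau> * V z)"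

lemma poly_taylor_poly_eq: "poly (taylor_poly \<tau> n) z = exp (- \<tau> * V z) * ratio \<tau> n z"
  by (simp add: ratio_def exp_minus)

definition ratio_error :: "complex \<Rightarrow> nat \<Rightarrow> real" where
  "ratio_error \<tau> n = (exp (norm \<tau> * C))\<^sup>2 * s ^ n / (1 - s)"

lemma ratio_error_nonneg: "0 \<le> ratio_error \<tau> n"
  using s_pos s_less_1 by (simp add: ratio_error_def)

lemma norm_ratio_minus_1_le:
  assumes z: "norm z \<le> 1 / s ^ 2"
  shows "norm (ratio \<tau> n z - 1) \<le> ratio_error \<tau> n"
proof -
  have hol: "(\<lambda>z. exp (- \<tau> * V z)) holomorphic_on ball 0 (1 / s ^ 3)"
    by (intro holomorphic_intros holomorphic_V)
  have bound: "norm (exp (- \<tau> * V w)) \<le> exp (norm \<tau> * C)" if "norm w < 1 / s ^ 3" for w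
    using norm_exp_V_le[of w "- \<tau>"] that by (simp only: norm_minus_cancel less_imp_le)
  have radius: "0 < 1 / s ^ 3" "norm z \<le> s * (1 / s ^ 3)"
    using z s_pos by (simp_all add: power_numeral_reduce)
  have "norm (poly (taylor_poly \<tau> n) z - exp (- \<tau> * V z)) \<le> exp (norm \<tau> * C) * s ^ Suc n / (1 - s)"
    unfolding taylor_poly_def poly_sum poly_monom
    by (rule taylor_polynomial_error_bound[OF hol radius(1) bound s_pos s_less_1 radius(2)])
  also have "\<dots> \<le> exp (norm \<tau> * C) * s ^ n / (1 - s)"
    using s_pos s_less_1 by (intro divide_right_mono mult_left_mono power_decreasing) auto
  finally have "norm ((poly (taylor_poly \<tau> n) z - exp (- \<tau> * V z)) * exp (\<tau> * V z)) \<le>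
      exp (norm \<tau> * C) * s ^ n / (1 - s) * exp (norm \<tau> * C)"
    unfolding norm_mult using z one_less_inverse_powers s_pos s_less_1
    by (intro mult_mono norm_exp_V_le) auto
  moreover have "(poly (taylor_poly \<tau> n) z - exp (- \<tau> * V z)) * exp (\<tau> * V z) = ratio \<tau> n z - 1"
    by (simp add: ratio_def exp_minus field_simps)
  ultimately show ?thesis
    by (simp add: ratio_error_def power2_eq_square mult_ac)
qed

lemma continuous_on_ratio: "continuous_on (ball 0 (1 / s ^ 2)) (ratio \<tau> n)"
proof -
  have "ball 0 (1 / s ^ 2) \<subseteq> ball (0::complex) (1 / s ^ 3)"
    using one_less_inverse_powers by (intro subset_ball) simp
  then show ?thesis
    unfolding ratio_def[abs_def]
    by (intro continuous_intros continuous_on_subset[OF holomorphic_on_imp_continuous_on[OF holomorphic_V]])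
qed

definition taylor_roots :: "complex \<Rightarrow> nat \<Rightarrow> (nat \<Rightarrow> complex) \<Rightarrow> bool" where
  "taylor_roots \<tau> n x \<longleftrightarrow> (\<forall>z. poly (taylor_poly \<tau> n) z = (\<Prod>k<n. 1 - x k * z))"

lemma ex_taylor_roots: "\<exists>x. taylor_roots \<tau> n x"
  unfolding taylor_roots_def
  using polynomial_factorization_at_0[OF coeff_0_taylor_poly degree_taylor_poly_le] by metis

lemma prod_chebyshev_denom_taylor_roots:
  assumes "taylor_roots \<tau> n x"
  shows "(\<Prod>k<n. chebyshev_denom (x k) (of_real (2 * cos t))) =
         exp (- \<tau> * of_real (W (2 * cos t))) * (ratio \<tau> n (cis t) * ratio \<tau> n (cis (- t)))"
proof -
  have "(\<Prod>k<n. chebyshev_denom (x k) (of_real (2 * cos t))) =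
      poly (taylor_poly \<tau> n) (cis t) * poly (taylor_poly \<tau> n) (cis (- t))"
    using assms unfolding chebyshev_denom_cos prod.distrib taylor_roots_def by simp
  also have "\<dots> = exp (- \<tau> * (V (cis t) + V (cis (- t)))) * (ratio \<tau> n (cis t) * ratio \<tau> n (cis (- t)))"
    unfolding poly_taylor_poly_eq ring_distribs exp_add by (simp add: mult_ac)
  finally show ?thesis unfolding V_cis_add .
qed

context
  fixes \<tau> :: complex and n :: nat and x :: "nat \<Rightarrow> complex"
  assumes roots: "taylor_roots \<tau> n x" and small: "ratio_error \<tau> n \<le> 1 / 4"
begin

lemma norm_ratio_minus_1_le_quarter: "norm z \<le> 1 / s ^ 2 \<Longrightarrow> norm (ratio \<tau> n z - 1) \<le> 1 / 4"
  using norm_ratio_minus_1_le small order_trans by blast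

lemma norm_taylor_root_less:
  assumes k: "k < n"
  shows "norm (x k) < s ^ 2"
proof (rule ccontr)
  assume contra: "\<not> norm (x k) < s ^ 2"
  then have x0: "x k \<noteq> 0" using s_pos by auto
  have "norm (1 / x k) \<le> 1 / s ^ 2"
    using contra s_pos x0 by (auto simp: norm_divide intro!: divide_left_mono mult_pos_pos)
  then have "ratio \<tau> n (1 / x k) \<noteq> 0"
    using norm_ratio_minus_1_le_quarter[of "1 / x k"] by auto
  moreover have "poly (taylor_poly \<tau> n) (1 / x k) = 0"
    using roots k x0 by (auto simp: taylor_roots_def intro!: prod_zero)
  ultimately show False by (simp add: ratio_def)
qed

lemma norm_taylor_root_less_1: "k < n \<Longrightarrow> norm (x k) < 1"
  using norm_taylor_root_less[of k] power_le_one[of s 2] s_pos s_less_1 by simp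

lemma norm_taylor_root_mult_less_1:
  assumes "k < n" "norm z < 1 / s ^ 2"
  shows "norm (x k * z) < 1"
  using norm_mult_less[OF norm_taylor_root_less[OF assms(1)] assms(2)] s_pos by simp

lemma sum_neg_Ln_taylor_roots:
  assumes z: "norm z < 1 / s ^ 2"
  shows "(\<Sum>k<n. - Ln (1 - x k * z)) = \<tau> * V z - Ln (ratio \<tau> n z)"
  \<comment> \<open>Both sides are logarithms of \<open>1 / \<Prod>\<^sub>k (1 - x\<^sub>k z)\<close> that vanish at the origin.\<close>
proof (rule continuous_logarithms_eq[where S="ball 0 (1 / s ^ 2)" and a=0
      and f="\<lambda>z. \<Sum>k<n. - Ln (1 - x k * z)" and g="\<lambda>z. \<tau> * V z - Ln (ratio \<tau> n z)"])
  have "ball 0 (1 / s ^ 2) \<subseteq> ball (0::complex) (1 / s ^ 3)"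
    using one_less_inverse_powers by (intro subset_ball) simp
  moreover have "norm (1 - ratio \<tau> n w) < 1" if "w \<in> ball 0 (1 / s ^ 2)" for w
    using norm_ratio_minus_1_le_quarter[of w] that by (simp add: norm_minus_commute)
  ultimately show "continuous_on (ball 0 (1 / s ^ 2)) (\<lambda>z. \<tau> * V z - Ln (ratio \<tau> n z))"
    by (intro continuous_intros continuous_on_ratio not_nonpos_Reals_near_1
          continuous_on_subset[OF holomorphic_on_imp_continuous_on[OF holomorphic_V]])
  show "continuous_on (ball 0 (1 / s ^ 2)) (\<lambda>z. \<Sum>k<n. - Ln (1 - x k * z))"
    by (intro continuous_intros not_nonpos_Reals_near_1) (simp add: norm_taylor_root_mult_less_1)
  show "(\<Sum>k<n. - Ln (1 - x k * 0)) = \<tau> * V 0 - Ln (ratio \<tau> n 0)"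
    using coeff_0_taylor_poly[of \<tau> n] by (simp add: ratio_def V_0 poly_0_coeff_0)
  fix w :: complex assume "w \<in> ball 0 (1 / s ^ 2)"
  then have w: "norm w < 1 / s ^ 2" by simp
  have "1 - x k * w \<noteq> 0" if "k < n" for k
    using norm_taylor_root_mult_less_1[OF that w] by auto
  then have "exp (- Ln (1 - x k * w)) = 1 / (1 - x k * w)" if "k < n" for k
    using that by (simp add: exp_minus inverse_eq_divide)
  then have "exp (\<Sum>k<n. - Ln (1 - x k * w)) = 1 / poly (taylor_poly \<tau> n) w"
    using roots by (simp add: exp_sum taylor_roots_def prod_dividef)
  also have "\<dots> = exp (\<tau> * V w) / ratio \<tau> n w"
    by (simp add: poly_taylor_poly_eq exp_minus divide_inverse)
  also have "ratio \<tau> n w \<noteq> 0"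
    using norm_ratio_minus_1_le_quarter[of w] w by auto
  then have "exp (\<tau> * V w) / ratio \<tau> n w = exp (\<tau> * V w - Ln (ratio \<tau> n w))"
    by (simp add: exp_diff)
  finally show "exp (\<Sum>k<n. - Ln (1 - x k * w)) = exp (\<tau> * V w - Ln (ratio \<tau> n w))" .
qed (use z s_pos in auto)

lemma norm_log_coeff_error_le: "norm (log_coeff n x m - \<tau> * of_real (v m)) \<le>
    2 * ratio_error \<tau> n * s ^ (2 * m)"
proof -
  have "norm (log_coeff n x m - \<tau> * of_real (v m)) \<le> 2 * ratio_error \<tau> n / (1 / s ^ 2) ^ m"
  proof (rule power_series_coeff_bound[where h="\<lambda>z. - Ln (ratio \<tau> n z)"])
    fix z :: complex assume z: "norm z < 1 / s ^ 2"
    have "(\<lambda>m. log_coeff n x m * z ^ m - \<tau> * (of_real (v m) * z ^ m)) sums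
        ((\<Sum>k<n. - Ln (1 - x k * z)) - \<tau> * V z)"
      using z one_less_inverse_powers
      by (intro sums_diff sums_mult log_coeff_sums V_sums norm_taylor_root_mult_less_1) auto
    then show "(\<lambda>m. (log_coeff n x m - \<tau> * of_real (v m)) * z ^ m) sums (- Ln (ratio \<tau> n z))"
      unfolding sum_neg_Ln_taylor_roots[OF z] by (simp add: algebra_simps)
    have "norm (Ln (1 + (ratio \<tau> n z - 1))) \<le> 2 * norm (ratio \<tau> n z - 1)"
      using norm_ratio_minus_1_le_quarter[of z] z by (intro norm_Ln_le) auto
    then show "norm (- Ln (ratio \<tau> n z)) \<le> 2 * ratio_error \<tau> n"
      using norm_ratio_minus_1_le[of z \<tau> n] z by simp
  qed (use s_pos in auto)
  then show ?thesis by (simp add: power_divide power_mult)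
qed

lemma norm_quadratic_error_term_le:
  fixes h :: "nat \<Rightarrow> complex"
  assumes h: "\<And>m. norm (h m) \<le> 2 * ratio_error \<tau> n * s ^ (2 * m)" and "0 < m"
  shows "norm (of_nat m * (h m * (2 * \<tau> * of_real (v m) + h m)) / 2 - h (2 * m)) \<le>
         2 * ratio_error \<tau> n * (norm \<tau> * C + 2) * (real m * s ^ m)"
proof -
  define \<eta> where "\<eta> = ratio_error \<tau> n"
  have \<eta>: "0 \<le> \<eta>" using ratio_error_nonneg by (simp add: \<eta>_def)
  have pow: "s ^ (2 * k) \<le> s ^ k" "s ^ k \<le> 1" for k
    using s_pos s_less_1 by (auto intro!: power_decreasing power_le_one)
  have h_le: "norm (h k) \<le> 2 * \<eta> * s ^ k" for k
    using h[of k] mult_left_mono[OF pow(1), of "2 * \<eta>" k] \<eta> by (simp add: \<eta>_def)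
  have "norm (2 * \<tau> * of_real (v m) + h m) \<le> 2 * (norm \<tau> * \<bar>v m\<bar>) + norm (h m)"
    by (rule order.trans[OF norm_triangle_ineq]) (simp add: norm_mult)
  also have "\<dots> \<le> 2 * (norm \<tau> * C) + 2 * \<eta>"
    using h_le[of m] mult_left_mono[OF pow(2), of "2 * \<eta>" m] \<eta>
        mult_left_mono[OF abs_v_le_C[of m], of "norm \<tau>"] by simp
  finally have "norm (2 * \<tau> * of_real (v m) + h m) \<le> 2 * (norm \<tau> * C) + 2"
    using small by (simp add: \<eta>_def)
  then have "norm (of_nat m * (h m * (2 * \<tau> * of_real (v m) + h m)) / 2) \<le>
      real m * ((2 * \<eta> * s ^ m) * (2 * (norm \<tau> * C) + 2)) / 2"
    unfolding norm_mult norm_divide norm_of_nat norm_numeral using h_le[of m] \<eta> s_pos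
    by (intro divide_right_mono mult_left_mono mult_mono) auto
  moreover have "norm (h (2 * m)) \<le> 2 * \<eta> * (real m * s ^ m)"
  proof -
    have "s ^ (2 * m) \<le> 1 * s ^ m" using pow by simp
    also have "\<dots> \<le> real m * s ^ m" using \<open>0 < m\<close> s_pos by (intro mult_right_mono) auto
    finally show ?thesis
      using h_le[of "2 * m"] mult_left_mono[of "s ^ (2 * m)" "real m * s ^ m" "2 * \<eta>"] \<eta> by simp
  qed
  ultimately show ?thesis
    using norm_triangle_ineq4[of "of_nat m * (h m * (2 * \<tau> * of_real (v m) + h m)) / 2" "h (2 * m)"]
    by (simp add: \<eta>_def algebra_simps)
qed

lemma norm_diff_gaussian_exponent_le:
  assumes S: "(\<lambda>m. of_nat m * (log_coeff n x m)\<^sup>2 / 2 - log_coeff n x (2 * m)) sums S"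
  shows "norm (S - gaussian_exponent v \<tau>) \<le> 2 * ratio_error \<tau> n * (norm \<tau> * C + 2) / (1 - s)\<^sup>2"
proof -
  define h where "h m = log_coeff n x m - \<tau> * of_real (v m)" for m
  have h_0: "h 0 = 0" by (simp add: h_def log_coeff_def v_0)
  have h_le: "norm (h m) \<le> 2 * ratio_error \<tau> n * s ^ (2 * m)" for m
    unfolding h_def by (rule norm_log_coeff_error_le)
  have "(\<lambda>m. \<tau>\<^sup>2 / 2 * of_real (real m * (v m)\<^sup>2) - \<tau> * of_real (v (2 * m))) sums (gaussian_exponent v \<tau>)"
    unfolding gaussian_exponent_def
    by (intro sums_diff sums_mult sums_of_real cosine_variance_sums cosine_shift_sums)
  from sums_diff[OF S this]
  have diff: "(\<lambda>m. of_nat m * (h m * (2 * \<tau> * of_real (v m) + h m)) / 2 - h (2 * m)) sums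
      (S - gaussian_exponent v \<tau>)"
    by (simp add: h_def algebra_simps power2_eq_square add_divide_distrib diff_divide_distrib)
  have geometric: "summable (\<lambda>m. real m * s ^ m)" "(\<Sum>m. real m * s ^ m) \<le> 1 / (1 - s)\<^sup>2"
    using sum_of_nat_power_le[of s] s_pos s_less_1 by auto
  have "norm (S - gaussian_exponent v \<tau>) \<le> (\<Sum>m. 2 * ratio_error \<tau> n * (norm \<tau> * C + 2) * (real m * s ^ m))"
    unfolding sums_unique[OF diff]
  proof (rule norm_suminf_le)
    show "norm (of_nat m * (h m * (2 * \<tau> * of_real (v m) + h m)) / 2 - h (2 * m)) \<le>
        2 * ratio_error \<tau> n * (norm \<tau> * C + 2) * (real m * s ^ m)" for m
      using h_0 h_le by (cases "m = 0") (simp_all add: norm_quadratic_error_term_le)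
  qed (intro summable_mult geometric)
  also have "\<dots> = 2 * ratio_error \<tau> n * (norm \<tau> * C + 2) * (\<Sum>m. real m * s ^ m)"
    by (rule suminf_mult[OF geometric(1)])
  also have "\<dots> \<le> 2 * ratio_error \<tau> n * (norm \<tau> * C + 2) * (1 / (1 - s)\<^sup>2)"
    using ratio_error_nonneg C_nonneg geometric(2) by (intro mult_left_mono) auto
  finally show ?thesis by simp
qed

lemma pair_prod_taylor_roots_eq_exp:
  obtains S where "pair_prod n (\<lambda>k l. 1 / (1 - x k * x l)) = exp S"
    and "norm (S - gaussian_exponent v \<tau>) \<le> 2 * ratio_error \<tau> n * (norm \<tau> * C + 2) / (1 - s)\<^sup>2"
proof (rule pair_prod_inverse_eq_exp_log_coeff)
  show "norm (x k) < 1" if "k < n" for k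
    by (rule norm_taylor_root_less_1[OF that])
qed (blast intro: that norm_diff_gaussian_exponent_le)

end

end

section \<open>Laplace transforms of linear statistics\<close>

definition linear_statistic :: "(real \<Rightarrow> real) \<Rightarrow> nat \<Rightarrow> (nat \<Rightarrow> real) \<Rightarrow> real" where
  "linear_statistic W n y = (\<Sum>i<n. W (y i))"

lemma measurable_linear_statistic [measurable]:
  assumes [measurable]: "W \<in> borel_measurable borel"
  shows "linear_statistic W n \<in> borel_measurable (ope n)"
  unfolding linear_statistic_def[abs_def] by measurable

lemma AE_abs_linear_statistic_le:
  assumes "\<And>u. u \<in> {-2..2} \<Longrightarrow> \<bar>W u\<bar> \<le> K"
  shows "AE y in ope n. \<bar>linear_statistic W n y\<bar> \<le> real n * K"
  using AE_ope_support
proof eventually_elim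
  case (elim y)
  have "\<bar>linear_statistic W n y\<bar> \<le> (\<Sum>i<n. \<bar>W (y i)\<bar>)"
    unfolding linear_statistic_def by (rule sum_abs)
  also have "\<dots> \<le> (\<Sum>i<n. K)"
    using elim by (intro sum_mono assms) auto
  finally show ?case by simp
qed

lemma integrable_linear_statistic:
  assumes [measurable]: "W \<in> borel_measurable borel" and W_le: "\<And>u. u \<in> {-2..2} \<Longrightarrow> \<bar>W u\<bar> \<le> K"
  shows "integrable (ope n) (linear_statistic W n)"
    and "integrable (ope n) (\<lambda>y. exp (b * complex_of_real (linear_statistic W n y)))"
    and "integrable (ope n) (\<lambda>y. exp (a * linear_statistic W n y))"
proof -
  interpret prob_space "ope n" by (rule prob_space_ope)
  have AE_le: "AE y in ope n. \<bar>linear_statistic W n y\<bar> \<le> real n * K"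
    by (rule AE_abs_linear_statistic_le) (rule W_le)
  show "integrable (ope n) (linear_statistic W n)"
    by (rule integrable_const_bound[of _ "real n * K"]) (use AE_le in auto)
  show complex: "integrable (ope n) (\<lambda>y. exp (b * complex_of_real (linear_statistic W n y)))" for b
  proof (rule integrable_const_bound)
    show "AE y in ope n. norm (exp (b * complex_of_real (linear_statistic W n y))) \<le>
        exp (\<bar>Re b\<bar> * (real n * K))"
      using AE_le
    proof eventually_elim
      case (elim y)
      have "Re b * linear_statistic W n y \<le> \<bar>Re b\<bar> * \<bar>linear_statistic W n y\<bar>"
        by (metis abs_ge_self abs_mult)
      also have "\<dots> \<le> \<bar>Re b\<bar> * (real n * K)"
        by (intro mult_left_mono elim) auto
      finally show ?case by simp
    qed
  qed measurable
  show "integrable (ope n) (\<lambda>y. exp (a * linear_statistic W n y))"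
    using integrable_norm[OF complex[of "of_real a"]] by simp
qed

lemma norm_prod_near_1:
  fixes g :: "nat \<Rightarrow> 'a::real_normed_field"
  assumes g: "\<And>i. i < n \<Longrightarrow> norm (g i - 1) \<le> \<delta>" and \<delta>: "0 \<le> \<delta>" "real n * \<delta> \<le> 1"
  shows "norm ((\<Prod>i<n. g i) - 1) \<le> 2 * (real n * \<delta>)"
proof -
  have "norm ((\<Prod>i<n. g i) - 1) = norm ((\<Prod>i<n. 1 + (g i - 1)) - 1)" by simp
  also have "\<dots> \<le> (\<Prod>i<n. 1 + norm (g i - 1)) - 1"
    by (rule norm_prod_minus1_le_prod_minus1)
  also have "(\<Prod>i<n. 1 + norm (g i - 1)) \<le> (\<Prod>i<n. exp \<delta>)"
    using g by (intro prod_mono conjI) (auto intro: add_nonneg_nonneg order.trans[OF _ exp_ge_add_one_self])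
  also have "\<dots> = exp (real n * \<delta>)" by (simp add: exp_of_nat_mult)
  also have "exp (real n * \<delta>) \<le> 1 + real n * \<delta> + (real n * \<delta>)\<^sup>2"
    using \<delta> by (intro exp_bound) auto
  also have "(real n * \<delta>)\<^sup>2 \<le> real n * \<delta>"
    using \<delta> by (simp add: power2_eq_square mult_left_le)
  finally show ?thesis by (simp add: mult.commute)
qed

lemma norm_mult_minus_1_le:
  fixes a b :: "'a::real_normed_algebra_1"
  assumes "norm (a - 1) \<le> \<delta>" "norm (b - 1) \<le> \<delta>" "\<delta> \<le> 1"
  shows "norm (a * b - 1) \<le> 3 * \<delta>"
proof -
  have "norm ((a - 1) * (b - 1)) \<le> norm (a - 1) * norm (b - 1)"
    by (rule norm_mult_ineq)
  also have "\<dots> \<le> \<delta> * 1"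
    using assms order_trans[OF norm_ge_zero assms(1)] by (intro mult_mono) auto
  finally have "norm ((a - 1) * (b - 1)) \<le> \<delta>" by simp
  moreover have eq: "a * b - 1 = (a - 1) * (b - 1) + (a - 1) + (b - 1)"
    by (simp add: algebra_simps)
  have "norm (a * b - 1) \<le> norm ((a - 1) * (b - 1)) + norm (a - 1) + norm (b - 1)"
    unfolding eq by (intro order.trans[OF norm_triangle_ineq] add_mono norm_triangle_ineq order_refl)
  ultimately show ?thesis
    using assms(1,2) by linarith
qed

definition laplace_error :: "real \<Rightarrow> real \<Rightarrow> complex \<Rightarrow> nat \<Rightarrow> real" where
  "laplace_error s C \<tau> n = (exp (norm \<tau> * C))\<^sup>2 * (norm \<tau> * C + 2) * (real n * s ^ n / (1 - s) ^ 3)"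

lemma norm_exp_diff_le:
  fixes a b :: complex
  assumes "norm (a - b) \<le> 1 / 2"
  shows "norm (exp a - exp b) \<le> norm (exp b) * (3 / 2 * norm (a - b))"
proof -
  have "exp a - exp b = exp b * (exp (a - b) - 1)"
    by (simp add: right_diff_distrib flip: exp_add)
  then have "norm (exp a - exp b) = norm (exp b) * norm (exp (a - b) - 1)"
    by (simp only: norm_mult)
  also have "\<dots> \<le> norm (exp b) * (3 / 2 * norm (a - b))"
    using assms by (intro mult_left_mono norm_exp_bounds) auto
  finally show ?thesis .
qed

context analytic_symbol
begin

definition ratio_prod :: "complex \<Rightarrow> nat \<Rightarrow> (nat \<Rightarrow> real) \<Rightarrow> complex" where
  "ratio_prod \<tau> n y = (\<Prod>i<n. ratio \<tau> n (cis (arccos (y i / 2))) * ratio \<tau> n (cis (- arccos (y i / 2))))"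

lemma chebyshev_kernel_taylor_roots:
  assumes roots: "taylor_roots \<tau> n x" and y: "\<And>i. i < n \<Longrightarrow> y i \<in> {-2..2}"
  shows "chebyshev_kernel n x y = exp (\<tau> * of_real (linear_statistic W n y)) / ratio_prod \<tau> n y"
proof -
  have "(\<Prod>k<n. chebyshev_denom (x k) (of_real (y i))) = exp (- \<tau> * of_real (W (y i))) *
      (ratio \<tau> n (cis (arccos (y i / 2))) * ratio \<tau> n (cis (- arccos (y i / 2))))" if "i < n" for i
    using prod_chebyshev_denom_taylor_roots[OF roots, of "arccos (y i / 2)"]
    by (simp only: two_cos_arccos_half[OF y[OF that]])
  then have "(\<Prod>i<n. \<Prod>k<n. chebyshev_denom (x k) (of_real (y i))) =
      (\<Prod>i<n. exp (- \<tau> * of_real (W (y i)))) * ratio_prod \<tau> n y"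
    unfolding ratio_prod_def prod.distrib[symmetric] by (intro prod.cong refl) simp
  also have "(\<Prod>i<n. exp (- \<tau> * of_real (W (y i)))) = exp (\<Sum>i<n. - \<tau> * of_real (W (y i)))"
    by (simp only: exp_sum[OF finite_lessThan])
  also have "(\<Sum>i<n. - \<tau> * complex_of_real (W (y i))) = - (\<tau> * of_real (linear_statistic W n y))"
    by (simp add: linear_statistic_def sum_distrib_left sum_negf)
  finally show ?thesis
    by (simp add: chebyshev_kernel_def exp_minus divide_inverse)
qed

lemma norm_exp_minus_chebyshev_kernel_le:
  assumes roots: "taylor_roots \<tau> n x" and small: "ratio_error \<tau> n \<le> 1" "real n * ratio_error \<tau> n \<le> 1 / 12"
    and y: "\<And>i. i < n \<Longrightarrow> y i \<in> {-2..2}"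
  shows "norm (exp (\<tau> * of_real (linear_statistic W n y)) - chebyshev_kernel n x y) \<le>
         12 * (real n * ratio_error \<tau> n) * exp (Re \<tau> * linear_statistic W n y)"
proof -
  define P where "P = ratio_prod \<tau> n y"
  define e where "e = exp (\<tau> * of_real (linear_statistic W n y))"
  have P_near_1: "norm (P - 1) \<le> 2 * (real n * (3 * ratio_error \<tau> n))"
    unfolding P_def ratio_prod_def using small ratio_error_nonneg
    by (intro norm_prod_near_1 norm_mult_minus_1_le norm_ratio_minus_1_le norm_cis_le) auto
  then have P_ge: "1 / 2 \<le> norm P"
    using norm_triangle_ineq2[of 1 "1 - P"] small by (simp add: norm_minus_commute)
  then have "P \<noteq> 0" by auto
  moreover have "chebyshev_kernel n x y = e / P"
    unfolding e_def P_def by (rule chebyshev_kernel_taylor_roots[OF roots y])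
  ultimately have "e - chebyshev_kernel n x y = e * ((P - 1) / P)"
    by (simp add: field_simps)
  then have "norm (e - chebyshev_kernel n x y) = norm e * (norm (P - 1) / norm P)"
    by (simp add: norm_mult norm_divide)
  also have "\<dots> \<le> norm e * (2 * (real n * (3 * ratio_error \<tau> n)) / (1 / 2))"
    using P_near_1 P_ge ratio_error_nonneg by (intro mult_left_mono frac_le) auto
  finally show ?thesis by (simp add: e_def mult_ac)
qed

lemma norm_expectation_exp_minus_chebyshev_kernel_le:
  assumes roots: "taylor_roots \<tau> n x" and small: "ratio_error \<tau> n \<le> 1" "real n * ratio_error \<tau> n \<le> 1 / 12"
  shows "norm ((\<integral>y. exp (\<tau> * of_real (linear_statistic W n y)) \<partial>ope n)
      - (\<integral>y. chebyshev_kernel n x y \<partial>ope n)) \<le>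
         12 * (real n * ratio_error \<tau> n) * (\<integral>y. exp (Re \<tau> * linear_statistic W n y) \<partial>ope n)"
proof -
  let ?X = "linear_statistic W n"
  let ?D = "\<lambda>y. exp (\<tau> * of_real (?X y)) - chebyshev_kernel n x y"
  note integrable_exp = integrable_linear_statistic(2,3)[OF measurable_W abs_W_le]
  have AE_le: "AE y in ope n. norm (?D y) \<le> 12 * (real n * ratio_error \<tau> n) * exp (Re \<tau> * ?X y)"
    using AE_ope_support by eventually_elim (rule norm_exp_minus_chebyshev_kernel_le[OF assms], auto)
  have integrable_D: "integrable (ope n) ?D"
  proof (rule Bochner_Integration.integrable_bound)
    show "AE y in ope n. norm (?D y) \<le> norm (12 * (real n * ratio_error \<tau> n) * exp (Re \<tau> * ?X y))"
      using AE_le by eventually_elim (simp add: abs_mult ratio_error_nonneg)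
  qed (intro integrable_mult_right integrable_exp, measurable)
  have "integrable (ope n) (chebyshev_kernel n x)"
    using Bochner_Integration.integrable_diff[OF integrable_exp(1)[where b=\<tau>] integrable_D] by simp
  from Bochner_Integration.integral_diff[OF integrable_exp(1)[where b=\<tau>] this]
  have "norm ((\<integral>y. exp (\<tau> * of_real (?X y)) \<partial>ope n) - (\<integral>y. chebyshev_kernel n x y \<partial>ope n)) =
      norm (integral\<^sup>L (ope n) ?D)"
    by simp
  also have "\<dots> \<le> (\<integral>y. norm (?D y) \<partial>ope n)"
    by (rule integral_norm_bound)
  also have "\<dots> \<le> (\<integral>y. 12 * (real n * ratio_error \<tau> n) * exp (Re \<tau> * ?X y) \<partial>ope n)"
    by (intro integral_mono_AE integrable_norm integrable_D integrable_mult_right integrable_exp AE_le)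
  finally show ?thesis by simp
qed

lemma ratio_error_le_laplace_error:
  assumes "0 < n"
  shows "ratio_error \<tau> n * (norm \<tau> * C + 2) / (1 - s)\<^sup>2 \<le> laplace_error s C \<tau> n"
    and "2 * (real n * ratio_error \<tau> n) \<le> laplace_error s C \<tau> n"
    and "2 * ratio_error \<tau> n \<le> laplace_error s C \<tau> n"
proof -
  let ?\<eta> = "ratio_error \<tau> n"
  have error: "laplace_error s C \<tau> n = real n * (?\<eta> * (norm \<tau> * C + 2) / (1 - s)\<^sup>2)"
    by (simp add: laplace_error_def ratio_error_def power_numeral_reduce mult_ac)
  have \<eta>: "0 \<le> ?\<eta>" by (rule ratio_error_nonneg)
  have s2: "0 < (1 - s)\<^sup>2" "(1 - s)\<^sup>2 \<le> 1"
    using s_pos s_less_1 by (auto simp: power_le_one)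
  have nonneg: "0 \<le> ?\<eta> * (norm \<tau> * C + 2) / (1 - s)\<^sup>2"
    using \<eta> C_nonneg by simp
  then show "?\<eta> * (norm \<tau> * C + 2) / (1 - s)\<^sup>2 \<le> laplace_error s C \<tau> n"
    unfolding error using mult_right_mono[OF _ nonneg, of 1 "real n"] assms by simp
  have "?\<eta> * 2 * (1 - s)\<^sup>2 \<le> ?\<eta> * (norm \<tau> * C + 2) * 1"
    using \<eta> s2 C_nonneg by (intro mult_mono mult_left_mono) auto
  then have "2 * ?\<eta> \<le> ?\<eta> * (norm \<tau> * C + 2) / (1 - s)\<^sup>2"
    using s2(1) by (simp add: le_divide_eq mult.commute)
  from mult_left_mono[OF this, of "real n"] show "2 * (real n * ?\<eta>) \<le> laplace_error s C \<tau> n"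
    unfolding error by (simp add: mult.left_commute)
  moreover have "?\<eta> \<le> real n * ?\<eta>"
    using assms \<eta> by (simp add: mult_le_cancel_right1)
  ultimately show "2 * ?\<eta> \<le> laplace_error s C \<tau> n" by linarith
qed

theorem laplace_approximation:
  assumes n: "0 < n" and small: "laplace_error s C \<tau> n \<le> 1 / 6"
  shows "norm ((\<integral>y. exp (\<tau> * of_real (linear_statistic W n y)) \<partial>ope n) - exp (gaussian_exponent v \<tau>)) \<le>
         6 * laplace_error s C \<tau> n * ((\<integral>y. exp (Re \<tau> * linear_statistic W n y) \<partial>ope n)
             + norm (exp (gaussian_exponent v \<tau>)))"
proof -
  let ?X = "linear_statistic W n" and ?\<delta> = "laplace_error s C \<tau> n" and ?K = "gaussian_exponent v \<tau>"
  note error_le = ratio_error_le_laplace_error[OF n, of \<tau>]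
  obtain x where roots: "taylor_roots \<tau> n x" using ex_taylor_roots by blast
  have quarter: "ratio_error \<tau> n \<le> 1 / 4" using error_le(3) small by simp
  obtain S where S: "pair_prod n (\<lambda>k l. 1 / (1 - x k * x l)) = exp S"
    and S_near: "norm (S - ?K) \<le> 2 * ratio_error \<tau> n * (norm \<tau> * C + 2) / (1 - s)\<^sup>2"
    by (rule pair_prod_taylor_roots_eq_exp[OF roots quarter])
  have kernel: "(\<integral>y. chebyshev_kernel n x y \<partial>ope n) = exp S"
    using norm_taylor_root_less_1[OF roots quarter] by (simp add: expectation_chebyshev_kernel S)
  have pos: "0 \<le> (\<integral>y. exp (Re \<tau> * ?X y) \<partial>ope n)"
    by (rule integral_nonneg_AE) simp
  have "norm ((\<integral>y. exp (\<tau> * of_real (?X y)) \<partial>ope n) - exp S) \<le>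
      12 * (real n * ratio_error \<tau> n) * (\<integral>y. exp (Re \<tau> * ?X y) \<partial>ope n)"
    unfolding kernel[symmetric] using quarter error_le(2) small
    by (intro norm_expectation_exp_minus_chebyshev_kernel_le roots) auto
  also have "\<dots> \<le> 6 * ?\<delta> * (\<integral>y. exp (Re \<tau> * ?X y) \<partial>ope n)"
    using error_le(2) pos by (intro mult_right_mono) auto
  finally have kernel_error: "norm ((\<integral>y. exp (\<tau> * of_real (?X y)) \<partial>ope n) - exp S) \<le> \<dots>" .
  have S_near': "norm (S - ?K) \<le> 2 * ?\<delta>"
    using S_near error_le(1) by simp
  have "norm (exp S - exp ?K) \<le> norm (exp ?K) * (3 / 2 * norm (S - ?K))"
    using S_near' small by (intro norm_exp_diff_le) auto
  also have "\<dots> \<le> norm (exp ?K) * (6 * ?\<delta>)"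
    using S_near' order_trans[OF norm_ge_zero S_near'] by (intro mult_left_mono) auto
  finally have exponent_error: "norm (exp S - exp ?K) \<le> \<dots>" .
  show ?thesis
    using norm_triangle_ineq[of "(\<integral>y. exp (\<tau> * of_real (?X y)) \<partial>ope n) - exp S" "exp S - exp ?K"]
        kernel_error exponent_error
    by (simp add: algebra_simps)
qed

end

section \<open>The central limit theorem for analytic symbols\<close>

lemma tendsto_of_relative_error:
  fixes \<Phi> U :: "nat \<Rightarrow> 'a::real_normed_vector" and \<epsilon> \<Psi> :: "nat \<Rightarrow> real"
  assumes err: "\<forall>\<^sub>F n in sequentially. norm (\<Phi> n - U n) \<le> \<epsilon> n * (\<Psi> n + norm (U n))"
    and \<epsilon>: "\<epsilon> \<longlonglongrightarrow> 0" and U: "U \<longlonglongrightarrow> L" and \<Psi>: "\<forall>\<^sub>F n in sequentially. \<bar>\<Psi> n\<bar> \<le> B"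
  shows "\<Phi> \<longlonglongrightarrow> L"
proof -
  have "(\<lambda>n. \<epsilon> n * \<Psi> n) \<longlonglongrightarrow> 0"
  proof (rule Lim_null_comparison)
    show "\<forall>\<^sub>F n in sequentially. norm (\<epsilon> n * \<Psi> n) \<le> \<bar>\<epsilon> n\<bar> * B"
      using \<Psi> by eventually_elim (simp add: abs_mult mult_left_mono)
    show "(\<lambda>n. \<bar>\<epsilon> n\<bar> * B) \<longlonglongrightarrow> 0"
      using tendsto_mult_right[OF tendsto_rabs_zero[OF \<epsilon>], of B] by simp
  qed
  then have "(\<lambda>n. \<epsilon> n * \<Psi> n + \<epsilon> n * norm (U n)) \<longlonglongrightarrow> 0 + 0 * norm L"
    by (intro tendsto_add tendsto_mult tendsto_norm \<epsilon> U)
  then have "(\<lambda>n. \<epsilon> n * (\<Psi> n + norm (U n))) \<longlonglongrightarrow> 0"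
    by (simp add: distrib_left)
  then have "(\<lambda>n. \<Phi> n - U n) \<longlonglongrightarrow> 0"
    by (rule Lim_null_comparison[OF err])
  from tendsto_add[OF this U] show ?thesis by simp
qed

lemma (in prob_space) one_plus_expectation_le_mgf:
  fixes Y :: "'a \<Rightarrow> real"
  assumes "integrable M Y" "integrable M (\<lambda>y. exp (a * Y y))"
  shows "1 + a * expectation Y \<le> expectation (\<lambda>y. exp (a * Y y))"
proof -
  have "1 + a * expectation Y = expectation (\<lambda>y. 1 + a * Y y)"
    using assms by (simp add: prob_space)
  also have "\<dots> \<le> expectation (\<lambda>y. exp (a * Y y))"
    using assms by (intro integral_mono) auto
  finally show ?thesis .
qed

lemma eventually_expectation_less_of_mgf_tendsto:
  fixes M :: "nat \<Rightarrow> 'a measure" and Y :: "nat \<Rightarrow> 'a \<Rightarrow> real"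
  assumes prob: "\<And>n. prob_space (M n)"
    and int: "\<forall>\<^sub>F n in sequentially. integrable (M n) (Y n) \<and> (\<forall>a. integrable (M n) (\<lambda>y. exp (a * Y n y)))"
    and mgf: "\<And>a. (\<lambda>n. \<integral>y. exp (a * Y n y) \<partial>M n) \<longlonglongrightarrow> L a"
    and deriv: "(L has_real_derivative m) (at 0)" and b: "m < b"
  shows "\<forall>\<^sub>F n in sequentially. (\<integral>y. Y n y \<partial>M n) < b"
proof -
  have "(\<lambda>n. \<integral>y. exp (0 * Y n y) \<partial>M n) = (\<lambda>_. 1)"
    using prob_space.prob_space[OF prob] by simp
  then have L0: "L 0 = 1"
    using mgf[of 0] by (simp add: LIMSEQ_const_iff)
  have "((\<lambda>a. (L a - 1) / a) \<longlongrightarrow> m) (at_right 0)"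
    using deriv by (simp add: DERIV_def L0 filterlim_at_split)
  then have "\<forall>\<^sub>F a in at_right 0. 0 < a \<and> (L a - 1) / a < b"
    using b by (intro eventually_conj order_tendstoD(2) eventually_at_right_less)
  from eventually_happens[OF this] obtain a where a: "0 < a" "(L a - 1) / a < b"
    by auto
  have "(\<lambda>n. ((\<integral>y. exp (a * Y n y) \<partial>M n) - 1) / a) \<longlonglongrightarrow> (L a - 1) / a"
    using a(1) by (intro tendsto_intros mgf) auto
  then have "\<forall>\<^sub>F n in sequentially. ((\<integral>y. exp (a * Y n y) \<partial>M n) - 1) / a < b"
    using a(2) by (rule order_tendstoD(2))
  with int show ?thesis
  proof eventually_elim
    case (elim n)
    have "(\<integral>y. Y n y \<partial>M n) \<le> ((\<integral>y. exp (a * Y n y) \<partial>M n) - 1) / a"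
      using prob_space.one_plus_expectation_le_mgf[OF prob, of n "Y n" a] elim a(1)
      by (simp add: le_divide_eq mult.commute)
    with elim show ?case by linarith
  qed
qed

theorem expectation_tendsto_of_mgf_tendsto:
  fixes M :: "nat \<Rightarrow> 'a measure" and Y :: "nat \<Rightarrow> 'a \<Rightarrow> real"
  assumes prob: "\<And>n. prob_space (M n)"
    and int: "\<forall>\<^sub>F n in sequentially. integrable (M n) (Y n) \<and> (\<forall>a. integrable (M n) (\<lambda>y. exp (a * Y n y)))"
    and mgf: "\<And>a. (\<lambda>n. \<integral>y. exp (a * Y n y) \<partial>M n) \<longlonglongrightarrow> L a"
    and deriv: "(L has_real_derivative m) (at 0)"
  shows "(\<lambda>n. \<integral>y. Y n y \<partial>M n) \<longlonglongrightarrow> m"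
proof (rule order_tendstoI)
  fix b assume "m < b"
  then show "\<forall>\<^sub>F n in sequentially. (\<integral>y. Y n y \<partial>M n) < b"
    by (rule eventually_expectation_less_of_mgf_tendsto[OF assms])
next
  fix b assume "b < m"
  have "\<forall>\<^sub>F n in sequentially. (\<integral>y. - Y n y \<partial>M n) < - b"
  proof (rule eventually_expectation_less_of_mgf_tendsto[OF prob])
    show "\<forall>\<^sub>F n in sequentially. integrable (M n) (\<lambda>y. - Y n y) \<and>
        (\<forall>a. integrable (M n) (\<lambda>y. exp (a * - Y n y)))"
      using int
    proof eventually_elim
      case (elim n)
      have "integrable (M n) (\<lambda>y. exp (a * - Y n y))" for a
        using elim[THEN conjunct2, THEN spec, of "- a"] by simp
      with elim show ?case by simp
    qed
    show "(\<lambda>n. \<integral>y. exp (a * - Y n y) \<partial>M n) \<longlonglongrightarrow> L (- a)" for a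
      using mgf[of "- a"] by simp
    have "((\<lambda>a. - a) has_real_derivative - 1) (at (0::real))"
      by (auto intro!: derivative_eq_intros)
    from DERIV_chain2[OF _ this, of L m] show "((\<lambda>a. L (- a)) has_real_derivative - m) (at 0)"
      using deriv by simp
  qed (use \<open>b < m\<close> in simp)
  then show "\<forall>\<^sub>F n in sequentially. b < (\<integral>y. Y n y \<partial>M n)"
    by simp
qed

lemma gaussian0_eq_distr:
  assumes "0 \<le> s2"
  shows "gaussian0 s2 = distr std_normal_distribution borel (\<lambda>x. sqrt s2 * x)"
proof -
  interpret prob_space std_normal_distribution
    by (intro prob_space_normal_density) simp
  show ?thesis
  proof (cases "s2 = 0")
    case True
    then show ?thesis by (simp add: gaussian0_def distr_const)
  next
    case False
    have "distributed std_normal_distribution lborel (\<lambda>x. x) std_normal_density"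
      by (auto simp: distributed_def distr_id2)
    from normal_density_affine[OF this, of "sqrt s2" 0]
    have "distr std_normal_distribution lborel (\<lambda>x. sqrt s2 * x) =
        density lborel (normal_density 0 (sqrt s2))"
      using False assms by (simp add: distributed_def)
    moreover have "distr std_normal_distribution lborel (\<lambda>x. sqrt s2 * x) =
        distr std_normal_distribution borel (\<lambda>x. sqrt s2 * x)"
      by (rule distr_cong) auto
    ultimately show ?thesis
      using False by (simp add: gaussian0_def)
  qed
qed

lemma real_distribution_gaussian0:
  assumes "0 \<le> s2"
  shows "real_distribution (gaussian0 s2)"
proof -
  have "prob_space std_normal_distribution"
    by (intro prob_space_normal_density) simp
  then show ?thesis
    unfolding gaussian0_eq_distr[OF assms] by (rule prob_space.real_distribution_distr) simp
qed

lemma char_gaussian0: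
  assumes "0 \<le> s2"
  shows "char (gaussian0 s2) t = exp (- (of_real (t\<^sup>2 * s2 / 2)))"
proof -
  have "char (gaussian0 s2) t = char std_normal_distribution (t * sqrt s2)"
    unfolding gaussian0_eq_distr[OF assms] char_def by (subst integral_distr) (auto simp: mult_ac)
  also have "\<dots> = complex_of_real (exp (- (t\<^sup>2 * s2 / 2)))"
    using assms by (simp add: char_std_normal_distribution power_mult_distrib)
  finally show ?thesis by (simp flip: exp_of_real)
qed

locale analytic_symbol_sequence =
  fixes W :: "nat \<Rightarrow> real \<Rightarrow> real" and w0 :: "nat \<Rightarrow> real" and v :: "nat \<Rightarrow> nat \<Rightarrow> real"
    and s :: "nat \<Rightarrow> real" and C \<sigma>2 :: real
  assumes measurable_W [measurable]: "\<And>n. W n \<in> borel_measurable borel"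
    and eventually_symbol: "\<forall>\<^sub>F n in sequentially. analytic_symbol (\<lambda>u. W n u - w0 n) (v n) (s n) C"
    and rate: "(\<lambda>n. real n * s n ^ n / (1 - s n) ^ 3) \<longlonglongrightarrow> 0"
    and variance_tendsto: "(\<lambda>n. cosine_variance (v n)) \<longlonglongrightarrow> \<sigma>2"
begin

definition shifted_statistic :: "nat \<Rightarrow> (nat \<Rightarrow> real) \<Rightarrow> real" where
  "shifted_statistic n y = linear_statistic (\<lambda>u. W n u - w0 n) n y + cosine_shift (v n)"

lemma linear_statistic_eq_shifted:
  "linear_statistic (W n) n y = shifted_statistic n y + (real n * w0 n - cosine_shift (v n))"
  by (simp add: shifted_statistic_def linear_statistic_def sum_subtractf)

lemma eventually_integrable_shifted_statistic:
  "\<forall>\<^sub>F n in sequentially. integrable (ope n) (shifted_statistic n) \<and>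
     (\<forall>a. integrable (ope n) (\<lambda>y. exp (a * shifted_statistic n y)))"
  using eventually_symbol
proof eventually_elim
  case (elim n)
  interpret prob_space "ope n" by (rule prob_space_ope)
  note int = integrable_linear_statistic[OF analytic_symbol.measurable_W[OF elim]
      analytic_symbol.abs_W_le[OF elim]]
  have "integrable (ope n) (\<lambda>y. exp (a * cosine_shift (v n))
      * exp (a * linear_statistic (\<lambda>u. W n u - w0 n) n y))" for a
    by (intro integrable_mult_right int(3))
  then show ?case
    unfolding shifted_statistic_def distrib_left exp_add
    using int(1) by (auto simp: mult.commute)
qed

lemma laplace_error_tendsto: "(\<lambda>n. 6 * laplace_error (s n) C \<tau> n) \<longlonglongrightarrow> 0"
  unfolding laplace_error_def using tendsto_mult_left[OF rate, of
      "6 * ((exp (norm \<tau> * C))\<^sup>2 * (norm \<tau> * C + 2))"]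
  by (simp add: mult.assoc)

lemma laplace_relative_error:
  "\<forall>\<^sub>F n in sequentially. norm ((\<integral>y. exp (\<tau> * of_real (shifted_statistic n y)) \<partial>ope n)
      - exp (\<tau>\<^sup>2 / 2 * of_real (cosine_variance (v n)))) \<le>
     6 * laplace_error (s n) C \<tau> n * ((\<integral>y. exp (Re \<tau> * shifted_statistic n y) \<partial>ope n)
         + norm (exp (\<tau>\<^sup>2 / 2 * of_real (cosine_variance (v n)))))"
proof -
  have "\<forall>\<^sub>F n in sequentially. 6 * laplace_error (s n) C \<tau> n < 1"
    using laplace_error_tendsto by (rule order_tendstoD) simp
  with eventually_symbol eventually_gt_at_top[of 0] show ?thesis
  proof eventually_elim
    case (elim n)
    let ?X = "linear_statistic (\<lambda>u. W n u - w0 n) n" and ?m = "cosine_shift (v n)"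
    have \<Phi>: "(\<integral>y. exp (\<tau> * of_real (shifted_statistic n y)) \<partial>ope n) =
        exp (\<tau> * of_real ?m) * (\<integral>y. exp (\<tau> * of_real (?X y)) \<partial>ope n)"
      by (simp add: shifted_statistic_def distrib_left exp_add mult.commute flip: integral_mult_right_zero)
    have \<Psi>: "(\<integral>y. exp (Re \<tau> * shifted_statistic n y) \<partial>ope n) =
        exp (Re \<tau> * ?m) * (\<integral>y. exp (Re \<tau> * ?X y) \<partial>ope n)"
      by (simp add: shifted_statistic_def distrib_left exp_add mult.commute flip: integral_mult_right_zero)
    have K: "exp (\<tau>\<^sup>2 / 2 * of_real (cosine_variance (v n))) =
        exp (\<tau> * of_real ?m) * exp (gaussian_exponent (v n) \<tau>)"
      unfolding gaussian_exponent_def exp_add[symmetric] by simp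
    have m: "norm (exp (\<tau> * complex_of_real ?m)) = exp (Re \<tau> * ?m)" by simp
    have "norm ((\<integral>y. exp (\<tau> * of_real (?X y)) \<partial>ope n) - exp (gaussian_exponent (v n) \<tau>)) \<le>
        6 * laplace_error (s n) C \<tau> n * ((\<integral>y. exp (Re \<tau> * ?X y) \<partial>ope n)
            + norm (exp (gaussian_exponent (v n) \<tau>)))"
      using elim by (intro analytic_symbol.laplace_approximation) auto
    from mult_left_mono[OF this, of "exp (Re \<tau> * ?m)"] show ?case
      unfolding \<Phi> \<Psi> K right_diff_distrib[symmetric] norm_mult m by (simp add: algebra_simps)
  qed
qed

lemma gaussian_factor_tendsto: "(\<lambda>n. exp (\<tau>\<^sup>2 / 2 * complex_of_real (cosine_variance (v n)))) \<longlonglongrightarrow>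
    exp (\<tau>\<^sup>2 / 2 * of_real \<sigma>2)"
  by (intro tendsto_intros variance_tendsto) auto

lemma mgf_tendsto: "(\<lambda>n. \<integral>y. exp (a * shifted_statistic n y) \<partial>ope n) \<longlonglongrightarrow> exp (a\<^sup>2 / 2 * \<sigma>2)"
proof -
  define \<Psi> where "\<Psi> n = (\<integral>y. exp (a * shifted_statistic n y) \<partial>ope n)" for n
  define U where "U n = exp (a\<^sup>2 / 2 * cosine_variance (v n))" for n
  have \<Psi>_nonneg: "0 \<le> \<Psi> n" for n
    unfolding \<Psi>_def by (rule integral_nonneg_AE) simp
  have U: "U \<longlonglongrightarrow> exp (a\<^sup>2 / 2 * \<sigma>2)"
    unfolding U_def by (intro tendsto_intros variance_tendsto) auto
  have "(\<integral>y. exp (complex_of_real a * of_real (shifted_statistic n y)) \<partial>ope n) = of_real (\<Psi> n)" for n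
    unfolding \<Psi>_def by (simp flip: integral_complex_of_real of_real_mult exp_of_real)
  moreover have "exp ((complex_of_real a)\<^sup>2 / 2 * of_real (cosine_variance (v n))) = of_real (U n)" for n
    by (simp add: U_def flip: exp_of_real)
  ultimately have err: "\<forall>\<^sub>F n in sequentially. norm (\<Psi> n - U n) \<le>
      6 * laplace_error (s n) C (of_real a) n * (\<Psi> n + norm (U n))"
    using laplace_relative_error[of "of_real a"] by (simp flip: of_real_diff add: \<Psi>_def)
  have "\<forall>\<^sub>F n in sequentially. 6 * laplace_error (s n) C (of_real a) n < 1 / 2"
    using laplace_error_tendsto by (rule order_tendstoD) simp
  moreover have "\<forall>\<^sub>F n in sequentially. U n < exp (a\<^sup>2 / 2 * \<sigma>2) + 1"
    using U by (rule order_tendstoD) simp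
  ultimately have "\<forall>\<^sub>F n in sequentially. \<bar>\<Psi> n\<bar> \<le> 3 * (exp (a\<^sup>2 / 2 * \<sigma>2) + 1)"
    using err
  proof eventually_elim
    case (elim n)
    have U_pos: "0 < U n" by (simp add: U_def)
    have "\<Psi> n - U n \<le> 6 * laplace_error (s n) C (of_real a) n * (\<Psi> n + U n)"
      using elim U_pos by (simp add: abs_le_iff)
    also have "\<dots> \<le> 1 / 2 * (\<Psi> n + U n)"
      using elim \<Psi>_nonneg[of n] U_pos by (intro mult_right_mono) auto
    finally have "\<Psi> n \<le> 3 * U n" by simp
    then show ?case
      using elim \<Psi>_nonneg[of n] by simp
  qed
  with err laplace_error_tendsto U show ?thesis
    unfolding \<Psi>_def[symmetric] by (rule tendsto_of_relative_error)
qed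

lemma laplace_tendsto:
  fixes \<tau> :: complex
  shows "(\<lambda>n. \<integral>y. exp (\<tau> * of_real (shifted_statistic n y)) \<partial>ope n) \<longlonglongrightarrow> exp (\<tau>\<^sup>2 / 2 * of_real \<sigma>2)"
proof (rule tendsto_of_relative_error[OF laplace_relative_error laplace_error_tendsto
    gaussian_factor_tendsto])
  let ?L = "exp ((Re \<tau>)\<^sup>2 / 2 * \<sigma>2)"
  have "\<forall>\<^sub>F n in sequentially. (\<integral>y. exp (Re \<tau> * shifted_statistic n y) \<partial>ope n) < ?L + 1"
    using mgf_tendsto by (rule order_tendstoD) simp
  then show "\<forall>\<^sub>F n in sequentially. \<bar>\<integral>y. exp (Re \<tau> * shifted_statistic n y) \<partial>ope n\<bar> \<le> ?L + 1"
    by eventually_elim (simp add: integral_nonneg_AE)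
qed

lemma expectation_shifted_statistic_tendsto: "(\<lambda>n. \<integral>y. shifted_statistic n y \<partial>ope n) \<longlonglongrightarrow> 0"
  by (rule expectation_tendsto_of_mgf_tendsto[OF prob_space_ope eventually_integrable_shifted_statistic
      mgf_tendsto])
     (auto intro!: derivative_eq_intros)

lemma centered_characteristic_tendsto:
  "(\<lambda>n. \<integral>y. exp (\<i> * of_real (t * (linear_statistic (W n) n y
      - integral\<^sup>L (ope n) (linear_statistic (W n) n)))) \<partial>ope n)
     \<longlonglongrightarrow> exp (- (of_real (t\<^sup>2 * \<sigma>2 / 2)))"
proof -
  define \<mu> where "\<mu> n = integral\<^sup>L (ope n) (shifted_statistic n)" for n
  have "(\<lambda>n. exp (- \<i> * of_real (t * \<mu> n))) \<longlonglongrightarrow> exp (- \<i> * of_real (t * 0))"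
    unfolding \<mu>_def by (intro tendsto_intros expectation_shifted_statistic_tendsto)
  from tendsto_mult[OF this laplace_tendsto[of "\<i> * of_real t"]]
  have lim: "(\<lambda>n. exp (- \<i> * of_real (t * \<mu> n))
      * (\<integral>y. exp (\<i> * of_real t * of_real (shifted_statistic n y)) \<partial>ope n))
      \<longlonglongrightarrow> exp (- (of_real (t\<^sup>2 * \<sigma>2 / 2)))"
    by (simp add: power_mult_distrib)
  moreover have "\<forall>\<^sub>F n in sequentially. exp (- \<i> * of_real (t * \<mu> n))
      * (\<integral>y. exp (\<i> * of_real t * of_real (shifted_statistic n y)) \<partial>ope n) =
     (\<integral>y. exp (\<i> * of_real (t * (linear_statistic (W n) n y
         - integral\<^sup>L (ope n) (linear_statistic (W n) n)))) \<partial>ope n)"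
    using eventually_integrable_shifted_statistic
  proof eventually_elim
    case (elim n)
    interpret prob_space "ope n" by (rule prob_space_ope)
    have "integral\<^sup>L (ope n) (linear_statistic (W n) n) =
        (\<integral>y. shifted_statistic n y + (real n * w0 n - cosine_shift (v n)) \<partial>ope n)"
      by (intro Bochner_Integration.integral_cong refl linear_statistic_eq_shifted)
    then have "linear_statistic (W n) n y - integral\<^sup>L (ope n) (linear_statistic (W n) n) =
        shifted_statistic n y - \<mu> n" for y
      unfolding linear_statistic_eq_shifted \<mu>_def using elim by (simp add: prob_space)
    moreover have "exp (- \<i> * of_real (t * \<mu> n)) * exp (\<i> * of_real t * of_real (shifted_statistic n y)) =
        exp (\<i> * of_real (t * (shifted_statistic n y - \<mu> n)))" for y
      unfolding exp_add[symmetric] by (simp add: algebra_simps)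
    ultimately show ?case
      by (simp flip: integral_mult_right_zero)
  qed
  ultimately show ?thesis by (rule Lim_transform_eventually)
qed

theorem weak_conv_linear_statistic:
  "weak_conv_m (\<lambda>n. distr (ope n) borel (\<lambda>y. linear_statistic (W n) n y
      - integral\<^sup>L (ope n) (linear_statistic (W n) n)))
     (gaussian0 \<sigma>2)"
proof (rule levy_continuity)
  have "0 \<le> cosine_variance (v n)" if "analytic_symbol (\<lambda>u. W n u - w0 n) (v n) (s n) C" for n
    using analytic_symbol.cosine_variance_sums[OF that] by (rule sums_le[OF _ sums_zero, rotated]) simp
  then have "\<forall>\<^sub>F n in sequentially. 0 \<le> cosine_variance (v n)"
    using eventually_symbol by (rule eventually_mono[rotated])
  then have \<sigma>2: "0 \<le> \<sigma>2"
    by (intro tendsto_lowerbound[OF variance_tendsto]) auto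
  then show "real_distribution (gaussian0 \<sigma>2)"
    by (rule real_distribution_gaussian0)
  show "real_distribution (distr (ope n) borel
      (\<lambda>y. linear_statistic (W n) n y - integral\<^sup>L (ope n) (linear_statistic (W n) n)))" for n
    by (rule prob_space.real_distribution_distr[OF prob_space_ope]) measurable
  show "(\<lambda>n. char (distr (ope n) borel (\<lambda>y. linear_statistic (W n) n y
      - integral\<^sup>L (ope n) (linear_statistic (W n) n))) t)
      \<longlonglongrightarrow> char (gaussian0 \<sigma>2) t" for t
    unfolding char_gaussian0[OF \<sigma>2] using centered_characteristic_tendsto[of t]
    by (simp add: char_def integral_distr)
qed

end

section \<open>The limiting variance\<close>

definition resolvent_product :: "complex \<Rightarrow> complex \<Rightarrow> real \<Rightarrow> complex" where
  "resolvent_product a b x = 1 / ((of_real x - a) * (of_real x - b))"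

lemma of_real_minus_nonreal_nonzero: "Im a \<noteq> 0 \<Longrightarrow> complex_of_real x - a \<noteq> 0"
  by (auto simp: complex_eq_iff)

lemma measurable_resolvent_product [measurable]: "resolvent_product a b \<in> borel_measurable borel"
  unfolding resolvent_product_def[abs_def] by measurable

lemma isCont_resolvent_product:
  assumes "Im a \<noteq> 0" "Im b \<noteq> 0"
  shows "isCont (resolvent_product a b) x"
  unfolding resolvent_product_def[abs_def]
  by (intro continuous_intros) (use assms of_real_minus_nonreal_nonzero in auto)

lemma integrable_inverse_norm_squared:
  assumes "Im a \<noteq> 0"
  shows "integrable lborel (\<lambda>x. 1 / (norm (complex_of_real x - a))\<^sup>2)"
proof -
  have "integrable lborel (\<lambda>x::real. inverse (1 + x\<^sup>2))"
    using integrable_inverse_1_plus_square by (simp add: set_integrable_def)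
  from lborel_integrable_real_affine[OF this, of "1 / Im a" "- Re a / Im a"] assms
  have "integrable lborel (\<lambda>x. 1 / (Im a)\<^sup>2 * inverse (1 + (- Re a / Im a + 1 / Im a * x)\<^sup>2))"
    by (intro integrable_mult_right) auto
  moreover have "1 / (Im a)\<^sup>2 * inverse (1 + (- Re a / Im a + 1 / Im a * x)\<^sup>2) =
      1 / (norm (complex_of_real x - a))\<^sup>2" for x
  proof -
    have "(Im a)\<^sup>2 * (1 + (- Re a / Im a + 1 / Im a * x)\<^sup>2) = (x - Re a)\<^sup>2 + (Im a)\<^sup>2"
      using assms by (simp add: power2_eq_square field_simps)
    then show ?thesis
      by (simp add: cmod_power2 inverse_eq_divide)
  qed
  ultimately show ?thesis by simp
qed

lemma integrable_resolvent_product: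
  assumes "Im a \<noteq> 0" "Im b \<noteq> 0"
  shows "integrable lborel (resolvent_product a b)"
proof (rule Bochner_Integration.integrable_bound)
  show "integrable lborel (\<lambda>x. 1 / (norm (complex_of_real x - a))\<^sup>2 + 1 / (norm (complex_of_real x - b))\<^sup>2)"
    by (intro Bochner_Integration.integrable_add integrable_inverse_norm_squared assms)
  have "norm (resolvent_product a b x) \<le>
      1 / (norm (complex_of_real x - a))\<^sup>2 + 1 / (norm (complex_of_real x - b))\<^sup>2" for x
  proof -
    define p q where "p = 1 / norm (complex_of_real x - a)" and "q = 1 / norm (complex_of_real x - b)"
    have "0 \<le> p * q" by (simp add: p_def q_def)
    moreover have "2 * (p * q) \<le> p\<^sup>2 + q\<^sup>2" using sum_squares_bound[of p q] by simp
    ultimately have "p * q \<le> p\<^sup>2 + q\<^sup>2" by linarith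
    then show ?thesis by (simp add: resolvent_product_def p_def q_def norm_divide norm_mult power_divide)
  qed
  then show "AE x in lborel. norm (resolvent_product a b x) \<le>
      norm (1 / (norm (complex_of_real x - a))\<^sup>2 + 1 / (norm (complex_of_real x - b))\<^sup>2)"
    unfolding real_norm_def by (intro AE_I2 order.trans[OF _ abs_ge_self])
qed measurable

lemma integral_line_FTC:
  fixes f F :: "real \<Rightarrow> complex"
  assumes deriv: "\<And>x. (F has_vector_derivative f x) (at x)" and cont: "\<And>x. isCont f x"
    and int: "integrable lborel f" and A: "(F \<longlongrightarrow> A) at_bot" and B: "(F \<longlongrightarrow> B) at_top"
  shows "(\<integral>x. f x \<partial>lborel) = B - A"
proof -
  have "(LBINT x=-\<infinity>..\<infinity>. f x) = B - A"
    by (rule interval_integral_FTC_integrable[where F=F])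
       (use assms in \<open>auto simp: set_integrable_def ereal_tendsto_simps\<close>)
  then show ?thesis
    by (simp add: interval_lebesgue_integral_def set_lebesgue_integral_def)
qed

lemma tendsto_Ln_diff_at_top:
  assumes "Im a \<noteq> 0" "Im b \<noteq> 0"
  shows "((\<lambda>x. Ln (of_real x - a) - Ln (of_real x - b)) \<longlongrightarrow> 0) at_top"
proof -
  have lim: "((\<lambda>x. Ln (1 - c / of_real x)) \<longlongrightarrow> 0) at_top" for c :: complex
  proof -
    have "((\<lambda>x. 1 - c * complex_of_real (inverse x)) \<longlongrightarrow> 1 - c * of_real 0) at_top"
      by (intro tendsto_intros tendsto_inverse_0_at_top filterlim_ident)
    then have "((\<lambda>x. Ln (1 - c * complex_of_real (inverse x))) \<longlongrightarrow> Ln 1) at_top"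
      by (intro tendsto_Ln) auto
    then show ?thesis by (simp add: divide_inverse)
  qed
  have "((\<lambda>x. Ln (1 - a / of_real x) - Ln (1 - b / of_real x)) \<longlongrightarrow> 0 - 0) at_top"
    by (intro tendsto_diff lim)
  moreover have "\<forall>\<^sub>F x in at_top. Ln (1 - a / of_real x) - Ln (1 - b / of_real x) =
      Ln (of_real x - a) - Ln (of_real x - b)"
    using eventually_gt_at_top[of 0]
  proof eventually_elim
    case (elim x)
    have "Ln (of_real x - c) = of_real (ln x) + Ln (1 - c / of_real x)" if "Im c \<noteq> 0" for c
    proof -
      have factor: "of_real x - c = of_real x * (1 - c / of_real x)"
        using elim by (simp add: field_simps)
      moreover have "1 - c / of_real x \<noteq> 0"
        using factor of_real_minus_nonreal_nonzero[OF that, of x] by auto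
      ultimately show ?thesis
        using Ln_times_of_real[OF elim] elim by (simp add: Ln_of_real)
    qed
    then show ?case using assms by simp
  qed
  ultimately show ?thesis by (simp add: Lim_transform_eventually)
qed

lemma Ln_reflect:
  assumes "Im c \<noteq> 0"
  shows "Ln (of_real (- x) - c) = Ln (of_real x - (- c)) + (if Im c > 0 then - \<i> * pi else \<i> * pi)"
proof -
  have "of_real x - (- c) \<noteq> 0"
    using assms by (intro of_real_minus_nonreal_nonzero) simp
  moreover have "of_real (- x) - c = - (of_real x - (- c))" by simp
  ultimately show ?thesis
    using Ln_minus[of "of_real x - (- c)"] assms by (auto split: if_splits)
qed

lemma tendsto_Ln_diff_at_bot:
  assumes "Im a > 0" "Im b \<noteq> 0"
  shows "((\<lambda>x. Ln (of_real x - a) - Ln (of_real x - b)) \<longlongrightarrow> (if Im b > 0 then 0 else - 2 * pi * \<i>)) at_bot"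
proof -
  let ?jump = "if Im b > 0 then 0 else - 2 * pi * \<i>"
  have "((\<lambda>x. Ln (of_real x - (- a)) - Ln (of_real x - (- b)) + ?jump) \<longlongrightarrow> 0 + ?jump) at_top"
    using assms by (intro tendsto_add tendsto_const tendsto_Ln_diff_at_top) auto
  moreover have "Ln (of_real x - (- a)) - Ln (of_real x - (- b)) + ?jump =
      Ln (of_real (- x) - a) - Ln (of_real (- x) - b)" for x
    using Ln_reflect[of a x] Ln_reflect[of b x] assms by auto
  ultimately show ?thesis
    by (subst filterlim_at_bot_mirror) simp
qed

lemma integral_resolvent_product_self:
  assumes "Im a \<noteq> 0"
  shows "(\<integral>x. resolvent_product a a x \<partial>lborel) = 0"
proof -
  have lim: "((\<lambda>x. - 1 / (complex_of_real x - a)) \<longlongrightarrow> 0) F" if "filterlim complex_of_real at_infinity F" for F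
  proof -
    have "filterlim (\<lambda>x. complex_of_real x - a) at_infinity F"
      using tendsto_add_filterlim_at_infinity'[OF that tendsto_const[of "- a"]] by simp
    then show ?thesis by (intro tendsto_divide_0[OF tendsto_const])
  qed
  have "(\<integral>x. resolvent_product a a x \<partial>lborel) = 0 - 0"
  proof (rule integral_line_FTC[where F="\<lambda>x. - 1 / (complex_of_real x - a)"])
    fix x
    have "((\<lambda>z. - 1 / (z - a)) has_field_derivative resolvent_product a a x) (at (complex_of_real x))"
      using of_real_minus_nonreal_nonzero[OF assms, of x]
      by (auto intro!: derivative_eq_intros simp: resolvent_product_def power2_eq_square)
    then show "((\<lambda>x. - 1 / (complex_of_real x - a)) has_vector_derivative resolvent_product a a x) (at x)"
      by (rule has_vector_derivative_real_field)
  next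
    show "((\<lambda>x. - 1 / (complex_of_real x - a)) \<longlongrightarrow> 0) at_bot"
      "((\<lambda>x. - 1 / (complex_of_real x - a)) \<longlongrightarrow> 0) at_top"
      by (intro lim filterlim_norm_at_top_imp_at_infinity; simp; real_asymp)+
  qed (use assms in \<open>auto intro: isCont_resolvent_product integrable_resolvent_product\<close>)
  then show ?thesis by simp
qed

lemma has_vector_derivative_Ln_diff:
  assumes "Im a \<noteq> 0" "Im b \<noteq> 0" "a \<noteq> b"
  shows "((\<lambda>x. (Ln (of_real x - a) - Ln (of_real x - b)) / (a - b)) has_vector_derivative
      resolvent_product a b x) (at x)"
proof (rule has_vector_derivative_real_field)
  note nz = of_real_minus_nonreal_nonzero[OF assms(1), of x]
      of_real_minus_nonreal_nonzero[OF assms(2), of x]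
  have "complex_of_real x - c \<notin> \<real>\<^sub>\<le>\<^sub>0" if "Im c \<noteq> 0" for c
    using that by (auto simp: complex_nonpos_Reals_iff)
  then have "((\<lambda>z. (Ln (z - a) - Ln (z - b)) / (a - b)) has_field_derivative
      (inverse (of_real x - a) * 1 - inverse (of_real x - b) * 1) / (a - b)) (at (complex_of_real x))"
    using assms
    by (intro DERIV_cdivide DERIV_diff DERIV_chain2[OF has_field_derivative_Ln])
       (auto intro!: derivative_eq_intros)
  moreover have "(inverse (of_real x - a) * 1 - inverse (of_real x - b) * 1) / (a - b) =
      resolvent_product a b x"
    using nz assms(3) by (simp add: resolvent_product_def inverse_eq_divide diff_frac_eq)
  ultimately show "((\<lambda>z. (Ln (z - a) - Ln (z - b)) / (a - b)) has_field_derivative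
      resolvent_product a b x) (at (complex_of_real x))"
    by (simp only:)
qed

theorem integral_resolvent_product:
  assumes a: "Im a > 0" and b: "Im b \<noteq> 0"
  shows "(\<integral>x. resolvent_product a b x \<partial>lborel) = (if Im b > 0 then 0 else 2 * pi * \<i> / (a - b))"
proof (cases "a = b")
  case True
  then show ?thesis using a integral_resolvent_product_self[of a] by simp
next
  case False
  have "(\<integral>x. resolvent_product a b x \<partial>lborel) =
      0 / (a - b) - (if Im b > 0 then 0 else - 2 * pi * \<i>) / (a - b)"
  proof (rule integral_line_FTC[where F="\<lambda>x. (Ln (of_real x - a) - Ln (of_real x - b)) / (a - b)"])
    show "((\<lambda>x. (Ln (of_real x - a) - Ln (of_real x - b)) / (a - b)) \<longlongrightarrow>
        (if Im b > 0 then 0 else - 2 * pi * \<i>) / (a - b)) at_bot"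
      using False by (intro tendsto_divide tendsto_const tendsto_Ln_diff_at_bot a b) simp
    show "((\<lambda>x. (Ln (of_real x - a) - Ln (of_real x - b)) / (a - b)) \<longlongrightarrow> 0 / (a - b)) at_top"
      using False a by (intro tendsto_divide tendsto_const tendsto_Ln_diff_at_top b) auto
  qed (use a b False in \<open>auto intro: has_vector_derivative_Ln_diff isCont_resolvent_product
      integrable_resolvent_product\<close>)
  then show ?thesis by (cases "Im b > 0") simp_all
qed

lemma (in pair_sigma_finite) integral_mult_pair:
  fixes f :: "'a \<Rightarrow> 'c::{real_normed_field, banach, second_countable_topology}" and g :: "'b \<Rightarrow> 'c"
  assumes f: "integrable M1 f" and g: "integrable M2 g"
  shows "integrable (M1 \<Otimes>\<^sub>M M2) (\<lambda>(x, y). f x * g y)"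
    and "(\<integral>(x, y). f x * g y \<partial>(M1 \<Otimes>\<^sub>M M2)) = integral\<^sup>L M1 f * integral\<^sup>L M2 g"
proof -
  have [measurable]: "f \<in> borel_measurable M1" "g \<in> borel_measurable M2"
    using f g by auto
  show I: "integrable (M1 \<Otimes>\<^sub>M M2) (\<lambda>(x, y). f x * g y)"
    by (rule Fubini_integrable) (use f g in \<open>auto simp: norm_mult\<close>)
  show "(\<integral>(x, y). f x * g y \<partial>(M1 \<Otimes>\<^sub>M M2)) = integral\<^sup>L M1 f * integral\<^sup>L M2 g"
    using integral_fst'[OF I] by simp
qed

definition variance_kernel :: "complex \<Rightarrow> complex \<Rightarrow> real \<times> real \<Rightarrow> complex" where
  "variance_kernel a b = (\<lambda>(x, y). resolvent_product a (cnj b) x * resolvent_product a (cnj b) y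
     - resolvent_product a b x * resolvent_product a b y)"

lemma integral_variance_kernel:
  assumes a: "Im a > 0" and b: "Im b > 0"
  shows "integrable (lborel \<Otimes>\<^sub>M lborel) (variance_kernel a b)"
    and "integral\<^sup>L (lborel \<Otimes>\<^sub>M lborel) (variance_kernel a b) = of_real (4 * pi\<^sup>2) * (- 1 / (a - cnj b)\<^sup>2)"
proof -
  have kernel: "variance_kernel a b = (\<lambda>z. (case z of (x, y) \<Rightarrow> resolvent_product a (cnj b) x
      * resolvent_product a (cnj b) y)
      - (case z of (x, y) \<Rightarrow> resolvent_product a b x * resolvent_product a b y))"
    by (auto simp: variance_kernel_def)
  have int: "integrable lborel (resolvent_product a (cnj b))" "integrable lborel (resolvent_product a b)"
    using a b by (auto intro!: integrable_resolvent_product)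
  show "integrable (lborel \<Otimes>\<^sub>M lborel) (variance_kernel a b)"
    unfolding kernel by (intro Bochner_Integration.integrable_diff lborel_pair.integral_mult_pair(1) int)
  let ?I = "integral\<^sup>L lborel"
  have "integral\<^sup>L (lborel \<Otimes>\<^sub>M lborel) (variance_kernel a b) =
      ?I (resolvent_product a (cnj b)) * ?I (resolvent_product a (cnj b)) - ?I (resolvent_product a b)
          * ?I (resolvent_product a b)"
    unfolding kernel lborel_pair.integral_mult_pair(2)[OF int(1) int(1), symmetric]
        lborel_pair.integral_mult_pair(2)[OF int(2) int(2), symmetric]
    by (intro Bochner_Integration.integral_diff lborel_pair.integral_mult_pair(1) int)
  also have "\<dots> = (2 * complex_of_real pi * \<i>)\<^sup>2 / (a - cnj b)\<^sup>2"
    using a b by (simp add: integral_resolvent_product power2_eq_square)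
  also have "\<dots> = of_real (4 * pi\<^sup>2) * (- 1 / (a - cnj b)\<^sup>2)"
    by (simp add: power_mult_distrib)
  finally show "integral\<^sup>L (lborel \<Otimes>\<^sub>M lborel) (variance_kernel a b) = \<dots>" .
qed

lemma sum_Im_squared:
  fixes c :: "nat \<Rightarrow> real" and z :: "nat \<Rightarrow> complex"
  shows "(\<Sum>j<N. c j * Im (z j))\<^sup>2 = (\<Sum>i<N. \<Sum>j<N. c i * c j * (Re (z i * cnj (z j) - z i * z j) / 2))"
proof -
  have "(\<Sum>j<N. c j * Im (z j))\<^sup>2 = (\<Sum>i<N. \<Sum>j<N. c i * c j * (Im (z i) * Im (z j)))"
    by (simp only: power2_eq_square sum_product) (simp only: mult_ac)
  moreover have "Im u * Im w = Re (u * cnj w - u * w) / 2" for u w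
    by simp
  ultimately show ?thesis by (simp only:)
qed

definition resolvent_sum :: "nat \<Rightarrow> (nat \<Rightarrow> real) \<Rightarrow> (nat \<Rightarrow> complex) \<Rightarrow> real \<Rightarrow> real" where
  "resolvent_sum N c \<eta> x = (\<Sum>j<N. c j * Im (1 / (of_real x - \<eta> j)))"

lemma measurable_resolvent_sum [measurable]: "resolvent_sum N c \<eta> \<in> borel_measurable borel"
  unfolding resolvent_sum_def[abs_def] by measurable

lemma resolvent_sum_difference_quotient_squared:
  assumes \<eta>: "\<And>j. j < N \<Longrightarrow> Im (\<eta> j) \<noteq> 0" and "x \<noteq> y"
  shows "((resolvent_sum N c \<eta> x - resolvent_sum N c \<eta> y) / (x - y))\<^sup>2 =
         (\<Sum>i<N. \<Sum>j<N. c i * c j * (Re (variance_kernel (\<eta> i) (\<eta> j) (x, y)) / 2))"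
proof -
  define z where "z j = 1 / ((of_real x - \<eta> j) * (of_real y - \<eta> j))" for j
  have "resolvent_sum N c \<eta> x - resolvent_sum N c \<eta> y =
      (\<Sum>j<N. c j * (Im (1 / (of_real x - \<eta> j)) - Im (1 / (of_real y - \<eta> j))))"
    unfolding resolvent_sum_def by (simp add: right_diff_distrib sum_subtractf)
  also have "\<dots> = (\<Sum>j<N. - (x - y) * (c j * Im (z j)))"
  proof (intro sum.cong refl)
    fix j assume "j \<in> {..<N}"
    then have "1 / (of_real x - \<eta> j) - 1 / (of_real y - \<eta> j) = of_real (- (x - y)) * z j"
      using of_real_minus_nonreal_nonzero[OF \<eta>, of j] unfolding z_def by (simp add: divide_simps)
    from arg_cong[OF this, of Im]
    have "Im (1 / (of_real x - \<eta> j)) - Im (1 / (of_real y - \<eta> j)) = - (x - y) * Im (z j)"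
      by (simp only: minus_complex.sel times_complex.sel Re_complex_of_real Im_complex_of_real)
    then show "c j * (Im (1 / (of_real x - \<eta> j)) - Im (1 / (of_real y - \<eta> j))) =
        - (x - y) * (c j * Im (z j))"
      by simp
  qed
  finally have "(resolvent_sum N c \<eta> x - resolvent_sum N c \<eta> y) / (x - y) = - (\<Sum>j<N. c j * Im (z j))"
    using assms(2) by (simp add: sum_distrib_left[symmetric] divide_simps) (simp add: algebra_simps)
  moreover have "z i * cnj (z j) - z i * z j = variance_kernel (\<eta> i) (\<eta> j) (x, y)" for i j
    by (simp add: z_def variance_kernel_def resolvent_product_def mult_ac)
  ultimately show ?thesis
    by (simp only: power2_minus sum_Im_squared)
qed

lemma AE_lborel_pair_neq: "AE z in lborel \<Otimes>\<^sub>M lborel. fst z \<noteq> (snd z :: real)"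
proof (rule lborel_pair.AE_pair_measure)
  show "AE x in lborel. AE y in lborel. fst (x, y) \<noteq> snd (x, y :: real)"
  proof (rule AE_I2)
    fix x :: real
    show "AE y in lborel. fst (x, y) \<noteq> snd (x, y)"
      using AE_lborel_singleton[of x] by eventually_elim auto
  qed
qed measurable

lemma integral_scaled_Re_variance_kernel:
  assumes a: "Im a > 0" and b: "Im b > 0"
  shows "integrable (lborel \<Otimes>\<^sub>M lborel) (\<lambda>z. c * (Re (variance_kernel a b z) / 2))"
    and "(\<integral>z. c * (Re (variance_kernel a b z) / 2) \<partial>(lborel \<Otimes>\<^sub>M lborel)) =
         4 * pi\<^sup>2 * (c * (Re (- 1 / (a - cnj b)\<^sup>2) / 2))"
proof -
  note kernel = integral_variance_kernel[OF a b]
  show "integrable (lborel \<Otimes>\<^sub>M lborel) (\<lambda>z. c * (Re (variance_kernel a b z) / 2))"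
    by (intro integrable_mult_right integrable_divide integrable_Re kernel)
  have "(\<integral>z. c * (Re (variance_kernel a b z) / 2) \<partial>(lborel \<Otimes>\<^sub>M lborel)) =
      c * (Re (integral\<^sup>L (lborel \<Otimes>\<^sub>M lborel) (variance_kernel a b)) / 2)"
    using integral_Re[OF kernel(1)] by simp
  also have "Re (integral\<^sup>L (lborel \<Otimes>\<^sub>M lborel) (variance_kernel a b)) =
      4 * pi\<^sup>2 * Re (- 1 / (a - cnj b)\<^sup>2)"
    unfolding kernel(2) by (simp only: times_complex.sel Re_complex_of_real Im_complex_of_real)
  finally show "(\<integral>z. c * (Re (variance_kernel a b z) / 2) \<partial>(lborel \<Otimes>\<^sub>M lborel)) =
      4 * pi\<^sup>2 * (c * (Re (- 1 / (a - cnj b)\<^sup>2) / 2))"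
    by simp
qed

theorem sigma2_resolvent_sum:
  assumes \<eta>: "\<And>j. j < N \<Longrightarrow> Im (\<eta> j) > 0"
  shows "sigma2 (resolvent_sum N c \<eta>) = (\<Sum>i<N. \<Sum>j<N. c i * c j * (Re (- 1 / (\<eta> i - cnj (\<eta> j))\<^sup>2) / 2))"
proof -
  let ?P = "lborel \<Otimes>\<^sub>M lborel :: (real \<times> real) measure"
  let ?f = "resolvent_sum N c \<eta>"
  let ?K = "\<lambda>i j z. c i * c j * (Re (variance_kernel (\<eta> i) (\<eta> j) z) / 2)"
  have int: "integrable ?P (?K i j)" if "i < N" "j < N" for i j
    by (rule integral_scaled_Re_variance_kernel(1)[OF \<eta>[OF that(1)] \<eta>[OF that(2)]])
  have "integral\<^sup>L (lborel :: (real \<times> real) measure) (\<lambda>(x, y). ((?f x - ?f y) / (x - y))\<^sup>2) =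
      (\<integral>z. (\<Sum>i<N. \<Sum>j<N. ?K i j z) \<partial>?P)"
    unfolding lborel_prod[symmetric]
  proof (rule integral_cong_AE)
    have "integrable ?P (\<lambda>z. \<Sum>i<N. \<Sum>j<N. ?K i j z)"
      by (intro Bochner_Integration.integrable_sum int) auto
    then show "(\<lambda>z. \<Sum>i<N. \<Sum>j<N. ?K i j z) \<in> borel_measurable ?P" by simp
    have "Im (\<eta> j) \<noteq> 0" if "j < N" for j using \<eta>[OF that] by simp
    then show "AE z in ?P. (case z of (x, y) \<Rightarrow> ((?f x - ?f y) / (x - y))\<^sup>2) = (\<Sum>i<N. \<Sum>j<N. ?K i j z)"
      using AE_lborel_pair_neq by (auto elim!: eventually_mono
          simp: resolvent_sum_difference_quotient_squared)
  qed measurable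
  also have "\<dots> = (\<Sum>i<N. \<integral>z. (\<Sum>j<N. ?K i j z) \<partial>?P)"
    by (intro Bochner_Integration.integral_sum Bochner_Integration.integrable_sum int) auto
  also have "\<dots> = (\<Sum>i<N. \<Sum>j<N. integral\<^sup>L ?P (?K i j))"
    by (intro sum.cong refl Bochner_Integration.integral_sum int) auto
  also have "\<dots> = (\<Sum>i<N. \<Sum>j<N. 4 * pi\<^sup>2 * (c i * c j * (Re (- 1 / (\<eta> i - cnj (\<eta> j))\<^sup>2) / 2)))"
    by (intro sum.cong refl integral_scaled_Re_variance_kernel(2) \<eta>) auto
  also have "\<dots> = 4 * pi\<^sup>2 * (\<Sum>i<N. \<Sum>j<N. c i * c j * (Re (- 1 / (\<eta> i - cnj (\<eta> j))\<^sup>2) / 2))"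
    by (simp only: sum_distrib_left)
  finally show ?thesis
    by (simp add: sigma2_def)
qed

section \<open>Fourier coefficients of resolvents\<close>

text \<open>The branch near \<open>(-2, 2)\<close> for which the upper half-plane goes into the unit disc.\<close>

definition joukowsky_inv :: "complex \<Rightarrow> complex" where
  "joukowsky_inv w = (w - \<i> * csqrt (4 - w\<^sup>2)) / 2"

lemma joukowsky_inv_nonzero: "joukowsky_inv w \<noteq> 0"
  and joukowsky_joukowsky_inv: "joukowsky (joukowsky_inv w) = w"
proof -
  define r where "r = csqrt (4 - w\<^sup>2)"
  have "joukowsky_inv w * ((w + \<i> * r) / 2) = (w\<^sup>2 + r\<^sup>2) / 4"
    unfolding joukowsky_inv_def r_def[symmetric] by (simp add: field_simps power2_eq_square)
  also have "r\<^sup>2 = 4 - w\<^sup>2" unfolding r_def by simp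
  finally have inverse: "joukowsky_inv w * ((w + \<i> * r) / 2) = 1" by simp
  then show nz: "joukowsky_inv w \<noteq> 0" by auto
  then have "1 / joukowsky_inv w = (w + \<i> * r) / 2"
    using inverse by (simp add: field_simps)
  then show "joukowsky (joukowsky_inv w) = w"
    by (simp add: joukowsky_def joukowsky_inv_def r_def[symmetric] field_simps)
qed

lemma joukowsky_inv_bulk:
  assumes "-2 < x" "x < 2"
  shows "isCont joukowsky_inv (of_real x)" and "Im (joukowsky_inv (of_real x)) < 0"
    and "norm (joukowsky_inv (of_real x)) = 1"
proof -
  have "0 < (2 - x) * (2 + x)" using assms by simp
  then have pos: "0 < 4 - x\<^sup>2" by (simp add: power2_eq_square algebra_simps)
  have real: "4 - (complex_of_real x)\<^sup>2 = of_real (4 - x\<^sup>2)" by simp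
  have "4 - (complex_of_real x)\<^sup>2 \<notin> \<real>\<^sub>\<le>\<^sub>0"
    unfolding real using pos by (simp only: nonpos_Reals_of_real_iff not_le)
  then show "isCont joukowsky_inv (of_real x)"
    unfolding joukowsky_inv_def[abs_def] by (intro continuous_intros) auto
  have "csqrt (4 - (complex_of_real x)\<^sup>2) = of_real (sqrt (4 - x\<^sup>2))"
    unfolding real using pos by (subst csqrt_of_real_nonneg) auto
  then have eq: "joukowsky_inv (of_real x) = Complex (x / 2) (- sqrt (4 - x\<^sup>2) / 2)"
    by (simp add: joukowsky_inv_def complex_eq_iff)
  show "Im (joukowsky_inv (of_real x)) < 0"
    unfolding eq using pos by simp
  show "norm (joukowsky_inv (of_real x)) = 1"
    unfolding eq complex_norm using pos by (simp add: power_divide flip: add_divide_distrib)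
qed

lemma norm_le_1_minus_Im_joukowsky:
  assumes Im: "0 < Im (joukowsky p)" "Im p < 0" and p: "1 / 2 \<le> norm p"
  shows "norm p \<le> 1 - Im (joukowsky p) / 4"
proof -
  define m where "m = norm p"
  have m0: "0 < m" unfolding m_def using p by linarith
  have "Im (1 / p) = - Im p / m\<^sup>2"
    by (simp add: m_def Im_divide cmod_power2)
  then have eq: "Im (joukowsky p) = (- Im p) * (1 / m\<^sup>2 - 1)"
    by (simp add: joukowsky_def algebra_simps)
  have pos: "0 < 1 / m\<^sup>2 - 1"
    using Im zero_less_mult_pos[of "- Im p" "1 / m\<^sup>2 - 1"] unfolding eq by simp
  then have "m\<^sup>2 < 1" using m0 by (simp add: field_simps)
  then have m1: "m < 1" using m0 by (simp add: power2_less_1_iff)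
  have "- Im p \<le> m" unfolding m_def using abs_Im_le_cmod[of p] by linarith
  then have "Im (joukowsky p) \<le> m * (1 / m\<^sup>2 - 1)"
    unfolding eq using pos by (intro mult_right_mono) auto
  also have "\<dots> = (1 - m) * ((1 + m) / m)" using m0 by (simp add: field_simps power2_eq_square)
  also have "(1 + m) / m \<le> 4" using p m0 m1 by (simp add: m_def divide_le_eq)
  finally have "Im (joukowsky p) \<le> (1 - m) * 4" using m1 by (simp add: mult_left_mono)
  then show ?thesis unfolding m_def by argo
qed

lemma poisson_kernel_sums:
  fixes p :: complex
  assumes "norm p < 1"
  shows "(\<lambda>k. (if k = 0 then 0 else p ^ k) * of_real (2 * cos (real k * t))) sums
           ((1 - p\<^sup>2) / chebyshev_denom p (of_real (2 * cos t)) - 1)"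
proof -
  have lt: "norm (p * cis s) < 1" for s using assms by (simp add: norm_mult)
  note nz = one_minus_mult_cis_nonzero[OF assms]
  let ?D = "chebyshev_denom p (complex_of_real (2 * cos t))"
  have D: "?D \<noteq> 0"
    unfolding chebyshev_denom_cos using nz[of t] nz[of "- t"] by simp
  have "1 / (1 - p * cis t) + 1 / (1 - p * cis (- t)) = (2 - p * (cis t + cis (- t))) / ?D"
    unfolding chebyshev_denom_cos using nz[of t] nz[of "- t"] by (simp add: add_frac_eq algebra_simps)
  also have "\<dots> - 2 = (1 - p\<^sup>2) / ?D - 1"
    unfolding cis_add_cis_neg using D by (simp add: field_simps)
        (simp add: chebyshev_denom_def algebra_simps)
  finally have sum: "1 / (1 - p * cis t) + 1 / (1 - p * cis (- t)) - 2 = (1 - p\<^sup>2) / ?D - 1" .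
  have "(\<lambda>k. (p * cis t) ^ k + (p * cis (- t)) ^ k - (if k = 0 then 2 else 0)) sums
      (1 / (1 - p * cis t) + 1 / (1 - p * cis (- t)) - 2)"
    by (intro sums_diff sums_add geometric_sums lt sums_single)
  moreover have "(p * cis t) ^ k + (p * cis (- t)) ^ k - (if k = 0 then 2 else 0) =
      (if k = 0 then 0 else p ^ k) * of_real (2 * cos (real k * t))" for k
    unfolding power_mult_distrib Complex.DeMoivre distrib_left[symmetric] mult_minus_right cis_add_cis_neg
    by simp
  ultimately show ?thesis unfolding sum by simp
qed

definition resolvent_amplitude :: "complex \<Rightarrow> complex" where
  "resolvent_amplitude p = 1 / (p - 1 / p)"

lemma resolvent_cosine_series:
  assumes p: "p \<noteq> 0" "norm p < 1"
  shows "(\<lambda>k. (if k = 0 then 0 else Im (of_real e * resolvent_amplitude p * p ^ k))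
      * (2 * cos (real k * t))) sums
           (Im (of_real e / (of_real (2 * cos t) - joukowsky p)) - Im (of_real e * resolvent_amplitude p))"
proof -
  let ?D = "chebyshev_denom p (complex_of_real (2 * cos t))" and ?\<kappa> = "of_real e * resolvent_amplitude p"
  have "norm (p\<^sup>2) < 1" using p by (simp add: norm_power power_less_one_iff)
  then have p2: "1 - p\<^sup>2 \<noteq> 0" by auto
  have D: "?D = - p * (of_real (2 * cos t) - joukowsky p)"
    using p by (simp add: chebyshev_denom_eq_joukowsky algebra_simps)
  have amplitude: "resolvent_amplitude p = - p / (1 - p\<^sup>2)"
    using p p2 by (simp add: resolvent_amplitude_def divide_simps power2_eq_square)
        (simp add: algebra_simps)
  have "?\<kappa> * ((1 - p\<^sup>2) / ?D) = of_real e / (of_real (2 * cos t) - joukowsky p)"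
    unfolding amplitude D using p p2 by simp
  then have "?\<kappa> * ((1 - p\<^sup>2) / ?D - 1) = of_real e / (of_real (2 * cos t) - joukowsky p) - ?\<kappa>"
    by (simp only: right_diff_distrib mult_1_right)
  with sums_Im[OF sums_mult[OF poisson_kernel_sums[OF p(2), of t], of ?\<kappa>]]
  have "(\<lambda>k. Im (?\<kappa> * ((if k = 0 then 0 else p ^ k) * of_real (2 * cos (real k * t))))) sums
      (Im (of_real e / (of_real (2 * cos t) - joukowsky p)) - Im ?\<kappa>)"
    by (simp only: minus_complex.sel)
  moreover have "Im (?\<kappa> * ((if k = 0 then 0 else p ^ k) * of_real (2 * cos (real k * t)))) =
      (if k = 0 then 0 else Im (?\<kappa> * p ^ k)) * (2 * cos (real k * t))" for k
    unfolding mult.assoc[symmetric] by auto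
  ultimately show ?thesis by (simp only:)
qed

definition koebe :: "'a::field \<Rightarrow> 'a" where
  "koebe z = z / (1 - z)\<^sup>2"

lemma koebe_sums:
  fixes z :: "'a::{real_normed_field, banach}"
  assumes "norm z < 1"
  shows "(\<lambda>k. of_nat k * z ^ k) sums koebe z"
proof -
  have "(\<lambda>k. z * (of_nat (Suc k) * z ^ k)) sums (z * (1 / (1 - z)\<^sup>2))"
    by (intro sums_mult geometric_deriv_sums assms)
  then have "(\<lambda>k. of_nat (Suc k) * z ^ Suc k) sums koebe z"
    by (simp add: koebe_def mult_ac)
  from sums_Suc[OF this] show ?thesis by simp
qed

lemma sums_of_nat_Im_squared:
  fixes \<kappa> p :: "nat \<Rightarrow> complex" and c :: "nat \<Rightarrow> real"
  assumes p: "\<And>j. j < N \<Longrightarrow> norm (p j) < 1"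
  shows "(\<lambda>k. real k * (\<Sum>j<N. c j * Im (\<kappa> j * p j ^ k))\<^sup>2) sums
     (\<Sum>i<N. \<Sum>j<N. c i * c j *
        (Re (\<kappa> i * cnj (\<kappa> j) * koebe (p i * cnj (p j)) - \<kappa> i * \<kappa> j * koebe (p i * p j)) / 2))"
proof -
  define z where "z k j = \<kappa> j * p j ^ k" for k j
  have product: "(\<lambda>k. of_nat k * (a * q ^ k * (b * r ^ k))) sums (a * b * koebe (q * r))"
    if "norm q < 1" "norm r < 1" for a b q r :: complex
    using sums_mult[OF koebe_sums[of "q * r"], of "a * b"] norm_mult_less[OF that]
    by (simp add: power_mult_distrib mult_ac)
  have "(\<lambda>k. of_nat k * (z k i * cnj (z k j)) - of_nat k * (z k i * z k j)) sums
      (\<kappa> i * cnj (\<kappa> j) * koebe (p i * cnj (p j)) - \<kappa> i * \<kappa> j * koebe (p i * p j))"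
    if "i < N" "j < N" for i j
    unfolding z_def complex_cnj_mult complex_cnj_power using p that by (intro sums_diff product) auto
  then have "(\<lambda>k. \<Sum>i<N. \<Sum>j<N. c i * c j * (Re (of_nat k * (z k i * cnj (z k j)) - of_nat k
      * (z k i * z k j)) / 2)) sums
      (\<Sum>i<N. \<Sum>j<N. c i * c j * (Re (\<kappa> i * cnj (\<kappa> j) * koebe (p i * cnj (p j)) - \<kappa> i * \<kappa> j
          * koebe (p i * p j)) / 2))"
    by (intro sums_sum sums_mult sums_divide sums_Re) auto
  moreover have "(\<Sum>i<N. \<Sum>j<N. c i * c j * (Re (of_nat k * (z k i * cnj (z k j)) - of_nat k
      * (z k i * z k j)) / 2)) =
      real k * (\<Sum>j<N. c j * Im (\<kappa> j * p j ^ k))\<^sup>2" for k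
  proof -
    have "Re (of_nat k * (z k i * cnj (z k j)) - of_nat k * (z k i * z k j)) =
        real k * Re (z k i * cnj (z k j) - z k i * z k j)" for i j
    proof -
      have "of_nat k * (z k i * cnj (z k j)) - of_nat k * (z k i * z k j) =
          of_real (real k) * (z k i * cnj (z k j) - z k i * z k j)"
        by (simp add: right_diff_distrib)
      then show ?thesis
        by (simp only: times_complex.sel(1) Re_complex_of_real Im_complex_of_real)
    qed
    then show ?thesis
      unfolding z_def[symmetric] sum_Im_squared sum_distrib_left
      by (simp only: times_divide_eq_right mult.left_commute)
  qed
  ultimately show ?thesis by simp
qed

lemma koebe_mult_eq:
  fixes p q :: "'a::field"
  assumes "p \<noteq> 0" "q \<noteq> 0" "p \<noteq> q"
  shows "koebe (p * q) = (p - q)\<^sup>2 / (p * q * (joukowsky p - joukowsky q)\<^sup>2)"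
proof -
  have "p * q * (joukowsky p - joukowsky q)\<^sup>2 = (p - q)\<^sup>2 * (1 - p * q)\<^sup>2 / (p * q)"
    using assms by (simp add: joukowsky_diff power_mult_distrib power_divide power2_commute[of q p])
      (simp add: power2_eq_square)
  then show ?thesis
    using assms by (simp add: koebe_def)
qed

lemma tendsto_mesoscopic_koebe:
  fixes p q e :: "nat \<Rightarrow> complex" and u z h1 h2 :: complex
  assumes e: "\<forall>\<^sub>F n in sequentially. e n \<noteq> 0"
    and p: "\<And>n. joukowsky (p n) = z + e n * h1" "\<And>n. p n \<noteq> 0" "p \<longlonglongrightarrow> u"
    and q: "\<And>n. joukowsky (q n) = z + e n * h2" "\<And>n. q n \<noteq> 0" "q \<longlonglongrightarrow> 1 / u"
    and u: "u \<noteq> 0" "u \<noteq> 1 / u" and h: "h1 \<noteq> h2"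
  shows "(\<lambda>n. (e n * resolvent_amplitude (p n)) * (e n * resolvent_amplitude (q n)) * koebe (p n * q n))
           \<longlonglongrightarrow> - 1 / (h1 - h2)\<^sup>2"
proof -
  define G where "G n = (p n - q n)\<^sup>2 * resolvent_amplitude (p n) * resolvent_amplitude (q n)
      / (p n * q n * (h1 - h2)\<^sup>2)" for n
  have "G \<longlonglongrightarrow> (u - 1 / u)\<^sup>2 * (1 / (u - 1 / u)) * (1 / (1 / u - 1 / (1 / u))) / (u * (1 / u) * (h1 - h2)\<^sup>2)"
    unfolding G_def resolvent_amplitude_def using u h by (intro tendsto_intros p q) auto
  also have "(u - 1 / u)\<^sup>2 * (1 / (u - 1 / u)) * (1 / (1 / u - 1 / (1 / u))) / (u * (1 / u) * (h1 - h2)\<^sup>2) =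
      - 1 / (h1 - h2)\<^sup>2"
  proof -
    have "d\<^sup>2 * (1 / d) * (1 / (- d)) = - 1" if "d \<noteq> 0" for d :: complex
      using that by (simp add: power2_eq_square)
    from this[of "u - 1 / u"] show ?thesis using u by simp
  qed
  finally have G: "G \<longlonglongrightarrow> - 1 / (h1 - h2)\<^sup>2" .
  have "\<forall>\<^sub>F n in sequentially. p n - q n \<noteq> 0"
    using u by (intro tendsto_imp_eventually_ne[OF tendsto_diff[OF p(3) q(3)]]) auto
  with e have "\<forall>\<^sub>F n in sequentially. G n =
      (e n * resolvent_amplitude (p n)) * (e n * resolvent_amplitude (q n)) * koebe (p n * q n)"
  proof eventually_elim
    case (elim n)
    have "joukowsky (p n) - joukowsky (q n) = e n * (h1 - h2)"
      by (simp add: p(1) q(1) algebra_simps)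
    then have "koebe (p n * q n) = (p n - q n)\<^sup>2 / (p n * q n * (e n * (h1 - h2))\<^sup>2)"
      using elim p(2) q(2) by (simp add: koebe_mult_eq)
    then show ?case
      using elim by (simp add: G_def power_mult_distrib power2_eq_square[of "e n"] mult_ac)
  qed
  from Lim_transform_eventually[OF G this] show ?thesis .
qed

section \<open>Mesoscopic resolvent statistics\<close>

lemma mesoscopic_rate:
  fixes \<alpha> d :: real
  assumes "0 < \<alpha>" "\<alpha> < 1" "0 < d"
  shows "(\<lambda>n. real n * (1 - d * real n powr - \<alpha>) ^ n / (1 - (1 - d * real n powr - \<alpha>)) ^ 3) \<longlonglongrightarrow> 0"
proof (rule Lim_null_comparison)
  have "(\<lambda>n. d * real n powr - \<alpha>) \<longlonglongrightarrow> 0"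
    using assms by real_asymp
  then have "\<forall>\<^sub>F n in sequentially. d * real n powr - \<alpha> < 1"
    by (rule order_tendstoD) simp
  then show "\<forall>\<^sub>F n in sequentially. norm (real n * (1 - d * real n powr - \<alpha>) ^ n
      / (1 - (1 - d * real n powr - \<alpha>)) ^ 3) \<le>
      real n * exp (- d * real n powr (1 - \<alpha>)) / (d * real n powr - \<alpha>) ^ 3"
    using eventually_gt_at_top[of 0]
  proof eventually_elim
    case (elim n)
    define x where "x = d * real n powr - \<alpha>"
    have x: "0 < x" "x < 1" using elim assms by (auto simp: x_def)
    have "(1 - x) ^ n \<le> exp (- x) ^ n"
      using x exp_ge_add_one_self[of "- x"] by (intro power_mono) auto
    also have "\<dots> = exp (- (real n * x))" by (simp flip: exp_of_nat_mult)
    also have "real n * x = d * real n powr (1 - \<alpha>)"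
      using elim by (simp add: x_def powr_diff powr_minus divide_inverse)
    finally have "(1 - x) ^ n \<le> exp (- d * real n powr (1 - \<alpha>))" by simp
    then have "real n * (1 - x) ^ n / x ^ 3 \<le> real n * exp (- d * real n powr (1 - \<alpha>)) / x ^ 3"
      using x by (intro divide_right_mono mult_left_mono) auto
    moreover have "norm (real n * (1 - x) ^ n / (1 - (1 - x)) ^ 3) = real n * (1 - x) ^ n / x ^ 3"
      using x by simp
    ultimately show ?case unfolding x_def by simp
  qed
  show "(\<lambda>n. real n * exp (- d * real n powr (1 - \<alpha>)) / (d * real n powr - \<alpha>) ^ 3) \<longlonglongrightarrow> 0"
    using assms by real_asymp
qed

locale mesoscopic_resolvents =
  fixes x0 \<alpha> :: real and N :: nat and \<eta> :: "nat \<Rightarrow> complex" and c :: "nat \<Rightarrow> real"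
  assumes x0: "-2 < x0" "x0 < 2" and \<alpha>: "0 < \<alpha>" "\<alpha> < 1" and Im_\<eta>_pos: "j < N \<Longrightarrow> 0 < Im (\<eta> j)"
begin

definition scale :: "nat \<Rightarrow> real" where
  "scale n = real n powr - \<alpha>"

definition bulk_point :: complex where
  "bulk_point = joukowsky_inv (of_real x0)"

definition disc_point :: "nat \<Rightarrow> nat \<Rightarrow> complex" where
  "disc_point n j = joukowsky_inv (of_real x0 + of_real (scale n) * \<eta> j)"

definition amplitude :: "nat \<Rightarrow> nat \<Rightarrow> complex" where
  "amplitude n j = of_real (scale n) * resolvent_amplitude (disc_point n j)"

definition rescaled_sum :: "nat \<Rightarrow> real \<Rightarrow> real" where
  "rescaled_sum n u = resolvent_sum N c \<eta> (real n powr \<alpha> * (u - x0))"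

definition fourier_mean :: "nat \<Rightarrow> real" where
  "fourier_mean n = (\<Sum>j<N. c j * Im (amplitude n j))"

definition fourier_coeff :: "nat \<Rightarrow> nat \<Rightarrow> real" where
  "fourier_coeff n k = (if k = 0 then 0 else \<Sum>j<N. c j * Im (amplitude n j * disc_point n j ^ k))"

text \<open>\<open>16 = 4 \<cdot> 4\<close>: a factor from \<open>1 - Im / 4\<close> in \<open>norm_le_1_minus_Im_joukowsky\<close>, and the exponent in \<open>decay n ^ 4\<close>.\<close>

definition gap :: real where
  "gap = Min (insert 1 ((\<lambda>j. Im (\<eta> j)) ` {..<N})) / 16"

definition decay :: "nat \<Rightarrow> real" where
  "decay n = 1 - gap * scale n"

definition amplitude_bound :: real where
  "amplitude_bound = 2 * norm (resolvent_amplitude bulk_point)"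

lemma gap_pos: "0 < gap"
  unfolding gap_def using Im_\<eta>_pos by (simp add: Min_gr_iff)

lemma gap_le: "j < N \<Longrightarrow> 16 * gap \<le> Im (\<eta> j)"
  unfolding gap_def by simp

lemma scale_pos: "0 < n \<Longrightarrow> 0 < scale n"
  by (simp add: scale_def)

lemma scale_tendsto: "scale \<longlonglongrightarrow> 0"
  unfolding scale_def using \<alpha> by real_asymp

lemma eventually_scale_nonzero: "\<forall>\<^sub>F n in sequentially. complex_of_real (scale n) \<noteq> 0"
  using eventually_gt_at_top[of 0] by eventually_elim (simp add: scale_def)

lemma eventually_decay: "\<forall>\<^sub>F n in sequentially. 0 < decay n \<and> decay n < 1"
proof -
  have "(\<lambda>n. gap * scale n) \<longlonglongrightarrow> gap * 0"
    by (intro tendsto_intros scale_tendsto)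
  then have "\<forall>\<^sub>F n in sequentially. gap * scale n < 1"
    by (rule order_tendstoD) simp
  with eventually_gt_at_top[of 0] show ?thesis
    by eventually_elim (simp add: decay_def gap_pos scale_pos)
qed

lemma disc_point_nonzero: "disc_point n j \<noteq> 0"
  by (simp add: disc_point_def joukowsky_inv_nonzero)

lemma joukowsky_disc_point: "joukowsky (disc_point n j) = of_real x0 + of_real (scale n) * \<eta> j"
  by (simp only: disc_point_def joukowsky_joukowsky_inv)

lemma disc_point_tendsto: "(\<lambda>n. disc_point n j) \<longlonglongrightarrow> bulk_point"
proof -
  have "(\<lambda>n. of_real x0 + of_real (scale n) * \<eta> j) \<longlonglongrightarrow> of_real x0 + of_real 0 * \<eta> j"
    by (intro tendsto_intros scale_tendsto)
  then have "(\<lambda>n. of_real x0 + of_real (scale n) * \<eta> j) \<longlonglongrightarrow> of_real x0"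
    by simp
  with joukowsky_inv_bulk(1)[OF x0] show ?thesis
    unfolding disc_point_def bulk_point_def by (rule isCont_tendsto_compose)
qed

lemma bulk_point: "Im bulk_point < 0" "norm bulk_point = 1"
  using joukowsky_inv_bulk(2,3)[OF x0] by (simp_all add: bulk_point_def)

lemma cnj_bulk_point: "cnj bulk_point = 1 / bulk_point"
proof -
  have "bulk_point * cnj bulk_point = 1"
    using bulk_point(2) by (simp add: complex_norm_square[symmetric])
  moreover from this have "bulk_point \<noteq> 0" by auto
  ultimately show ?thesis
    by (simp add: eq_divide_eq mult.commute)
qed

lemma bulk_point_neq: "bulk_point \<noteq> 0" "bulk_point \<noteq> 1 / bulk_point"
  using bulk_point cnj_bulk_point by (auto simp: complex_eq_iff)

lemma resolvent_amplitude_disc_point_tendsto: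
  "(\<lambda>n. resolvent_amplitude (disc_point n j)) \<longlonglongrightarrow> resolvent_amplitude bulk_point"
  unfolding resolvent_amplitude_def using bulk_point_neq by (intro tendsto_intros disc_point_tendsto) auto

lemma amplitude_tendsto: "(\<lambda>n. amplitude n j) \<longlonglongrightarrow> 0"
proof -
  have "(\<lambda>n. amplitude n j) \<longlonglongrightarrow> of_real 0 * resolvent_amplitude bulk_point"
    unfolding amplitude_def by (intro tendsto_intros scale_tendsto resolvent_amplitude_disc_point_tendsto)
  then show ?thesis by simp
qed

lemma amplitude_bound_pos: "0 < amplitude_bound"
  using bulk_point_neq by (simp add: amplitude_bound_def resolvent_amplitude_def)

lemma norm_disc_point_le:
  assumes "0 < n" "j < N" "gap * scale n \<le> 1"
    and p: "Im (disc_point n j) < 0" "1 / 2 \<le> norm (disc_point n j)"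
  shows "norm (disc_point n j) \<le> decay n ^ 4"
proof -
  have Im: "Im (joukowsky (disc_point n j)) = scale n * Im (\<eta> j)"
    by (simp add: joukowsky_disc_point)
  then have "0 < Im (joukowsky (disc_point n j))"
    using scale_pos[OF assms(1)] Im_\<eta>_pos[OF assms(2)] by simp
  from norm_le_1_minus_Im_joukowsky[OF this p] have "norm (disc_point n j) \<le> 1 - scale n * Im (\<eta> j) / 4"
    by (simp only: Im)
  also have "\<dots> \<le> 1 + real 4 * (- (gap * scale n))"
    using mult_left_mono[OF gap_le[OF assms(2)], of "scale n"] scale_pos[OF assms(1)] by (simp add: mult_ac)
  also have "\<dots> \<le> (1 + - (gap * scale n)) ^ 4"
    using assms(3) by (intro Bernoulli_inequality) simp
  finally show ?thesis by (simp add: decay_def)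
qed

lemma eventually_disc_point_amplitude_bounds:
  "\<forall>\<^sub>F n in sequentially. \<forall>j<N. norm (disc_point n j) \<le> decay n ^ 4 \<and>
      norm (amplitude n j) \<le> amplitude_bound * scale n"
proof -
  have "\<forall>\<^sub>F n in sequentially. \<forall>j\<in>{..<N}. Im (disc_point n j) < 0 \<and> 1 / 2 < norm (disc_point n j) \<and>
      norm (resolvent_amplitude (disc_point n j)) < amplitude_bound"
  proof (intro eventually_ball_finite finite_lessThan ballI eventually_conj)
    fix j
    show "\<forall>\<^sub>F n in sequentially. Im (disc_point n j) < 0"
      by (rule order_tendstoD(2)[OF tendsto_Im[OF disc_point_tendsto] bulk_point(1)])
    show "\<forall>\<^sub>F n in sequentially. 1 / 2 < norm (disc_point n j)"
      by (rule order_tendstoD(1)[OF tendsto_norm[OF disc_point_tendsto]]) (simp add: bulk_point)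
    show "\<forall>\<^sub>F n in sequentially. norm (resolvent_amplitude (disc_point n j)) < amplitude_bound"
      by (rule order_tendstoD(2)[OF tendsto_norm[OF resolvent_amplitude_disc_point_tendsto]])
         (use amplitude_bound_pos in \<open>simp add: amplitude_bound_def\<close>)
  qed
  with eventually_decay eventually_gt_at_top[of 0] show ?thesis
  proof eventually_elim
    case (elim n)
    show ?case
    proof (intro allI impI conjI)
      fix j assume "j < N"
      with elim show "norm (disc_point n j) \<le> decay n ^ 4"
        by (intro norm_disc_point_le) (auto simp: decay_def intro: less_imp_le)
      have "norm (amplitude n j) = norm (resolvent_amplitude (disc_point n j)) * scale n"
        using scale_pos[of n] elim by (simp add: amplitude_def norm_mult)
      also have "\<dots> \<le> amplitude_bound * scale n"
        using elim \<open>j < N\<close> scale_pos[of n] by (intro mult_right_mono) (auto intro: less_imp_le)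
      finally show "norm (amplitude n j) \<le> amplitude_bound * scale n" .
    qed
  qed
qed

lemma eventually_norm_disc_point_less_1: "\<forall>\<^sub>F n in sequentially. \<forall>j<N. norm (disc_point n j) < 1"
  using eventually_disc_point_amplitude_bounds eventually_decay
proof eventually_elim
  case (elim n)
  then have "decay n ^ 4 < 1" by (simp add: power_less_one_iff)
  with elim show ?case by (meson le_less_trans)
qed

definition coeff_bound :: real where
  "coeff_bound = (\<Sum>j<N. \<bar>c j\<bar>) * amplitude_bound / gap"

lemma eventually_abs_fourier_coeff_le:
  "\<forall>\<^sub>F n in sequentially. \<forall>k. \<bar>fourier_coeff n k\<bar> \<le> coeff_bound * (1 - decay n) * decay n ^ (4 * k)"
  using eventually_disc_point_amplitude_bounds eventually_decay
proof eventually_elim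
  case (elim n)
  have nonneg: "0 \<le> coeff_bound * (1 - decay n)"
    using elim gap_pos amplitude_bound_pos by (simp add: coeff_bound_def sum_nonneg)
  show ?case
  proof
    fix k
    have "\<bar>c j * Im (amplitude n j * disc_point n j ^ k)\<bar> \<le>
        \<bar>c j\<bar> * (amplitude_bound * scale n * (decay n ^ 4) ^ k)" if "j < N" for j
    proof -
      have "\<bar>Im (amplitude n j * disc_point n j ^ k)\<bar> \<le> norm (amplitude n j) * norm (disc_point n j) ^ k"
        using abs_Im_le_cmod[of "amplitude n j * disc_point n j ^ k"] by (simp only: norm_mult norm_power)
      also have "\<dots> \<le> amplitude_bound * scale n * (decay n ^ 4) ^ k"
        using elim that order_trans[OF norm_ge_zero, of "amplitude n j"]
        by (intro mult_mono power_mono) auto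
      finally show ?thesis
        unfolding abs_mult by (rule mult_left_mono) simp
    qed
    then have "(\<Sum>j<N. \<bar>c j * Im (amplitude n j * disc_point n j ^ k)\<bar>) \<le>
        (\<Sum>j<N. \<bar>c j\<bar> * (amplitude_bound * scale n * (decay n ^ 4) ^ k))"
      by (intro sum_mono) auto
    also have "\<dots> = coeff_bound * (1 - decay n) * decay n ^ (4 * k)"
      using gap_pos unfolding coeff_bound_def decay_def power_mult
      by (simp add: sum_distrib_right[symmetric])
    finally show "\<bar>fourier_coeff n k\<bar> \<le> coeff_bound * (1 - decay n) * decay n ^ (4 * k)"
      using nonneg elim order_trans[OF sum_abs] by (auto simp: fourier_coeff_def)
  qed
qed

lemma rescaled_resolvent:
  assumes "0 < n"
  shows "1 / (of_real (real n powr \<alpha> * (u - x0)) - \<eta> j) =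
         of_real (scale n) / (of_real u - joukowsky (disc_point n j))"
proof -
  have scale: "real n powr \<alpha> \<noteq> 0" "scale n = 1 / real n powr \<alpha>"
    using assms by (auto simp: scale_def powr_minus divide_inverse)
  have "of_real (real n powr \<alpha> * (u - x0)) - \<eta> j =
      of_real (real n powr \<alpha>) * (of_real u - (of_real x0 + of_real (scale n) * \<eta> j))"
    unfolding scale(2) using scale(1) by (simp add: field_simps)
  then show ?thesis
    unfolding joukowsky_disc_point scale(2) by simp
qed

lemma fourier_coeff_cosine_sums:
  assumes "0 < n" "\<And>j. j < N \<Longrightarrow> norm (disc_point n j) < 1"
  shows "(\<lambda>k. fourier_coeff n k * (2 * cos (real k * t))) sums
      (rescaled_sum n (2 * cos t) - fourier_mean n)"
proof -
  have "(\<lambda>k. \<Sum>j<N. c j * ((if k = 0 then 0 else Im (amplitude n j * disc_point n j ^ k))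
      * (2 * cos (real k * t)))) sums
     (\<Sum>j<N. c j * (Im (of_real (scale n) / (of_real (2 * cos t) - joukowsky (disc_point n j)))
         - Im (amplitude n j)))"
    unfolding amplitude_def
    by (intro sums_sum sums_mult resolvent_cosine_series disc_point_nonzero assms) auto
  moreover have "(\<Sum>j<N. c j * ((if k = 0 then 0 else Im (amplitude n j * disc_point n j ^ k))
      * (2 * cos (real k * t)))) =
     fourier_coeff n k * (2 * cos (real k * t))" for k
    by (cases "k = 0") (simp_all only: fourier_coeff_def sum_distrib_right mult.assoc if_True if_False,
        simp_all)
  moreover have "(\<Sum>j<N. c j * (Im (of_real (scale n) / (of_real (2 * cos t) - joukowsky (disc_point n j)))
      - Im (amplitude n j)))
      = rescaled_sum n (2 * cos t) - fourier_mean n"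
    unfolding rescaled_sum_def resolvent_sum_def fourier_mean_def rescaled_resolvent[OF assms(1)]
    by (simp only: right_diff_distrib sum_subtractf)
  ultimately show ?thesis by simp
qed

lemma eventually_analytic_symbol:
  "\<forall>\<^sub>F n in sequentially. analytic_symbol (\<lambda>u. rescaled_sum n u - fourier_mean n) (fourier_coeff n)
      (decay n) coeff_bound"
  using eventually_decay eventually_abs_fourier_coeff_le eventually_norm_disc_point_less_1
      eventually_gt_at_top[of 0]
proof eventually_elim
  case (elim n)
  show ?case
  proof
    show "(\<lambda>u. rescaled_sum n u - fourier_mean n) \<in> borel_measurable borel"
      unfolding rescaled_sum_def by measurable
  qed (use elim in \<open>auto simp: fourier_coeff_def[of n 0] intro!: fourier_coeff_cosine_sums\<close>)
qed

lemma koebe_mult_cnj_tendsto: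
  assumes "i < N" "j < N"
  shows "(\<lambda>n. amplitude n i * cnj (amplitude n j) * koebe (disc_point n i * cnj (disc_point n j)))
           \<longlonglongrightarrow> - 1 / (\<eta> i - cnj (\<eta> j))\<^sup>2"
proof -
  have neq: "\<eta> i \<noteq> cnj (\<eta> j)"
    using Im_\<eta>_pos[OF assms(1)] Im_\<eta>_pos[OF assms(2)] by (auto simp: complex_eq_iff)
  have joukowsky_cnj: "joukowsky (cnj (disc_point n j)) = of_real x0 + of_real (scale n) * cnj (\<eta> j)" for n
    using arg_cong[OF joukowsky_disc_point[of n j], of cnj] by (simp add: joukowsky_def)
  have cnj_tendsto: "(\<lambda>n. cnj (disc_point n j)) \<longlonglongrightarrow> 1 / bulk_point"
    unfolding cnj_bulk_point[symmetric] by (intro tendsto_cnj disc_point_tendsto)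
  have "(\<lambda>n. (of_real (scale n) * resolvent_amplitude (disc_point n i)) *
      (of_real (scale n) * resolvent_amplitude (cnj (disc_point n j)))
          * koebe (disc_point n i * cnj (disc_point n j)))
      \<longlonglongrightarrow> - 1 / (\<eta> i - cnj (\<eta> j))\<^sup>2"
    by (rule tendsto_mesoscopic_koebe[OF eventually_scale_nonzero joukowsky_disc_point disc_point_nonzero
          disc_point_tendsto joukowsky_cnj _ cnj_tendsto bulk_point_neq neq]) (simp add: disc_point_nonzero)
  then show ?thesis
    by (simp add: amplitude_def resolvent_amplitude_def)
qed

lemma koebe_mult_tendsto:
  "(\<lambda>n. amplitude n i * amplitude n j * koebe (disc_point n i * disc_point n j)) \<longlonglongrightarrow> 0"
proof -
  have "bulk_point * bulk_point \<noteq> 1"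
    using bulk_point_neq by (auto simp: field_simps)
  then have "(\<lambda>n. amplitude n i * amplitude n j * koebe (disc_point n i * disc_point n j)) \<longlonglongrightarrow>
      0 * 0 * koebe (bulk_point * bulk_point)"
    unfolding koebe_def by (intro tendsto_intros amplitude_tendsto disc_point_tendsto) auto
  then show ?thesis by simp
qed

lemma cosine_variance_tendsto: "(\<lambda>n. cosine_variance (fourier_coeff n)) \<longlonglongrightarrow> sigma2 (resolvent_sum N c \<eta>)"
proof -
  let ?V = "\<lambda>n. \<Sum>i<N. \<Sum>j<N. c i * c j * (Re (amplitude n i * cnj (amplitude n j)
      * koebe (disc_point n i * cnj (disc_point n j))
      - amplitude n i * amplitude n j * koebe (disc_point n i * disc_point n j)) / 2)"
  have "?V \<longlonglongrightarrow> (\<Sum>i<N. \<Sum>j<N. c i * c j * (Re (- 1 / (\<eta> i - cnj (\<eta> j))\<^sup>2 - 0) / 2))"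
    by (intro tendsto_sum tendsto_mult tendsto_const tendsto_divide tendsto_Re tendsto_diff
          koebe_mult_cnj_tendsto koebe_mult_tendsto) auto
  also have "(\<Sum>i<N. \<Sum>j<N. c i * c j * (Re (- 1 / (\<eta> i - cnj (\<eta> j))\<^sup>2 - 0) / 2)) =
      sigma2 (resolvent_sum N c \<eta>)"
    using sigma2_resolvent_sum[OF Im_\<eta>_pos] by simp
  finally have "?V \<longlonglongrightarrow> sigma2 (resolvent_sum N c \<eta>)" .
  moreover have "\<forall>\<^sub>F n in sequentially. ?V n = cosine_variance (fourier_coeff n)"
    using eventually_norm_disc_point_less_1
  proof eventually_elim
    case (elim n)
    have "?V n = (\<Sum>k. real k * (\<Sum>j<N. c j * Im (amplitude n j * disc_point n j ^ k))\<^sup>2)"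
      using elim by (intro sums_unique sums_of_nat_Im_squared) auto
    also have "\<dots> = cosine_variance (fourier_coeff n)"
      unfolding cosine_variance_def by (intro suminf_cong) (simp add: fourier_coeff_def)
    finally show ?case .
  qed
  ultimately show ?thesis by (rule Lim_transform_eventually)
qed

sublocale analytic_symbol_sequence rescaled_sum fourier_mean fourier_coeff decay coeff_bound
    "sigma2 (resolvent_sum N c \<eta>)"
proof
  show "rescaled_sum n \<in> borel_measurable borel" for n
    unfolding rescaled_sum_def by measurable
  show "(\<lambda>n. real n * decay n ^ n / (1 - decay n) ^ 3) \<longlonglongrightarrow> 0"
    unfolding decay_def scale_def by (rule mesoscopic_rate[OF \<alpha> gap_pos])
qed (rule eventually_analytic_symbol cosine_variance_tendsto)+

end

theorem theorem4p7:
  fixes x0 \<alpha> :: real and N :: nat and \<eta> :: "nat \<Rightarrow> complex" and c :: "nat \<Rightarrow> real"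
    and f :: "real \<Rightarrow> real"
  assumes "-2 < x0" "x0 < 2" "0 < \<alpha>" "\<alpha> < 1"
    and "\<And>j. j < N \<Longrightarrow> Im (\<eta> j) > 0"
    and "\<And>x. f x = (\<Sum>j<N. c j * Im (1 / (complex_of_real x - \<eta> j)))"
  shows "weak_conv_m
           (\<lambda>n. distr (ope n) borel
                  (\<lambda>x. lin_stat f \<alpha> x0 n x - integral\<^sup>L (ope n) (lin_stat f \<alpha> x0 n)))
           (gaussian0 (sigma2 f))"
proof -
  interpret mesoscopic_resolvents x0 \<alpha> N \<eta> c
    using assms(1-5) by unfold_locales
  have f: "f = resolvent_sum N c \<eta>"
    by (rule ext) (simp add: assms(6) resolvent_sum_def)
  have "lin_stat f \<alpha> x0 n = linear_statistic (rescaled_sum n) n" for n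
    by (rule ext) (simp add: f lin_stat_def linear_statistic_def rescaled_sum_def)
  then show ?thesis
    using weak_conv_linear_statistic unfolding f by simp
qed

end
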